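(* Let $\lambda\in\mathbb C$, $\lambda\ne0$. For $f,g\in\mathbb C[G]^{\mathfrak l}$, the multiplication $$f*_tg:=\sum_{\boldsymbol m\in\mathbb Z_+^n}\frac{(-t)^{|\boldsymbol m|}}{\prod_{i=1}^nm_i!\,\prod_{j=0}^{|\boldsymbol m|-1}(\lambda-jt)}\bigl(x_n^{m_n}\cdots x_1^{m_1}f\bigr)\cdot\bigl(y_n^{m_n}\cdots y_1^{m_1}g\bigr)$$ is a $U(\mathfrak{gl}(n+1))$-invariant star product on $\mathbb C[G]^{\mathfrak l}$ under the right co-regular action.
   Context: $G=GL(n+1)$ over $\mathbb C$, $\mathfrak g=\mathfrak{gl}(n+1)$, $\mathfrak l=\mathfrak{gl}(1)\oplus\mathfrak{gl}(n)\subset\mathfrak g$ (block diagonal, the $\mathfrak{gl}(1)$ block first). With $\alpha_1,\dots,\alpha_n$ the simple roots ($\alpha_2,\dots,\alpha_n$ being those of $\mathfrak l$), and $e_i$, $f_i$ the Chevalley generators, put $x_i=[e_1,[e_2,\dots[e_{i-1},e_i]\dots]]$ and $y_i=[f_i,[f_{i-1},\dots[f_2,f_1]\dots]]$ (the root vectors of weights $\pm(\alpha_1+\dots+\alpha_i)$; with the matrix units, $x_i=E_{1,i+1}$, $y_i=E_{i+1,1}$). $\mathbb C[G]$ is the algebra of polynomial functions on $G$; $\mathfrak g$ acts on it by left-invariant vector fields (left co-regular action), and $\mathbb C[G]^{\mathfrak l}$ is the subalgebra of $\mathfrak l$-invariants under this action; the elements $x_i,y_i$ in the formula act by left-invariant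 vector fields. The right co-regular action is the commuting action of $U(\mathfrak g)$, $(fu)(w)=f(uw)$ for $u,w\in U(\mathfrak g)$ (functions viewed as functionals on $U(\mathfrak g)$), i.e. by right-invariant vector fields. $\mathbb Z_+$ is the set of non-negative integers, $|\boldsymbol m|=m_1+\dots+m_n$, and $\cdot$ is the ordinary multiplication. A star product is an associative $\mathbb C[[t]]$-bilinear multiplication on $\mathbb C[G]^{\mathfrak l}[[t]]$ reducing to the ordinary one modulo $t$ (the coefficients are expanded as power series in $t$); it is invariant if it is equivariant with respect to the right co-regular action. *)

theory Defs
  imports
    "HOL-Analysis.Analysis"
    "HOL-Computational_Algebra.Formal_Power_Series"
    "HOL-Library.Poly_Mapping"
    "Jordan_Normal_Form.Determinant"
begin

section \<open>The group and its coordinate ring\<close>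

text \<open>Rows and columns are numbered from 0, as usual for this matrix type; so the matrix
  unit \<open>E\<^bsub>a,b\<^esub>\<close> in the numbering from 1 is \<open>mat_unit n (a - 1) (b - 1)\<close>.\<close>

definition GL :: "nat \<Rightarrow> complex mat set" where
  "GL N = {g \<in> carrier_mat N N. invertible_mat g}"

abbreviation gl :: "nat \<Rightarrow> complex mat set" where
  "gl N \<equiv> carrier_mat N N"

text \<open>\<open>\<complex>[GL(N)]\<close>, generated by the matrix entries and the inverse of the determinant. A function
  on the group is represented by its extension by 0 to the whole type, so that equality of
  functions on the group is equality of HOL functions; all generators below, including the
  constants, are therefore cut off outside the group.\<close>

inductive_set coord_ring :: "nat \<Rightarrow> (complex mat \<Rightarrow> complex) set" for N where
  const: "(\<lambda>g. if g \<in> GL N then c else 0) \<in> coord_ring N"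
| entry: "i < N \<Longrightarrow> j < N \<Longrightarrow> (\<lambda>g. if g \<in> GL N then g $$ (i, j) else 0) \<in> coord_ring N"
| inv_det: "(\<lambda>g. if g \<in> GL N then 1 / Determinant.det g else 0) \<in> coord_ring N"
| add: "f \<in> coord_ring N \<Longrightarrow> f' \<in> coord_ring N \<Longrightarrow> (\<lambda>g. f g + f' g) \<in> coord_ring N"
| mult: "f \<in> coord_ring N \<Longrightarrow> f' \<in> coord_ring N \<Longrightarrow> (\<lambda>g. f g * f' g) \<in> coord_ring N"


section \<open>Invariant vector fields\<close>

text \<open>The group is open in the space of all matrices, and the left-invariant (right-invariant)
  vector field of \<open>X\<close> has the value \<open>g X\<close> (\<open>X g\<close>) at \<open>g\<close>, being the velocity at \<open>s = 0\<close> of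
  \<open>g exp(s X)\<close> (\<open>exp(s X) g\<close>). On functions, \<open>X \<mapsto> left_vf N X\<close> is a left action of the Lie
  algebra and \<open>X \<mapsto> right_vf N X\<close> is a right action.\<close>

definition left_vf :: "nat \<Rightarrow> complex mat \<Rightarrow> (complex mat \<Rightarrow> complex) \<Rightarrow> complex mat \<Rightarrow> complex" where
  "left_vf N X f = (\<lambda>g. if g \<in> GL N then deriv (\<lambda>s. f (g + s \<cdot>\<^sub>m (g * X))) 0 else 0)"

definition right_vf :: "nat \<Rightarrow> complex mat \<Rightarrow> (complex mat \<Rightarrow> complex) \<Rightarrow> complex mat \<Rightarrow> complex" where
  "right_vf N X f = (\<lambda>g. if g \<in> GL N then deriv (\<lambda>s. f (g + s \<cdot>\<^sub>m (X * g))) 0 else 0)"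


section \<open>The Levi subalgebra and its invariants\<close>

definition levi :: "nat \<Rightarrow> complex mat set" where
  "levi n = {X \<in> gl (n + 1). \<forall>j\<in>{1..n}. X $$ (0, j) = 0 \<and> X $$ (j, 0) = 0}"

definition levi_invariants :: "nat \<Rightarrow> (complex mat \<Rightarrow> complex) set" where
  "levi_invariants n =
     {f \<in> coord_ring (n + 1). \<forall>X\<in>levi n. left_vf (n + 1) X f = (\<lambda>g. 0)}"


section \<open>The root vectors\<close>

definition mat_unit :: "nat \<Rightarrow> nat \<Rightarrow> nat \<Rightarrow> complex mat" where
  "mat_unit n a b = mat (n + 1) (n + 1) (\<lambda>(i, j). if i = a \<and> j = b then 1 else 0)"

definition lie_bracket :: "complex mat \<Rightarrow> complex mat \<Rightarrow> complex mat" where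
  "lie_bracket X Y = X * Y - Y * X"

definition chev_e :: "nat \<Rightarrow> nat \<Rightarrow> complex mat" where
  "chev_e n i = mat_unit n (i - 1) i"

definition chev_f :: "nat \<Rightarrow> nat \<Rightarrow> complex mat" where
  "chev_f n i = mat_unit n i (i - 1)"

text \<open>\<open>x\<^sub>i = [e\<^sub>1, [e\<^sub>2, \<dots> [e\<^bsub>i-1\<^esub>, e\<^sub>i] \<dots>]]\<close> and \<open>y\<^sub>i = [f\<^sub>i, [f\<^bsub>i-1\<^esub>, \<dots> [f\<^sub>2, f\<^sub>1] \<dots>]]\<close>, for
  \<open>1 \<le> i \<le> n\<close>.\<close>

definition root_x :: "nat \<Rightarrow> nat \<Rightarrow> complex mat" where
  "root_x n i = foldr (\<lambda>j Z. lie_bracket (chev_e n j) Z) [1..<i] (chev_e n i)"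

definition root_y :: "nat \<Rightarrow> nat \<Rightarrow> complex mat" where
  "root_y n i = fold (\<lambda>j Z. lie_bracket (chev_f n j) Z) [2..<i + 1] (chev_f n 1)"

lemma mat_unit_mult:
  "b \<le> n \<Longrightarrow> c \<le> n \<Longrightarrow>
     mat_unit n a b * mat_unit n c d = (if b = c then mat_unit n a d else 0\<^sub>m (n + 1) (n + 1))"
  by (rule eq_matI)
    (auto simp: mat_unit_def scalar_prod_def if_distrib[of "\<lambda>x. x * _"] if_distrib[of "\<lambda>x. _ * x"]
      sum.delta cong: if_cong)

lemma root_x_eq: "1 \<le> i \<Longrightarrow> i \<le> n \<Longrightarrow> root_x n i = mat_unit n 0 i"
proof -
  assume i: "1 \<le> i" "i \<le> n"
  have "k < i \<Longrightarrow> foldr (\<lambda>j Z. lie_bracket (chev_e n j) Z) [i - k..<i] (chev_e n i)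
          = mat_unit n (i - 1 - k) i" for k
  proof (induction k)
    case (Suc k)
    have "[i - Suc k..<i] = (i - Suc k) # [i - k..<i]"
      using Suc.prems by (subst upt_conv_Cons) (auto simp: Suc_diff_Suc)
    then show ?case
      using Suc i by (auto simp: lie_bracket_def chev_e_def mat_unit_mult)
        (auto simp: mat_unit_def intro!: eq_matI)
  qed (simp add: chev_e_def)
  from this[of "i - 1"] i show ?thesis by (simp add: root_x_def)
qed

lemma root_y_eq: "1 \<le> i \<Longrightarrow> i \<le> n \<Longrightarrow> root_y n i = mat_unit n i 0"
proof (induction i rule: dec_induct)
  case base
  show ?case by (simp add: root_y_def chev_f_def)
next
  case (step i)
  have "root_y n (Suc i) = lie_bracket (chev_f n (Suc i)) (root_y n i)"
    using step by (simp add: root_y_def)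
  then show ?case
    using step by (auto simp: lie_bracket_def chev_f_def mat_unit_mult)
      (auto simp: mat_unit_def intro!: eq_matI)
qed

text \<open>The action of \<open>Z\<^sub>n\<^bsup>m n\<^esup> \<cdots> Z\<^sub>1\<^bsup>m 1\<^esup>\<close>; the factor \<open>Z\<^sub>1\<^bsup>m 1\<^esup>\<close> acts first.\<close>

definition mono_act ::
  "nat \<Rightarrow> (nat \<Rightarrow> complex mat) \<Rightarrow> (nat \<Rightarrow> nat) \<Rightarrow> (complex mat \<Rightarrow> complex) \<Rightarrow> complex mat \<Rightarrow> complex" where
  "mono_act n Z m f = fold (\<lambda>i h. (left_vf (n + 1) (Z i) ^^ m i) h) [1..<n + 1] f"


section \<open>Formal power series in t\<close>

text \<open>A power series in \<open>t\<close> whose coefficients are functions on the group is represented as a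
  function with values in \<open>\<complex>[[t]]\<close>. The ordinary product of two such series is then the pointwise
  one, and multiplication by a scalar of \<open>\<complex>[[t]]\<close> is pointwise as well.\<close>

definition coeff_fun :: "nat \<Rightarrow> ('a \<Rightarrow> complex fps) \<Rightarrow> 'a \<Rightarrow> complex" where
  "coeff_fun k F = (\<lambda>g. fps_nth (F g) k)"

definition series_over :: "('a \<Rightarrow> complex) set \<Rightarrow> ('a \<Rightarrow> complex fps) set" where
  "series_over A = {F. \<forall>k. coeff_fun k F \<in> A}"

definition coeffwise ::
  "(('a \<Rightarrow> complex) \<Rightarrow> 'a \<Rightarrow> complex) \<Rightarrow> ('a \<Rightarrow> complex fps) \<Rightarrow> 'a \<Rightarrow> complex fps" where
  "coeffwise D F = (\<lambda>g. Abs_fps (\<lambda>k. D (coeff_fun k F) g))"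


section \<open>Star products\<close>

definition star_product ::
  "('a \<Rightarrow> complex) set \<Rightarrow> (('a \<Rightarrow> complex fps) \<Rightarrow> ('a \<Rightarrow> complex fps) \<Rightarrow> 'a \<Rightarrow> complex fps) \<Rightarrow> bool" where
  "star_product A S \<longleftrightarrow>
     (\<forall>F\<in>series_over A. \<forall>G\<in>series_over A. S F G \<in> series_over A) \<and>
     (\<forall>F\<in>series_over A. \<forall>F'\<in>series_over A. \<forall>G\<in>series_over A.
        S (\<lambda>g. F g + F' g) G = (\<lambda>g. S F G g + S F' G g)) \<and>
     (\<forall>F\<in>series_over A. \<forall>G\<in>series_over A. \<forall>G'\<in>series_over A.
        S F (\<lambda>g. G g + G' g) = (\<lambda>g. S F G g + S F G' g)) \<and>
     (\<forall>a. \<forall>F\<in>series_over A. \<forall>G\<in>series_over A.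
        S (\<lambda>g. a * F g) G = (\<lambda>g. a * S F G g) \<and>
        S F (\<lambda>g. a * G g) = (\<lambda>g. a * S F G g)) \<and>
     (\<forall>F\<in>series_over A. \<forall>G\<in>series_over A. \<forall>H\<in>series_over A.
        S (S F G) H = S F (S G H)) \<and>
     (\<forall>F\<in>series_over A. \<forall>G\<in>series_over A.
        coeff_fun 0 (S F G) = (\<lambda>g. coeff_fun 0 F g * coeff_fun 0 G g))"


section \<open>Invariance under the right co-regular action of \<open>U(gl(N))\<close>\<close>

text \<open>\<open>f (X\<^sub>1 \<cdots> X\<^sub>k) = (\<dots> (f X\<^sub>1) \<dots>) X\<^sub>k\<close>.\<close>

definition right_word ::
  "nat \<Rightarrow> complex mat list \<Rightarrow> (complex mat \<Rightarrow> complex) \<Rightarrow> complex mat \<Rightarrow> complex" where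
  "right_word N w f = fold (right_vf N) w f"

text \<open>An element of \<open>U(gl(N))\<close> is given by a representative: a formal linear combination \<open>u\<close> of words
  in elements of \<open>gl(N)\<close>.\<close>

definition U_reps :: "nat \<Rightarrow> (complex mat list \<Rightarrow>\<^sub>0 complex) set" where
  "U_reps N = {u. Poly_Mapping.keys u \<subseteq> lists (gl N)}"

definition right_U ::
  "nat \<Rightarrow> (complex mat list \<Rightarrow>\<^sub>0 complex) \<Rightarrow> (complex mat \<Rightarrow> complex) \<Rightarrow> complex mat \<Rightarrow> complex" where
  "right_U N u f = (\<lambda>g. \<Sum>w\<in>Poly_Mapping.keys u. Poly_Mapping.lookup u w * right_word N w f g)"

text \<open>\<open>\<Sum> S (F u\<^sub>(\<^sub>1\<^sub>)) (G u\<^sub>(\<^sub>2\<^sub>))\<close> for the coproduct of \<open>U(gl(N))\<close>: elements of the Lie algebra are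
  primitive, so the coproduct of \<open>X\<^sub>1 \<cdots> X\<^sub>k\<close> is the sum, over all \<open>J \<subseteq> {1,\<dots>,k}\<close>, of the tensor
  product of the subword with positions in \<open>J\<close> and the complementary subword.\<close>

definition right_U_coprod ::
  "nat \<Rightarrow> (complex mat list \<Rightarrow>\<^sub>0 complex) \<Rightarrow>
   ((complex mat \<Rightarrow> complex fps) \<Rightarrow> (complex mat \<Rightarrow> complex fps) \<Rightarrow> complex mat \<Rightarrow> complex fps) \<Rightarrow>
   (complex mat \<Rightarrow> complex fps) \<Rightarrow> (complex mat \<Rightarrow> complex fps) \<Rightarrow> complex mat \<Rightarrow> complex fps" where
  "right_U_coprod N u S F G = (\<lambda>g. \<Sum>w\<in>Poly_Mapping.keys u. fps_const (Poly_Mapping.lookup u w) *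
     (\<Sum>J\<in>Pow {..<length w}.
        S (coeffwise (right_word N (nths w J)) F) (coeffwise (right_word N (nths w (- J))) G) g))"

definition right_U_invariant ::
  "nat \<Rightarrow> (complex mat \<Rightarrow> complex) set \<Rightarrow>
   ((complex mat \<Rightarrow> complex fps) \<Rightarrow> (complex mat \<Rightarrow> complex fps) \<Rightarrow> complex mat \<Rightarrow> complex fps) \<Rightarrow> bool" where
  "right_U_invariant N A S \<longleftrightarrow>
     (\<forall>u\<in>U_reps N. \<forall>f\<in>A. right_U N u f \<in> A) \<and>
     (\<forall>u\<in>U_reps N. \<forall>F\<in>series_over A. \<forall>G\<in>series_over A.
        coeffwise (right_U N u) (S F G) = right_U_coprod N u S F G)"


section \<open>The multiplication\<close>

definition multi_indices :: "nat \<Rightarrow> (nat \<Rightarrow> nat) set" where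
  "multi_indices n = {m. \<forall>i. i \<notin> {1..n} \<longrightarrow> m i = 0}"

definition mdeg :: "nat \<Rightarrow> (nat \<Rightarrow> nat) \<Rightarrow> nat" where
  "mdeg n m = (\<Sum>i=1..n. m i)"

definition star_coeff :: "nat \<Rightarrow> complex \<Rightarrow> (nat \<Rightarrow> nat) \<Rightarrow> complex fps" where
  "star_coeff n lambda m =
     (- fps_X) ^ mdeg n m /
     (of_nat (\<Prod>i=1..n. fact (m i)) *
      (\<Prod>j<mdeg n m. fps_const lambda - of_nat j * fps_X))"

lemma star_coeff_eq_0:
  assumes "lambda \<noteq> 0" "k < mdeg n m"
  shows "fps_nth (star_coeff n lambda m) k = 0"
proof -
  let ?d = "of_nat (\<Prod>i=1..n. fact (m i)) *
      (\<Prod>j<mdeg n m. fps_const lambda - of_nat j * fps_X) :: complex fps"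
  have "fps_nth (\<Prod>j<r. fps_const lambda - of_nat j * fps_X) 0 = lambda ^ r" for r
    by (induction r) (auto simp: mult.commute)
  then have "fps_nth ?d 0 \<noteq> 0"
    using assms(1) by (simp flip: of_nat_prod)
  then have "star_coeff n lambda m = fps_X ^ mdeg n m * ((- 1) ^ mdeg n m * inverse ?d)"
    unfolding star_coeff_def by (simp add: fps_divide_unit power_minus[of fps_X] mult_ac)
  then show ?thesis
    using assms(2) by (simp add: fps_X_power_mult_nth)
qed

lemma finite_multi_indices: "finite {m \<in> multi_indices n. mdeg n m \<le> k}"
proof (rule finite_subset)
  show "{m \<in> multi_indices n. mdeg n m \<le> k} \<subseteq>
    {m. (\<forall>i\<in>{1..n}. m i \<in> {..k}) \<and> (\<forall>i. i \<notin> {1..n} \<longrightarrow> m i = 0)}"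
    unfolding multi_indices_def mdeg_def
    by (auto intro: order_trans[OF member_le_sum])
  show "finite {m. (\<forall>i\<in>{1..n}. m i \<in> {..k}) \<and> (\<forall>i. i \<notin> {1..n} \<longrightarrow> m i = (0::nat))}"
    using finite_set_of_finite_funs[of "{1..n}" "{..k}" 0] by (rule rev_finite_subset) auto
qed

text \<open>The series \<open>f *\<^sub>t g\<close> for functions \<open>f\<close>, \<open>g\<close>. By \<open>star_coeff_eq_0\<close>, only multi-indices of degree at
  most \<open>k\<close> contribute to the coefficient of \<open>t\<^sup>k\<close>, so the sum over all multi-indices is truncated
  there.\<close>

definition star_fun ::
  "nat \<Rightarrow> complex \<Rightarrow> (complex mat \<Rightarrow> complex) \<Rightarrow> (complex mat \<Rightarrow> complex) \<Rightarrow> complex mat \<Rightarrow> complex fps" where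
  "star_fun n lambda f g = (\<lambda>h. Abs_fps (\<lambda>k.
     \<Sum>m\<in>{m \<in> multi_indices n. mdeg n m \<le> k}.
       fps_nth (star_coeff n lambda m) k *
       (mono_act n (root_x n) m f h * mono_act n (root_y n) m g h)))"

text \<open>The \<open>\<complex>[[t]]\<close>-bilinear extension to series: \<open>\<Sum> i j. t\<^bsup>i+j\<^esup> (F\<^sub>i *\<^sub>t G\<^sub>j)\<close>.\<close>

definition star ::
  "nat \<Rightarrow> complex \<Rightarrow> (complex mat \<Rightarrow> complex fps) \<Rightarrow> (complex mat \<Rightarrow> complex fps) \<Rightarrow> complex mat \<Rightarrow> complex fps" where
  "star n lambda F G = (\<lambda>h. Abs_fps (\<lambda>k.
     \<Sum>(i, j)\<in>{(i, j). i + j \<le> k}.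
       fps_nth (star_fun n lambda (coeff_fun i F) (coeff_fun j G) h) (k - (i + j))))"

end

theory Submission
  imports Defs "HOL-Library.Function_Algebras"
begin

text \<open>Write \<open>\<Omega>\<close> for the operator \<open>\<Sum>\<^sub>i x\<^sub>i \<otimes> y\<^sub>i\<close> on tensor products of functions. By the multinomial
  theorem the degree \<open>d\<close> part of \<open>f *\<^sub>t g\<close> is \<open>c\<^sub>d/d!\<close> times the product of the two factors of
  \<open>\<Omega>\<^sup>d (f \<otimes> g)\<close>, where \<open>c\<^sub>d = (-t)\<^sup>d / \<Prod>\<^bsub>j<d\<^esub> (\<lambda> - j t)\<close>. Every derivation annihilating \<open>\<Omega>\<close>, in
  particular every element of \<open>\<ll>\<close> and every right-invariant field, is therefore a derivation of
  the star product.

  On \<open>f \<otimes> g \<otimes> h\<close> the two bracketings of the product are the sums with coefficients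
  \<open>c\<^sub>a c\<^sub>b/(a! b!)\<close> of \<open>(\<Omega>\<^sub>1\<^sub>3 + \<Omega>\<^sub>2\<^sub>3)\<^sup>a \<Omega>\<^sub>1\<^sub>2\<^sup>b\<close> and of \<open>(\<Omega>\<^sub>1\<^sub>2 + \<Omega>\<^sub>1\<^sub>3)\<^sup>a \<Omega>\<^sub>2\<^sub>3\<^sup>b\<close>. Up to the central
  operator \<open>\<Omega>\<^sub>1\<^sub>3\<close>, the operators \<open>\<Omega>\<^sub>2\<^sub>3\<close>, \<open>\<Omega>\<^sub>1\<^sub>2\<close> and their commutator form an \<open>\<ss>\<ll>\<^sub>2\<close>-triple, and the
  commutator annihilates \<open>f \<otimes> g \<otimes> h\<close> because \<open>g\<close> is \<open>\<ll>\<close>-invariant. After normal ordering,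
  associativity is a Vandermonde identity for the \<open>c\<^sub>d\<close>.\<close>


section \<open>Derivations of algebras of functions\<close>

text \<open>Tensor products are never formed. A tensor f \<otimes> g \<otimes> h enters only through
  functionals additive in each of three arguments, on which the operators of the tensor legs act by
  precomposition. This reverses compositions, and the invariance of g turns into weight 0 of the
  evaluation at (f, g, h). The functional to which everything is applied is the threefold product at
  a point.

  Only one bracketing comes out in normal order. In the other one, each crossing trades an operator
  on the legs (1,2) and one on the legs (2,3) for a single operator on the legs (1,3), so the number
  of operators drops while the order in t of the coefficients stays. The denominators \<lambda> - j
  t compensate exactly this: the recursion c_{k+1} (\<lambda> - k t) = - t c_k relates coefficients
  of neighbouring degrees.

  All functions take values in the power series ring from the start, and each order in t is compared
  through finite partial sums. Vector fields are treated as derivations determined by their values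
  on the matrix entries, which reduces relations between fields to matrix identities.\<close>

definition function_algebra :: "('p \<Rightarrow> 'r::comm_ring_1) set \<Rightarrow> bool" where
  "function_algebra A \<longleftrightarrow> (\<lambda>p. 0) \<in> A \<and>
     (\<forall>f\<in>A. \<forall>g\<in>A. (\<lambda>p. f p + g p) \<in> A) \<and>
     (\<forall>c. \<forall>f\<in>A. (\<lambda>p. c * f p) \<in> A) \<and>
     (\<forall>f\<in>A. \<forall>g\<in>A. (\<lambda>p. f p * g p) \<in> A)"

definition derivation_on ::
  "('p \<Rightarrow> 'r::comm_ring_1) set \<Rightarrow> (('p \<Rightarrow> 'r) \<Rightarrow> 'p \<Rightarrow> 'r) \<Rightarrow> bool" where
  "derivation_on A D \<longleftrightarrow> (\<forall>f\<in>A. D f \<in> A) \<and>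
     (\<forall>f\<in>A. \<forall>g\<in>A. D (\<lambda>p. f p + g p) = (\<lambda>p. D f p + D g p)) \<and>
     (\<forall>c. \<forall>f\<in>A. D (\<lambda>p. c * f p) = (\<lambda>p. c * D f p)) \<and>
     (\<forall>f\<in>A. \<forall>g\<in>A. D (\<lambda>p. f p * g p) = (\<lambda>p. D f p * g p + f p * D g p))"

lemma
  assumes "function_algebra A"
  shows function_algebra_zero: "(\<lambda>p. 0) \<in> A"
    and function_algebra_add: "f \<in> A \<Longrightarrow> g \<in> A \<Longrightarrow> (\<lambda>p. f p + g p) \<in> A"
    and function_algebra_scale: "f \<in> A \<Longrightarrow> (\<lambda>p. c * f p) \<in> A"
    and function_algebra_mult: "f \<in> A \<Longrightarrow> g \<in> A \<Longrightarrow> (\<lambda>p. f p * g p) \<in> A"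
  using assms unfolding function_algebra_def by blast+

lemma function_algebra_sum:
  assumes "function_algebra A" "\<And>i. i \<in> I \<Longrightarrow> F i \<in> A"
  shows "(\<lambda>p. \<Sum>i\<in>I. F i p) \<in> A"
  using assms(2)
  by (induction I rule: infinite_finite_induct)
    (auto intro: function_algebra_zero function_algebra_add assms(1))

lemma
  assumes "derivation_on A D"
  shows derivation_mem: "f \<in> A \<Longrightarrow> D f \<in> A"
    and derivation_add: "f \<in> A \<Longrightarrow> g \<in> A \<Longrightarrow> D (\<lambda>p. f p + g p) = (\<lambda>p. D f p + D g p)"
    and derivation_scale: "f \<in> A \<Longrightarrow> D (\<lambda>p. c * f p) = (\<lambda>p. c * D f p)"
    and derivation_mult: "f \<in> A \<Longrightarrow> g \<in> A \<Longrightarrow> D (\<lambda>p. f p * g p) = (\<lambda>p. D f p * g p + f p * D g p)"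
  using assms unfolding derivation_on_def by blast+

lemma derivation_zero:
  assumes "function_algebra A" "derivation_on A D"
  shows "D (\<lambda>p. 0) = (\<lambda>p. 0)"
  using derivation_scale[OF assms(2) function_algebra_zero[OF assms(1)], of 0] by simp

lemma derivation_sum:
  assumes "function_algebra A" "derivation_on A D" "\<And>i. i \<in> I \<Longrightarrow> F i \<in> A"
  shows "D (\<lambda>p. \<Sum>i\<in>I. F i p) = (\<lambda>p. \<Sum>i\<in>I. D (F i) p)"
  using assms(3)
proof (induction I rule: infinite_finite_induct)
  case (insert i I)
  then show ?case
    using derivation_add[OF assms(2), of "F i" "\<lambda>p. \<Sum>i\<in>I. F i p"]
      function_algebra_sum[OF assms(1), of I F] by auto
qed (simp_all add: derivation_zero[OF assms(1,2)])

text \<open>The mixed products of first derivatives cancel. As a derivation in its own right, a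
  commutator of vector fields can be compared with another derivation on generators alone.\<close>

lemma derivation_on_commutator:
  assumes A: "function_algebra A" and D: "derivation_on A D" and E: "derivation_on A E"
  shows "derivation_on A (\<lambda>f p. D (E f) p - E (D f) p)"
proof -
  have "(\<lambda>p. f p - g p) \<in> A" if "f \<in> A" "g \<in> A" for f g
    using function_algebra_add[OF A that(1) function_algebra_scale[OF A that(2), of "-1"]] by simp
  then show ?thesis
    unfolding derivation_on_def
    using derivation_mem[OF D] derivation_mem[OF E] function_algebra_mult[OF A]
    by (auto simp: derivation_add[OF D] derivation_add[OF E] derivation_scale[OF D]
        derivation_scale[OF E] derivation_mult[OF D] derivation_mult[OF E]
        algebra_simps fun_eq_iff)
qed

lemma derivation_on_linear_combination:
  assumes A: "function_algebra A" and D: "\<And>i. i \<in> I \<Longrightarrow> derivation_on A (D i)"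
  shows "derivation_on A (\<lambda>f p. \<Sum>i\<in>I. a i * D i f p)"
  unfolding derivation_on_def
proof (intro conjI ballI allI)
  fix f assume "f \<in> A"
  then show "(\<lambda>p. \<Sum>i\<in>I. a i * D i f p) \<in> A"
    by (intro function_algebra_sum[OF A] function_algebra_scale[OF A] derivation_mem[OF D])
qed (auto simp: derivation_add[OF D] derivation_scale[OF D] derivation_mult[OF D] fun_eq_iff
    sum.distrib sum_distrib_left sum_distrib_right algebra_simps intro!: sum.cong)


section \<open>Vector fields on the general linear group\<close>

lemma GL_iff: "g \<in> GL N \<longleftrightarrow> g \<in> carrier_mat N N \<and> Determinant.det g \<noteq> 0"
proof safe
  assume g: "g \<in> carrier_mat N N" and d: "Determinant.det g \<noteq> 0"
  from det_non_zero_imp_unit[OF g d, of "()"] obtain B where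
    "B \<in> carrier_mat N N" "B * g = 1\<^sub>m N" "g * B = 1\<^sub>m N"
    unfolding Units_def ring_mat_def by auto
  with g show "g \<in> GL N"
    unfolding GL_def invertible_mat_def inverts_mat_def by auto
next
  assume "g \<in> GL N" and d: "Determinant.det g = 0"
  then obtain B where B: "g \<in> carrier_mat N N" "inverts_mat g B" "inverts_mat B g"
    unfolding GL_def invertible_mat_def by auto
  \<comment> \<open>The size of \<open>B\<close> is not given: g * B = 1 fixes its number of columns
    and B * g = 1 its number of rows.\<close>
  then have "B \<in> carrier_mat N N"
    unfolding inverts_mat_def
    by (metis carrier_matD(1,2) carrier_matI index_mult_mat(2,3) index_one_mat(2,3))
  with B have "Determinant.det g * Determinant.det B = 1"
    by (metis carrier_matD(1) det_mult det_one inverts_mat_def)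
  with d show False by simp
qed (simp add: GL_def)

lemma GL_carrier: "g \<in> GL N \<Longrightarrow> g \<in> carrier_mat N N"
  by (simp add: GL_iff)

text \<open>By the permutation expansion, the determinant along a line is a polynomial in the
  parameter.\<close>

lemma det_line_holomorphic:
  assumes "g \<in> carrier_mat N N" "Z \<in> carrier_mat N N"
  shows "(\<lambda>s. Determinant.det (g + s \<cdot>\<^sub>m Z)) holomorphic_on UNIV"
proof -
  have "Determinant.det (g + s \<cdot>\<^sub>m Z) =
      (\<Sum>p | p permutes {0..<N}. of_int (sign p) * (\<Prod>i = 0..<N. g $$ (i, p i) + s * Z $$ (i, p i)))" for s
    using assms
    by (subst det_def'[of _ N]) (auto intro!: sum.cong prod.cong dest: permutes_in_image)
  then show ?thesis
    by (simp only:) (intro holomorphic_intros)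
qed

text \<open>Openness of the group along a line. It makes the extension by 0 invisible to derivatives
  at points of the group.\<close>

lemma GL_line_eventually:
  assumes "g \<in> GL N" "Z \<in> carrier_mat N N"
  shows "\<forall>\<^sub>F s in nhds 0. g + s \<cdot>\<^sub>m Z \<in> GL N"
proof -
  let ?d = "\<lambda>s. Determinant.det (g + s \<cdot>\<^sub>m Z)"
  have g: "g \<in> carrier_mat N N" using assms(1) by (simp add: GL_iff)
  have 0: "g + 0 \<cdot>\<^sub>m Z = g" using g assms(2) by (intro eq_matI) auto
  have "isCont ?d 0"
    using holomorphic_on_imp_continuous_on[OF det_line_holomorphic[OF g assms(2)]]
    by (simp add: continuous_on_eq_continuous_at)
  then have "(?d \<longlongrightarrow> ?d 0) (nhds 0)" by (simp add: isCont_def tendsto_nhds_iff)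
  then have "\<forall>\<^sub>F s in nhds 0. ?d s \<noteq> 0"
    using assms(1) by (intro tendsto_imp_eventually_ne[of ?d "?d 0"]) (auto simp: 0 GL_iff)
  then show ?thesis
    by eventually_elim (use g assms(2) in \<open>auto simp: GL_iff\<close>)
qed

lemma coord_ring_eq_0: "f \<in> coord_ring N \<Longrightarrow> g \<notin> GL N \<Longrightarrow> f g = 0"
  by (induction rule: coord_ring.induct) auto

text \<open>\<open>deriv\<close> is a total operator whose sum and product rules presuppose
  differentiability; this supplies that condition for all Leibniz rules below.\<close>

lemma coord_ring_differentiable:
  assumes "f \<in> coord_ring N" "g \<in> GL N" "Z \<in> carrier_mat N N"
  shows "(\<lambda>s. f (g + s \<cdot>\<^sub>m Z)) field_differentiable at 0"
proof -
  have g: "g \<in> carrier_mat N N" using assms(2) by (simp add: GL_iff)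
  have 0: "g + 0 \<cdot>\<^sub>m Z = g" using g assms(3) by (intro eq_matI) auto
  note ev = GL_line_eventually[OF assms(2,3)]
  have cut: "(\<lambda>s. if g + s \<cdot>\<^sub>m Z \<in> GL N then F s else 0) field_differentiable at 0"
    if F: "F field_differentiable at 0" for F :: "complex \<Rightarrow> complex"
  proof -
    from ev have "\<forall>\<^sub>F s in nhds 0. F s = (if g + s \<cdot>\<^sub>m Z \<in> GL N then F s else 0)"
      by eventually_elim simp
    from DERIV_cong_ev[OF refl this refl] F show ?thesis
      unfolding field_differentiable_def by blast
  qed
  have dd: "(\<lambda>s. Determinant.det (g + s \<cdot>\<^sub>m Z)) field_differentiable at 0"
    using det_line_holomorphic[OF g assms(3)] by (simp add: holomorphic_on_def)
  show ?thesis using assms(1)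
  proof (induction rule: coord_ring.induct)
    case (const c)
    show ?case by (rule cut) (rule field_differentiable_const)
  next
    case (entry i j)
    have "(\<lambda>s. g $$ (i, j) + s * Z $$ (i, j)) field_differentiable at 0"
      by (intro derivative_intros)
    then have "(\<lambda>s. (g + s \<cdot>\<^sub>m Z) $$ (i, j)) field_differentiable at 0"
      using entry g assms(3) by simp
    then show ?case by (rule cut)
  next
    case inv_det
    have "(\<lambda>s. 1 / Determinant.det (g + s \<cdot>\<^sub>m Z)) field_differentiable at 0"
      using dd assms(2) by (intro field_differentiable_divide derivative_intros) (auto simp: 0 GL_iff)
    then show ?case by (rule cut)
  qed (auto intro: field_differentiable_add field_differentiable_mult)
qed

lemma function_algebra_coord_ring: "function_algebra (coord_ring N)"
proof -
  have "(\<lambda>g. c * f g) \<in> coord_ring N" if "f \<in> coord_ring N" for c f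
  proof -
    have "(\<lambda>g. c * f g) = (\<lambda>g. (if g \<in> GL N then c else 0) * f g)"
      using coord_ring_eq_0[OF that] by auto
    then show ?thesis using coord_ring.mult[OF coord_ring.const that] by simp
  qed
  then show ?thesis
    using coord_ring.const[of N 0]
    by (auto simp: function_algebra_def intro: coord_ring.intros)
qed

text \<open>The determinant is a polynomial in the entries. The closure conditions deliberately omit
  1/det: in the applications, \<open>S\<close> is the set where two derivations agree or the set
  mapped into the ring, and its membership for 1/det is only derived afterwards, from that of
  det.\<close>

lemma det_mem_generated:
  assumes const: "\<And>c. (\<lambda>g. if g \<in> GL N then c else 0) \<in> S"
    and entry: "\<And>i j. i < N \<Longrightarrow> j < N \<Longrightarrow> (\<lambda>g. if g \<in> GL N then g $$ (i, j) else 0) \<in> S"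
    and add: "\<And>f f'. f \<in> S \<Longrightarrow> f' \<in> S \<Longrightarrow> (\<lambda>g. f g + f' g) \<in> S"
    and mult: "\<And>f f'. f \<in> S \<Longrightarrow> f' \<in> S \<Longrightarrow> (\<lambda>g. f g * f' g) \<in> S"
  shows "(\<lambda>g. if g \<in> GL N then Determinant.det g else 0) \<in> S"
proof -
  have sum: "(\<lambda>g. if g \<in> GL N then (\<Sum>i\<in>I. F i g) else 0) \<in> S"
    if "\<And>i. i \<in> I \<Longrightarrow> (\<lambda>g. if g \<in> GL N then F i g else 0) \<in> S" for I :: "(nat \<Rightarrow> nat) set" and F
    using that
  proof (induction I rule: infinite_finite_induct)
    case (insert i I)
    then have "(\<lambda>g. (if g \<in> GL N then F i g else 0) + (if g \<in> GL N then (\<Sum>i\<in>I. F i g) else 0)) \<in> S"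
      by (intro add) auto
    also have "(\<lambda>g. (if g \<in> GL N then F i g else 0) + (if g \<in> GL N then (\<Sum>i\<in>I. F i g) else 0)) =
        (\<lambda>g. if g \<in> GL N then (\<Sum>i\<in>insert i I. F i g) else 0)"
      using insert by auto
    finally show ?case .
  qed (simp_all add: const[of 0, simplified] cong: if_cong)
  have prod: "(\<lambda>g. if g \<in> GL N then (\<Prod>i\<in>I. F i g) else 0) \<in> S"
    if "\<And>i. i \<in> I \<Longrightarrow> (\<lambda>g. if g \<in> GL N then F i g else 0) \<in> S" for I :: "nat set" and F
    using that
  proof (induction I rule: infinite_finite_induct)
    case (insert i I)
    then have "(\<lambda>g. (if g \<in> GL N then F i g else 0) * (if g \<in> GL N then (\<Prod>i\<in>I. F i g) else 0)) \<in> S"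
      by (intro mult) auto
    also have "(\<lambda>g. (if g \<in> GL N then F i g else 0) * (if g \<in> GL N then (\<Prod>i\<in>I. F i g) else 0)) =
        (\<lambda>g. if g \<in> GL N then (\<Prod>i\<in>insert i I. F i g) else 0)"
      using insert by auto
    finally show ?case .
  qed (simp_all add: const[of 1] cong: if_cong)
  have summand: "(\<lambda>g. if g \<in> GL N then of_int (sign p) * (\<Prod>i = 0..<N. g $$ (i, p i)) else 0) \<in> S"
    if p: "p permutes {0..<N}" for p
  proof -
    have "(\<lambda>g. (if g \<in> GL N then of_int (sign p) else 0) *
        (if g \<in> GL N then (\<Prod>i = 0..<N. g $$ (i, p i)) else 0)) \<in> S"
      using permutes_in_image[OF p] by (intro mult const prod entry) auto
    also have "(\<lambda>g. (if g \<in> GL N then of_int (sign p) else 0) *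
        (if g \<in> GL N then (\<Prod>i = 0..<N. g $$ (i, p i)) else 0)) =
        (\<lambda>g. if g \<in> GL N then of_int (sign p) * (\<Prod>i = 0..<N. g $$ (i, p i)) else 0)" by auto
    finally show ?thesis .
  qed
  have "(\<lambda>g. if g \<in> GL N then Determinant.det g else 0) =
      (\<lambda>g. if g \<in> GL N then (\<Sum>p | p permutes {0..<N}. of_int (sign p) * (\<Prod>i = 0..<N. g $$ (i, p i))) else 0)"
    by (auto simp: GL_iff det_def'[of _ N])
  also have "\<dots> \<in> S" using summand by (intro sum) auto
  finally show ?thesis .
qed

lemma det_mem_coord_ring: "(\<lambda>g. if g \<in> GL N then Determinant.det g else 0) \<in> coord_ring N"
  by (rule det_mem_generated) (auto intro: coord_ring.intros)


text \<open>The function \<open>1\<close> is idempotent, hence killed by the Leibniz rule.\<close>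

lemma derivation_const:
  assumes "derivation_on (coord_ring N) D"
  shows "D (\<lambda>g. if g \<in> GL N then c else 0) = (\<lambda>g. 0)"
proof
  let ?e = "\<lambda>g. if g \<in> GL N then 1 else (0::complex)"
  have e: "?e \<in> coord_ring N" by (rule coord_ring.const)
  have ee: "(\<lambda>g. ?e g * ?e g) = ?e" by auto
  have ce: "(\<lambda>g. c * ?e g) = (\<lambda>g. if g \<in> GL N then c else 0)" by auto
  fix g show "D (\<lambda>g. if g \<in> GL N then c else 0) g = 0"
    using fun_cong[OF derivation_mult[OF assms e e], of g] derivation_scale[OF assms e, of c]
      coord_ring_eq_0[OF derivation_mem[OF assms e], of g]
    unfolding ee ce by (cases "g \<in> GL N") auto
qed

text \<open>Quotient rule, from d * r = 1 on the group. The assumptions are three consequences of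
  the Leibniz rule instead of \<open>derivation_on\<close>, because for a vector field the stability
  of the coordinate ring is itself deduced from this formula.\<close>

lemma leibniz_inv_det:
  fixes N
  defines "d \<equiv> \<lambda>g. if g \<in> GL N then Determinant.det g else (0::complex)"
    and "r \<equiv> \<lambda>g. if g \<in> GL N then 1 / Determinant.det g else (0::complex)"
  assumes "D (\<lambda>g. d g * r g) = (\<lambda>g. D d g * r g + d g * D r g)"
    and "D (\<lambda>g. if g \<in> GL N then 1 else 0) = (\<lambda>g. 0)"
    and "\<And>g. g \<notin> GL N \<Longrightarrow> D r g = 0"
  shows "D r = (\<lambda>g. - 1 * (D d g * (r g * r g)))"
proof
  have dr: "(\<lambda>g. d g * r g) = (\<lambda>g. if g \<in> GL N then 1 else 0)"
    by (auto simp: d_def r_def GL_iff)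
  fix g
  show "D r g = - 1 * (D d g * (r g * r g))"
  proof (cases "g \<in> GL N")
    case True
    then have "Determinant.det g \<noteq> 0" by (simp add: GL_iff)
    moreover have "D d g * r g + d g * D r g = 0"
      using fun_cong[OF assms(3), of g] unfolding dr assms(4) by simp
    moreover have "b = - 1 * (a * (1 / c * (1 / c)))" if "c \<noteq> 0" "a * (1 / c) + c * b = 0" for a b c :: complex
    proof -
      have "c * b = - (a / c)" using that(2) by (simp add: eq_neg_iff_add_eq_0 add.commute)
      then have "b = - (a / c) / c" using that(1) by (metis nonzero_mult_div_cancel_left)
      then show ?thesis by simp
    qed
    moreover have "d g = Determinant.det g" "r g = 1 / Determinant.det g"
      using True by (simp_all add: d_def r_def)
    ultimately show ?thesis by simp
  qed (use assms(5)[of g] in \<open>simp add: r_def\<close>)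
qed

text \<open>The entries determine a derivation on det, which is polynomial in them, and the quotient
  rule then determines it on 1/det. This is the tool by which relations between vector fields become
  relations between matrices.\<close>

lemma derivation_eq_on_entries:
  assumes D: "derivation_on (coord_ring N) D" and E: "derivation_on (coord_ring N) E"
    and eq: "\<And>i j. i < N \<Longrightarrow> j < N \<Longrightarrow>
      D (\<lambda>g. if g \<in> GL N then g $$ (i, j) else 0) = E (\<lambda>g. if g \<in> GL N then g $$ (i, j) else 0)"
    and f: "f \<in> coord_ring N"
  shows "D f = E f"
proof -
  let ?S = "{f \<in> coord_ring N. D f = E f}"
  let ?d = "\<lambda>g. if g \<in> GL N then Determinant.det g else (0::complex)"
  let ?r = "\<lambda>g. if g \<in> GL N then 1 / Determinant.det g else (0::complex)"
  have *: "?d \<in> ?S"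
  proof (rule det_mem_generated)
    fix f f' assume "f \<in> ?S" "f' \<in> ?S"
    then have *: "f \<in> coord_ring N" "f' \<in> coord_ring N" "D f = E f" "D f' = E f'" by auto
    then show "(\<lambda>g. f g + f' g) \<in> ?S" "(\<lambda>g. f g * f' g) \<in> ?S"
      by (simp_all only: mem_Collect_eq coord_ring.add coord_ring.mult derivation_add[OF D]
          derivation_add[OF E] derivation_mult[OF D] derivation_mult[OF E] simp_thms)
  qed (simp_all only: mem_Collect_eq coord_ring.const coord_ring.entry derivation_const[OF D]
      derivation_const[OF E] eq simp_thms)
  have "F ?r = (\<lambda>g. - 1 * (F ?d g * (?r g * ?r g)))" if F: "derivation_on (coord_ring N) F" for F
    by (rule leibniz_inv_det[of F N]) (use derivation_mult[OF F det_mem_coord_ring coord_ring.inv_det]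
        derivation_const[OF F] coord_ring_eq_0[OF derivation_mem[OF F coord_ring.inv_det]] in auto)
  from this[OF D] this[OF E] * have inv: "D ?r = E ?r" by simp
  from f show ?thesis
  proof (induction rule: coord_ring.induct)
    case (const c)
    show ?case by (simp only: derivation_const[OF D] derivation_const[OF E])
  next
    case (entry i j)
    then show ?case by (rule eq)
  next
    case inv_det
    show ?case by (rule inv)
  next
    case (add f f')
    then show ?case by (simp only: derivation_add[OF D] derivation_add[OF E])
  next
    case (mult f f')
    then show ?case by (simp only: derivation_mult[OF D] derivation_mult[OF E])
  qed
qed

section \<open>Vector fields as derivations of the coordinate ring\<close>

definition vector_field ::
  "nat \<Rightarrow> (complex mat \<Rightarrow> complex mat) \<Rightarrow> (complex mat \<Rightarrow> complex) \<Rightarrow> complex mat \<Rightarrow> complex" where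
  "vector_field N v f = (\<lambda>g. if g \<in> GL N then deriv (\<lambda>s. f (g + s \<cdot>\<^sub>m v g)) 0 else 0)"

lemma left_vf_eq: "left_vf N X = vector_field N (\<lambda>g. g * X)"
  and right_vf_eq: "right_vf N X = vector_field N (\<lambda>g. X * g)"
  by (auto simp: left_vf_def right_vf_def vector_field_def fun_eq_iff)

lemma vector_field_cut:
  assumes "g \<in> GL N" "v g \<in> carrier_mat N N"
  shows "vector_field N v (\<lambda>g. if g \<in> GL N then F g else 0) g = deriv (\<lambda>s. F (g + s \<cdot>\<^sub>m v g)) 0"
proof -
  from GL_line_eventually[OF assms] have
    "\<forall>\<^sub>F s in nhds 0. (if g + s \<cdot>\<^sub>m v g \<in> GL N then F (g + s \<cdot>\<^sub>m v g) else 0) = F (g + s \<cdot>\<^sub>m v g)"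
    by eventually_elim simp
  then show ?thesis
    using assms by (simp add: vector_field_def deriv_cong_ev)
qed

lemma vector_field_entry:
  assumes "\<And>g. g \<in> GL N \<Longrightarrow> v g \<in> carrier_mat N N" "i < N" "j < N"
  shows "vector_field N v (\<lambda>g. if g \<in> GL N then g $$ (i, j) else 0) =
    (\<lambda>g. if g \<in> GL N then v g $$ (i, j) else 0)"
proof
  fix g
  show "vector_field N v (\<lambda>g. if g \<in> GL N then g $$ (i, j) else 0) g =
      (if g \<in> GL N then v g $$ (i, j) else 0)"
  proof (cases "g \<in> GL N")
    case True
    then have "(\<lambda>s. (g + s \<cdot>\<^sub>m v g) $$ (i, j)) = (\<lambda>s. g $$ (i, j) + s * v g $$ (i, j))"
      using assms(1)[OF True] assms(2,3) True by (auto simp: GL_iff)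
    moreover have "((\<lambda>s. g $$ (i, j) + s * v g $$ (i, j)) has_field_derivative v g $$ (i, j)) (at 0)"
      by (auto intro!: derivative_eq_intros)
    ultimately show ?thesis
      using True by (subst vector_field_cut) (auto simp: assms(1) DERIV_imp_deriv)
  qed (simp add: vector_field_def)
qed

text \<open>The sum and product rules come from differentiability along each line. The substantial
  point is that the coordinate ring is mapped into itself: this is assumed on the entries, passes to
  det by closure, and passes to 1/det by the quotient rule.\<close>

lemma derivation_on_vector_field:
  assumes v: "\<And>g. g \<in> GL N \<Longrightarrow> v g \<in> carrier_mat N N"
    and entries: "\<And>i j. i < N \<Longrightarrow> j < N \<Longrightarrow> (\<lambda>g. if g \<in> GL N then v g $$ (i, j) else 0) \<in> coord_ring N"
  shows "derivation_on (coord_ring N) (vector_field N v)"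
proof -
  let ?D = "vector_field N v"
  let ?S = "{f \<in> coord_ring N. ?D f \<in> coord_ring N}"
  let ?d = "\<lambda>g. if g \<in> GL N then Determinant.det g else (0::complex)"
  let ?r = "\<lambda>g. if g \<in> GL N then 1 / Determinant.det g else (0::complex)"
  note diff = coord_ring_differentiable[OF _ _ v]
  have line0: "g + 0 \<cdot>\<^sub>m v g = g" if "g \<in> GL N" for g
    using that v[OF that] by (intro eq_matI) (auto simp: GL_iff)
  have add: "?D (\<lambda>g. f g + f' g) = (\<lambda>g. ?D f g + ?D f' g)"
    if "f \<in> coord_ring N" "f' \<in> coord_ring N" for f f'
    using that by (auto simp: vector_field_def fun_eq_iff intro!: deriv_add diff)
  have mult: "?D (\<lambda>g. f g * f' g) = (\<lambda>g. ?D f g * f' g + f g * ?D f' g)"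
    if "f \<in> coord_ring N" "f' \<in> coord_ring N" for f f'
    using that by (auto simp: vector_field_def fun_eq_iff deriv_mult diff line0)
  have scale: "?D (\<lambda>g. c * f g) = (\<lambda>g. c * ?D f g)" if "f \<in> coord_ring N" for c f
    using that by (auto simp: vector_field_def fun_eq_iff intro!: deriv_cmult diff)
  have const: "?D (\<lambda>g. if g \<in> GL N then c else 0) = (\<lambda>g. 0)" for c
  proof
    fix g show "?D (\<lambda>g. if g \<in> GL N then c else 0) g = 0"
      by (cases "g \<in> GL N") (simp_all add: vector_field_cut v, simp add: vector_field_def)
  qed
  note zero = function_algebra_zero[OF function_algebra_coord_ring]
  note scale_mem = function_algebra_scale[OF function_algebra_coord_ring]
  have "?d \<in> ?S"
    by (rule det_mem_generated) (auto intro!: coord_ring.intros zero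
        simp: const vector_field_entry[OF v] entries add mult)
  moreover have "?D ?r = (\<lambda>g. - 1 * (?D ?d g * (?r g * ?r g)))"
    by (rule leibniz_inv_det[of ?D N]) (use mult[OF det_mem_coord_ring coord_ring.inv_det] const in
        \<open>auto simp: vector_field_def\<close>)
  ultimately have inv: "?D ?r \<in> coord_ring N"
    by (simp only:) (intro scale_mem coord_ring.mult coord_ring.inv_det, simp)
  have "?D f \<in> coord_ring N" if "f \<in> coord_ring N" for f
    using that
    by (induction rule: coord_ring.induct)
      (simp_all add: const zero inv vector_field_entry[OF v] entries add mult coord_ring.intros)
  then show ?thesis
    by (auto simp: derivation_on_def add mult scale)
qed

section \<open>Left- and right-invariant fields on the matrix entries\<close>

lemma coord_ring_sum_entries:
  assumes "\<And>k. k < N \<Longrightarrow> i k < N \<and> j k < N"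
  shows "(\<lambda>g. if g \<in> GL N then \<Sum>k<N. a k * g $$ (i k, j k) else 0) \<in> coord_ring N"
proof -
  have "(\<lambda>g. \<Sum>k\<in>{..<N}. a k * (if g \<in> GL N then g $$ (i k, j k) else 0)) \<in> coord_ring N"
    using assms by (intro function_algebra_sum function_algebra_scale function_algebra_coord_ring
        coord_ring.entry) auto
  also have "(\<lambda>g. \<Sum>k\<in>{..<N}. a k * (if g \<in> GL N then g $$ (i k, j k) else 0)) =
      (\<lambda>g. if g \<in> GL N then \<Sum>k<N. a k * g $$ (i k, j k) else 0)" by auto
  finally show ?thesis .
qed

lemma mat_mult_entry:
  assumes "A \<in> carrier_mat N N" "B \<in> carrier_mat N N" "i < N" "j < N"
  shows "(A * B) $$ (i, j) = (\<Sum>k<N. A $$ (i, k) * B $$ (k, j))"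
  using assms by (simp add: scalar_prod_def atLeast0LessThan)

lemma derivation_left_vf:
  assumes "X \<in> gl N"
  shows "derivation_on (coord_ring N) (left_vf N X)"
  unfolding left_vf_eq
proof (rule derivation_on_vector_field)
  fix i j assume "i < N" "j < N"
  then show "(\<lambda>g. if g \<in> GL N then (g * X) $$ (i, j) else 0) \<in> coord_ring N"
    using coord_ring_sum_entries[of N "\<lambda>k. i" "\<lambda>k. k" "\<lambda>k. X $$ (k, j)"] assms
    by (simp add: mat_mult_entry[where N=N] GL_carrier mult.commute del: index_mult_mat cong: if_cong)
qed (use assms in \<open>auto dest: GL_carrier\<close>)

lemma derivation_right_vf:
  assumes "X \<in> gl N"
  shows "derivation_on (coord_ring N) (right_vf N X)"
  unfolding right_vf_eq
proof (rule derivation_on_vector_field)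
  fix i j assume "i < N" "j < N"
  then show "(\<lambda>g. if g \<in> GL N then (X * g) $$ (i, j) else 0) \<in> coord_ring N"
    using coord_ring_sum_entries[of N "\<lambda>k. k" "\<lambda>k. j" "\<lambda>k. X $$ (i, k)"] assms
    by (simp add: mat_mult_entry[where N=N] GL_carrier del: index_mult_mat cong: if_cong)
qed (use assms in \<open>auto dest: GL_carrier\<close>)

lemma left_vf_entry:
  assumes "X \<in> gl N" "i < N" "j < N"
  shows "left_vf N X (\<lambda>g. if g \<in> GL N then g $$ (i, j) else 0) =
    (\<lambda>g. \<Sum>k<N. X $$ (k, j) * (if g \<in> GL N then g $$ (i, k) else 0))"
  unfolding left_vf_eq using assms
  by (subst vector_field_entry) (auto simp: GL_carrier mult_carrier_mat[of _ N N _ N] mat_mult_entry[where N=N] mult.commute simp del: index_mult_mat)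

lemma right_vf_entry:
  assumes "X \<in> gl N" "i < N" "j < N"
  shows "right_vf N X (\<lambda>g. if g \<in> GL N then g $$ (i, j) else 0) =
    (\<lambda>g. \<Sum>k<N. X $$ (i, k) * (if g \<in> GL N then g $$ (k, j) else 0))"
  unfolding right_vf_eq using assms
  by (subst vector_field_entry) (auto simp: GL_carrier mult_carrier_mat[of _ N N _ N] mat_mult_entry[where N=N] simp del: index_mult_mat)

lemma derivation_lincomb_entries:
  assumes D: "derivation_on (coord_ring N) D" and "\<And>k. k < N \<Longrightarrow> i k < N \<and> j k < N"
  shows "D (\<lambda>g. \<Sum>k<N. a k * (if g \<in> GL N then g $$ (i k, j k) else 0)) =
    (\<lambda>g. \<Sum>k<N. a k * D (\<lambda>g. if g \<in> GL N then g $$ (i k, j k) else 0) g)"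
proof -
  have e: "(\<lambda>g. if g \<in> GL N then g $$ (i k, j k) else 0) \<in> coord_ring N" if "k < N" for k
    using assms(2)[OF that] by (intro coord_ring.entry) auto
  then have "(\<lambda>g. a k * (if g \<in> GL N then g $$ (i k, j k) else 0)) \<in> coord_ring N" if "k < N" for k
    using that by (intro function_algebra_scale[OF function_algebra_coord_ring])
  then show ?thesis
    by (subst derivation_sum[OF function_algebra_coord_ring D])
      (auto simp only: lessThan_iff derivation_scale[OF D e] intro!: ext sum.cong)
qed

text \<open>Left fields preserve the span of the entries of a fixed row, and the field of X after
  that of Y acts there through the product X * Y in this order. So brackets are preserved without a
  sign.\<close>

lemma left_vf_bracket:
  assumes X: "X \<in> gl N" and Y: "Y \<in> gl N" and f: "f \<in> coord_ring N"
  shows "left_vf N (lie_bracket X Y) f = (\<lambda>g. left_vf N X (left_vf N Y f) g - left_vf N Y (left_vf N X f) g)"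
proof (rule derivation_eq_on_entries[where D = "left_vf N (lie_bracket X Y)" and
    E = "\<lambda>f g. left_vf N X (left_vf N Y f) g - left_vf N Y (left_vf N X f) g", OF _ _ _ f])
  note dX = derivation_left_vf[OF X] and dY = derivation_left_vf[OF Y]
  have b: "lie_bracket X Y \<in> gl N"
    using X Y by (simp add: lie_bracket_def minus_carrier_mat mult_carrier_mat[of _ N N _ N])
  show "derivation_on (coord_ring N) (left_vf N (lie_bracket X Y))" by (rule derivation_left_vf[OF b])
  show "derivation_on (coord_ring N) (\<lambda>f g. left_vf N X (left_vf N Y f) g - left_vf N Y (left_vf N X f) g)"
    by (rule derivation_on_commutator[OF function_algebra_coord_ring dX dY])
  fix i j assume ij: "i < N" "j < N"
  let ?e = "\<lambda>k g. if g \<in> GL N then g $$ (i, k) else (0::complex)"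
  have *: "left_vf N X (left_vf N Y (?e j)) = (\<lambda>g. \<Sum>k<N. \<Sum>l<N. Y $$ (k, j) * X $$ (l, k) * ?e l g)"
    if "X \<in> gl N" "Y \<in> gl N" for X Y
    using that ij
    by (simp add: left_vf_entry derivation_lincomb_entries[OF derivation_left_vf] sum_distrib_left mult.assoc)
  show "left_vf N (lie_bracket X Y) (?e j) =
      (\<lambda>g. left_vf N X (left_vf N Y (?e j)) g - left_vf N Y (left_vf N X (?e j)) g)"
    unfolding *[OF X Y] *[OF Y X] left_vf_entry[OF b ij]
  proof
    fix g
    have "(\<Sum>l<N. lie_bracket X Y $$ (l, j) * ?e l g) =
        (\<Sum>l<N. \<Sum>k<N. (X $$ (l, k) * Y $$ (k, j) - Y $$ (l, k) * X $$ (k, j)) * ?e l g)"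
      using X Y ij by (intro sum.cong refl)
        (auto simp add: lie_bracket_def mat_mult_entry[where N=N] sum_distrib_right sum_subtractf left_diff_distrib simp del: index_mult_mat(1))
    also have "\<dots> = (\<Sum>k<N. \<Sum>l<N. (X $$ (l, k) * Y $$ (k, j) - Y $$ (l, k) * X $$ (k, j)) * ?e l g)"
      by (rule sum.swap)
    also have "\<dots> = (\<Sum>k<N. \<Sum>l<N. Y $$ (k, j) * X $$ (l, k) * ?e l g) - (\<Sum>k<N. \<Sum>l<N. X $$ (k, j) * Y $$ (l, k) * ?e l g)"
      unfolding sum_subtractf[symmetric] by (intro sum.cong refl) (simp add: algebra_simps)
    finally show "(\<Sum>l<N. lie_bracket X Y $$ (l, j) * ?e l g) =
      (\<Sum>k<N. \<Sum>l<N. Y $$ (k, j) * X $$ (l, k) * ?e l g) - (\<Sum>k<N. \<Sum>l<N. X $$ (k, j) * Y $$ (l, k) * ?e l g)" .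
  qed
qed

text \<open>A left field changes only the column index of an entry and a right field only the row
  index. Hence their commutator, a derivation, kills all entries.\<close>

lemma left_vf_right_vf_commute:
  assumes X: "X \<in> gl N" and Y: "Y \<in> gl N" and f: "f \<in> coord_ring N"
  shows "left_vf N X (right_vf N Y f) = right_vf N Y (left_vf N X f)"
proof -
  note dX = derivation_left_vf[OF X] and dY = derivation_right_vf[OF Y]
  have "(\<lambda>g. left_vf N X (right_vf N Y f) g - right_vf N Y (left_vf N X f) g) = (\<lambda>g. 0)"
  proof (rule derivation_eq_on_entries[where E = "\<lambda>f g. 0" and
      D = "\<lambda>f g. left_vf N X (right_vf N Y f) g - right_vf N Y (left_vf N X f) g", OF _ _ _ f])
    show "derivation_on (coord_ring N) (\<lambda>f g. left_vf N X (right_vf N Y f) g - right_vf N Y (left_vf N X f) g)"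
      by (rule derivation_on_commutator[OF function_algebra_coord_ring dX dY])
    show "derivation_on (coord_ring N) (\<lambda>f g. 0)"
      by (simp add: derivation_on_def function_algebra_zero[OF function_algebra_coord_ring])
    fix i j assume ij: "i < N" "j < N"
    have "left_vf N X (right_vf N Y (\<lambda>g. if g \<in> GL N then g $$ (i, j) else 0)) =
      (\<lambda>g. \<Sum>k<N. \<Sum>l<N. Y $$ (i, k) * X $$ (l, j) * (if g \<in> GL N then g $$ (k, l) else 0))"
      using X Y ij
      by (simp add: right_vf_entry left_vf_entry derivation_lincomb_entries[OF dX] sum_distrib_left mult.assoc)
    moreover have "right_vf N Y (left_vf N X (\<lambda>g. if g \<in> GL N then g $$ (i, j) else 0)) =
      (\<lambda>g. \<Sum>l<N. \<Sum>k<N. X $$ (l, j) * Y $$ (i, k) * (if g \<in> GL N then g $$ (k, l) else 0))"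
      using X Y ij
      by (simp add: right_vf_entry left_vf_entry derivation_lincomb_entries[OF dY] sum_distrib_left mult.assoc)
    moreover have "(\<Sum>k<N. \<Sum>l<N. Y $$ (i, k) * X $$ (l, j) * (if g \<in> GL N then g $$ (k, l) else 0)) =
        (\<Sum>l<N. \<Sum>k<N. X $$ (l, j) * Y $$ (i, k) * (if g \<in> GL N then g $$ (k, l) else 0))" for g
      by (subst sum.swap) (simp only: mult.commute)
    ultimately show "(\<lambda>g. left_vf N X (right_vf N Y (\<lambda>g. if g \<in> GL N then g $$ (i, j) else 0)) g -
        right_vf N Y (left_vf N X (\<lambda>g. if g \<in> GL N then g $$ (i, j) else 0)) g) =
        (\<lambda>g. 0)"
      by simp
  qed
  then show ?thesis by (simp add: fun_eq_iff)
qed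

text \<open>Linearity in the matrix. The hypothesis is entrywise so that a bracket can be expanded
  directly in root vectors; the empty index set covers the zero matrix.\<close>

lemma left_vf_linear_combination:
  assumes X: "\<And>k. k \<in> I \<Longrightarrow> X k \<in> gl N" and Z: "Z \<in> gl N"
    and eq: "\<And>i j. i < N \<Longrightarrow> j < N \<Longrightarrow> Z $$ (i, j) = (\<Sum>k\<in>I. a k * X k $$ (i, j))"
    and f: "f \<in> coord_ring N"
  shows "left_vf N Z f = (\<lambda>g. \<Sum>k\<in>I. a k * left_vf N (X k) f g)"
proof (rule derivation_eq_on_entries[where D = "left_vf N Z" and
    E = "\<lambda>f g. \<Sum>k\<in>I. a k * left_vf N (X k) f g", OF _ _ _ f])
  show "derivation_on (coord_ring N) (left_vf N Z)" by (rule derivation_left_vf[OF Z])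
  show "derivation_on (coord_ring N) (\<lambda>f g. \<Sum>k\<in>I. a k * left_vf N (X k) f g)"
    by (intro derivation_on_linear_combination function_algebra_coord_ring derivation_left_vf X)
  fix i j assume ij: "i < N" "j < N"
  let ?e = "\<lambda>k g. if g \<in> GL N then g $$ (i, k) else (0::complex)"
  show "left_vf N Z (?e j) = (\<lambda>g. \<Sum>k\<in>I. a k * left_vf N (X k) (?e j) g)"
  proof
    fix g
    have "(\<Sum>l<N. Z $$ (l, j) * ?e l g) = (\<Sum>l<N. \<Sum>k\<in>I. a k * X k $$ (l, j) * ?e l g)"
      using ij by (intro sum.cong refl) (simp add: eq sum_distrib_right)
    also have "\<dots> = (\<Sum>k\<in>I. \<Sum>l<N. a k * X k $$ (l, j) * ?e l g)" by (rule sum.swap)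
    also have "\<dots> = (\<Sum>k\<in>I. a k * left_vf N (X k) (?e j) g)"
      using ij X by (intro sum.cong refl) (simp add: left_vf_entry sum_distrib_left mult.assoc)
    finally show "left_vf N Z (?e j) g = (\<Sum>k\<in>I. a k * left_vf N (X k) (?e j) g)"
      using left_vf_entry[OF Z ij] by simp
  qed
qed

section \<open>Normal ordering\<close>

text \<open>The relations between the operators contain only integers, written as repeated sums;
  scalars appear only after evaluation by a functional. A carrier set is used because the
  functionals in question do not fill a type.\<close>

definition additive_on :: "'v::plus set \<Rightarrow> ('v \<Rightarrow> 'v) \<Rightarrow> bool" where
  "additive_on V F \<longleftrightarrow> (\<forall>T\<in>V. F T \<in> V) \<and> (\<forall>S\<in>V. \<forall>T\<in>V. F (S + T) = F S + F T)"

lemma additive_on_mem: "additive_on V F \<Longrightarrow> T \<in> V \<Longrightarrow> F T \<in> V"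
  and additive_on_add: "additive_on V F \<Longrightarrow> S \<in> V \<Longrightarrow> T \<in> V \<Longrightarrow> F (S + T) = F S + F T"
  by (auto simp: additive_on_def)

lemma additive_on_funpow: "additive_on V F \<Longrightarrow> additive_on V (F ^^ k)"
  by (induction k) (auto simp: additive_on_def)

lemma funpow_mem: "additive_on V F \<Longrightarrow> T \<in> V \<Longrightarrow> (F ^^ k) T \<in> V"
  by (rule additive_on_mem[OF additive_on_funpow])

lemma funpow_commute_on:
  assumes F: "additive_on V F" and G: "additive_on V G"
    and "\<And>T. T \<in> V \<Longrightarrow> F (G T) = G (F T)" and "T \<in> V"
  shows "(F ^^ k) (G T) = G ((F ^^ k) T)"
  using assms(3,4) by (induction k) (auto simp: funpow_mem[OF F])

definition falling :: "'a::comm_ring_1 \<Rightarrow> nat \<Rightarrow> 'a" where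
  "falling z k = (\<Prod>i<k. z - of_nat i)"

lemma falling_0 [simp]: "falling z 0 = 1"
  and falling_Suc: "falling z (Suc k) = falling z k * (z - of_nat k)"
  by (simp_all add: falling_def)

lemma falling_shift: "falling (z + 1) (Suc k) = (z + 1) * falling z k"
  unfolding falling_def by (subst prod.lessThan_Suc_shift) simp

text \<open>The coefficients of the normal ordering of \<open>Y\<^sup>d X\<^sup>b\<close>, applied to a vector of weight 0.\<close>

definition ordering_coeff :: "nat \<Rightarrow> nat \<Rightarrow> nat \<Rightarrow> 'a::comm_ring_1" where
  "ordering_coeff b d k =
     of_nat (fact k * (b choose k) * (d choose k)) * falling (of_nat b - of_nat d) k"

lemma ordering_coeff_0 [simp]: "ordering_coeff b d 0 = 1"
  by (simp add: ordering_coeff_def)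

lemma ordering_coeff_eq_0: "b < k \<or> d < k \<Longrightarrow> ordering_coeff b d k = 0"
  by (auto simp: ordering_coeff_def binomial_eq_0)

text \<open>The last factor is the one created when a further X crosses Y^(d-k) underneath X^(b-k),
  see \<open>ev_XYX\<close>. After removal of the common factors \<open>A\<close>, \<open>C\<close>
  and \<open>f\<close>, the claim is (b+1)(b-d+1) = (b-k)(b-d-k) + (k+1)(2(b-k) - (d-k) +
  1).\<close>

lemma ordering_coeff_Suc:
  assumes "k \<le> b" "k < d"
  shows "(ordering_coeff (Suc b) d (Suc k) :: 'a::comm_ring_1) = ordering_coeff b d (Suc k) +
    ordering_coeff b d k * (of_nat (d - k) * (2 * of_nat (b - k) - of_nat (d - k) + 1))"
proof -
  define f where "f = (falling (of_nat b - of_nat d) k :: 'a)"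
  define A where "A = (of_nat (fact k * (b choose k)) :: 'a)"
  define C where "C = (of_nat (d choose Suc k) :: 'a)"
  have "fact (Suc k) * (Suc b choose Suc k) = Suc b * (fact k * (b choose k))"
    using arg_cong[OF Suc_times_binomial_eq[of b k], of "\<lambda>z. fact k * z"]
    by (simp only: fact_Suc of_nat_id mult_ac)
  then have 1: "of_nat (fact (Suc k) * (Suc b choose Suc k)) = (of_nat b + 1) * A"
    unfolding A_def by (metis of_nat_Suc of_nat_mult add.commute)
  have "fact (Suc k) * (b choose Suc k) = (b - k) * (fact k * (b choose k))"
    using arg_cong[OF trans[OF binomial_absorption[of k b] binomial_absorb_comp[of b k, symmetric]],
        of "\<lambda>z. fact k * z"]
    by (simp only: fact_Suc of_nat_id mult_ac)
  then have 2: "of_nat (fact (Suc k) * (b choose Suc k)) = (of_nat b - of_nat k) * A"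
    unfolding A_def using assms by (metis of_nat_diff of_nat_mult)
  have "(d choose k) * (d - k) = Suc k * (d choose Suc k)"
    using binomial_absorb_comp[of d k] binomial_absorption[of k d] by (simp add: mult.commute)
  then have 3: "of_nat (d choose k) * (of_nat d - of_nat k) = (of_nat k + 1) * C"
    unfolding C_def using assms by (metis of_nat_Suc of_nat_diff of_nat_mult add.commute less_imp_le)
  have "falling (of_nat (Suc b) - of_nat d) (Suc k) = (of_nat b - of_nat d + 1) * f"
    using falling_shift[of "of_nat b - of_nat d" k] by (simp add: f_def algebra_simps)
  then have L: "(ordering_coeff (Suc b) d (Suc k) :: 'a) = (of_nat b + 1) * A * C * ((of_nat b - of_nat d + 1) * f)"
    unfolding ordering_coeff_def using 1 C_def by (simp only: of_nat_mult)
  have M: "(ordering_coeff b d (Suc k) :: 'a) = (of_nat b - of_nat k) * A * C * (f * (of_nat b - of_nat d - of_nat k))"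
    unfolding ordering_coeff_def falling_Suc f_def using 2 C_def by (simp only: of_nat_mult)
  have "ordering_coeff b d k * (of_nat (d - k) * (2 * of_nat (b - k) - of_nat (d - k) + 1)) =
      A * f * (of_nat (d choose k) * (of_nat d - of_nat k)) * (2 * (of_nat b - of_nat k) - (of_nat d - of_nat k) + 1)"
    using assms unfolding ordering_coeff_def A_def f_def by (simp add: of_nat_diff mult_ac)
  also have "\<dots> = A * f * ((of_nat k + 1) * C) * (2 * (of_nat b - of_nat k) - (of_nat d - of_nat k) + 1)"
    by (simp only: 3)
  finally show ?thesis
    unfolding L M by (simp add: algebra_simps)
qed

text \<open>Up to the scaling of \<open>H\<close> by the central operator \<open>W\<close>, the relations are those of
  \<open>\<ss>\<ll>\<^sub>2\<close>, for operators acting from the right; the functional \<open>ev\<close> has weight 0.\<close>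

locale weight_zero_functional =
  fixes V :: "'v::comm_monoid_add set" and X Y W H :: "'v \<Rightarrow> 'v" and ev :: "'v \<Rightarrow> 'r::comm_ring_1"
  assumes V_add: "S \<in> V \<Longrightarrow> T \<in> V \<Longrightarrow> S + T \<in> V"
    and X: "additive_on V X" and Y: "additive_on V Y" and W: "additive_on V W" and H: "additive_on V H"
    and XW: "T \<in> V \<Longrightarrow> X (W T) = W (X T)"
    and YW: "T \<in> V \<Longrightarrow> Y (W T) = W (Y T)"
    and YX: "T \<in> V \<Longrightarrow> Y (X T) = X (Y T) + H T"
    and XH: "T \<in> V \<Longrightarrow> X (H T) = H (X T) + W (X T) + W (X T)"
    and HY: "T \<in> V \<Longrightarrow> H (Y T) = Y (H T) + W (Y T) + W (Y T)"
    and ev_add: "S \<in> V \<Longrightarrow> T \<in> V \<Longrightarrow> ev (S + T) = ev S + ev T"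
    and ev_H: "T \<in> V \<Longrightarrow> ev (H T) = 0"
begin

lemmas mem = additive_on_mem[OF X] additive_on_mem[OF Y] additive_on_mem[OF W] additive_on_mem[OF H]
  funpow_mem[OF X] funpow_mem[OF Y] funpow_mem[OF W] funpow_mem[OF H] V_add

lemmas pow_add = additive_on_add[OF additive_on_funpow[OF X]] additive_on_add[OF additive_on_funpow[OF Y]]
  additive_on_add[OF additive_on_funpow[OF W]]

text \<open>Moving H outwards past each X costs 2 W, and an outermost H is killed by
  \<open>ev\<close>. Thus \<open>ev\<close> after X^j has weight 2j, with W as the unit of
  weight.\<close>

lemma ev_XH: "T \<in> V \<Longrightarrow> ev ((X ^^ j) (H T)) = 2 * of_nat j * ev ((X ^^ j) (W T))"
proof (induction j arbitrary: T)
  case 0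
  then show ?case by (simp add: ev_H)
next
  case (Suc j)
  have "ev ((X ^^ Suc j) (H T)) = ev ((X ^^ j) (H (X T))) + ev ((X ^^ j) (W (X T))) + ev ((X ^^ j) (W (X T)))"
    using Suc.prems by (simp add: funpow_swap1 XH pow_add ev_add mem)
  also have "\<dots> = 2 * of_nat (Suc j) * ev ((X ^^ j) (W (X T)))"
    using Suc.prems by (simp add: Suc.IH mem algebra_simps)
  also have "(X ^^ j) (W (X T)) = (X ^^ Suc j) (W T)"
    using Suc.prems by (simp add: funpow_swap1 XW)
  finally show ?case .
qed

text \<open>Crossing Y changes the weight by -2, as crossing X changes it by +2.\<close>

lemma ev_XYH:
  "T \<in> V \<Longrightarrow> ev ((X ^^ j) ((Y ^^ m) (H T))) =
     2 * (of_nat j - of_nat m) * ev ((X ^^ j) ((Y ^^ m) (W T)))"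
proof (induction m arbitrary: T)
  case 0
  then show ?case by (simp add: ev_XH)
next
  case (Suc m)
  have "ev ((X ^^ j) ((Y ^^ m) (H (Y T)))) = ev ((X ^^ j) ((Y ^^ m) (Y (H T)))) +
      ev ((X ^^ j) ((Y ^^ m) (W (Y T)))) + ev ((X ^^ j) ((Y ^^ m) (W (Y T))))"
    using Suc.prems by (simp add: HY pow_add ev_add mem)
  moreover have "ev ((X ^^ j) ((Y ^^ m) (H (Y T)))) =
      2 * (of_nat j - of_nat m) * ev ((X ^^ j) ((Y ^^ m) (W (Y T))))"
    using Suc.prems by (simp add: Suc.IH mem)
  ultimately have "ev ((X ^^ j) ((Y ^^ m) (Y (H T)))) =
      2 * (of_nat j - of_nat (Suc m)) * ev ((X ^^ j) ((Y ^^ m) (W (Y T))))"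
    by (simp add: algebra_simps)
  then show ?case
    using Suc.prems by (simp add: funpow_swap1 YW)
qed

text \<open>Moving X outwards through Y^m leaves m copies of H, having i = 0, ..., m-1 factors Y
  outside them and hence weight 2(j-i). The coefficient is the sum of these weights.\<close>

lemma ev_XYX:
  "T \<in> V \<Longrightarrow> ev ((X ^^ j) ((Y ^^ m) (X T))) = ev ((X ^^ Suc j) ((Y ^^ m) T)) +
     of_nat m * (2 * of_nat j - of_nat m + 1) * ev ((X ^^ j) ((Y ^^ (m - 1)) (W T)))"
proof (induction m arbitrary: T)
  case 0
  then show ?case by (simp add: funpow_swap1)
next
  case (Suc m)
  let ?w = "ev ((X ^^ j) ((Y ^^ m) (W T)))"
  have "ev ((X ^^ j) ((Y ^^ Suc m) (X T))) =
      ev ((X ^^ j) ((Y ^^ m) (X (Y T)))) + ev ((X ^^ j) ((Y ^^ m) (H T)))"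
    using Suc.prems by (simp add: funpow_swap1 YX pow_add ev_add mem)
  also have "ev ((X ^^ j) ((Y ^^ m) (X (Y T)))) = ev ((X ^^ Suc j) ((Y ^^ Suc m) T)) +
      of_nat m * (2 * of_nat j - of_nat m + 1) * ev ((X ^^ j) ((Y ^^ (m - 1)) (W (Y T))))"
    using Suc.prems by (simp add: Suc.IH mem funpow_swap1)
  \<comment> \<open>For m = 0 the truncated exponent m - 1 is harmless, as the factor
    \<open>of_nat m\<close> vanishes.\<close>
  also have "of_nat m * (2 * of_nat j - of_nat m + 1) * ev ((X ^^ j) ((Y ^^ (m - 1)) (W (Y T)))) =
      of_nat m * (2 * of_nat j - of_nat m + 1) * ?w"
    using Suc.prems by (cases m) (simp_all add: funpow_swap1 YW[symmetric])
  also have "ev ((X ^^ j) ((Y ^^ m) (H T))) = 2 * (of_nat j - of_nat m) * ?w"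
    using Suc.prems by (rule ev_XYH)
  finally show ?case by (simp add: algebra_simps)
qed

lemma W_pow_commute:
  assumes "T \<in> V"
  shows "(W ^^ k) (X T) = X ((W ^^ k) T)" "(W ^^ k) (Y T) = Y ((W ^^ k) T)"
  using funpow_commute_on[OF W X _ assms] funpow_commute_on[OF W Y _ assms] XW YW by simp_all

text \<open>Induction on b: the innermost X crosses Y^(d-k) by \<open>ev_XYX\<close>, which feeds
  the summands k and k+1 of the new sum. Where b - k truncates, the coefficient is 0.\<close>

lemma normal_ordering:
  "T \<in> V \<Longrightarrow> ev ((Y ^^ d) ((X ^^ b) T)) =
     (\<Sum>k\<le>d. ordering_coeff b d k * ev ((X ^^ (b - k)) ((Y ^^ (d - k)) ((W ^^ k) T))))"
proof (induction b arbitrary: T)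
  case 0
  have "(\<Sum>k\<le>d. ordering_coeff 0 d k * ev ((X ^^ (0 - k)) ((Y ^^ (d - k)) ((W ^^ k) T)))) =
      (\<Sum>k\<in>{0}. ordering_coeff 0 d k * ev ((X ^^ (0 - k)) ((Y ^^ (d - k)) ((W ^^ k) T))))"
    by (rule sum.mono_neutral_right) (auto simp: ordering_coeff_eq_0)
  then show ?case by simp
next
  case (Suc b)
  let ?u = "\<lambda>b k. ev ((X ^^ (b - k)) ((Y ^^ (d - k)) ((W ^^ k) T)))"
  let ?q = "\<lambda>k. of_nat (d - k) * (2 * of_nat (b - k) - of_nat (d - k) + 1) :: 'r"
  have summand: "ordering_coeff b d k * ev ((X ^^ (b - k)) ((Y ^^ (d - k)) ((W ^^ k) (X T)))) =
      ordering_coeff b d k * ?u (Suc b) k + ordering_coeff b d k * ?q k * ?u (Suc b) (Suc k)"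
    if "k \<le> d" for k
  proof (cases "k \<le> b")
    case True
    have "ev ((X ^^ (b - k)) ((Y ^^ (d - k)) (X ((W ^^ k) T)))) = ?u (Suc b) k + ?q k * ?u (Suc b) (Suc k)"
      using Suc.prems True ev_XYX[of "(W ^^ k) T" "b - k" "d - k"]
      by (simp add: mem Suc_diff_le)
    moreover have "c * (x + y * z) = c * x + c * y * z" for c x y z :: 'r
      by (simp add: algebra_simps)
    ultimately show ?thesis
      unfolding W_pow_commute(1)[OF Suc.prems] by (simp only:)
  qed (simp add: ordering_coeff_eq_0)
  have rec: "ordering_coeff b d k * ?q k + ordering_coeff b d (Suc k) = (ordering_coeff (Suc b) d (Suc k) :: 'r)"
    if "k < d" for k
  proof (cases "k \<le> b")
    case True
    then show ?thesis using ordering_coeff_Suc[OF True that, where ?'a = 'r] by simp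
  qed (simp add: ordering_coeff_eq_0)
  have "ev ((Y ^^ d) ((X ^^ Suc b) T)) = ev ((Y ^^ d) ((X ^^ b) (X T)))"
    by (simp add: funpow_swap1)
  also have "\<dots> = (\<Sum>k\<le>d. ordering_coeff b d k * ?u (Suc b) k) +
      (\<Sum>k\<le>d. ordering_coeff b d k * ?q k * ?u (Suc b) (Suc k))"
    using Suc.prems by (simp add: Suc.IH mem summand sum.distrib)
  \<comment> \<open>The summand k = d vanishes: no Y is left to be crossed, so \<open>?q d\<close>
    is 0.\<close>
  also have "(\<Sum>k\<le>d. ordering_coeff b d k * ?q k * ?u (Suc b) (Suc k)) =
      (\<Sum>k<d. ordering_coeff b d k * ?q k * ?u (Suc b) (Suc k))"
    by (simp add: lessThan_Suc_atMost[symmetric])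
  also have "(\<Sum>k\<le>d. ordering_coeff b d k * ?u (Suc b) k) =
      ?u (Suc b) 0 + (\<Sum>k<d. ordering_coeff b d (Suc k) * ?u (Suc b) (Suc k))"
    by (subst sum.atMost_shift) simp
  also have "\<dots> + (\<Sum>k<d. ordering_coeff b d k * ?q k * ?u (Suc b) (Suc k)) =
      ?u (Suc b) 0 + (\<Sum>k<d. ordering_coeff (Suc b) d (Suc k) * ?u (Suc b) (Suc k))"
    by (simp add: sum.distrib[symmetric] rec[symmetric] distrib_right add.commute add.left_commute)
  also have "\<dots> = (\<Sum>k\<le>d. ordering_coeff (Suc b) d k * ?u (Suc b) k)"
    by (subst sum.atMost_shift) simp
  finally show ?case .
qed

end

lemma binomial_on:
  fixes \<phi> :: "'v::comm_monoid_add \<Rightarrow> 'r::comm_ring_1"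
  assumes V: "\<And>S T. S \<in> V \<Longrightarrow> T \<in> V \<Longrightarrow> S + T \<in> V"
    and X: "additive_on V X" and W: "additive_on V W"
    and XW: "\<And>T. T \<in> V \<Longrightarrow> X (W T) = W (X T)"
    and \<phi>: "\<And>S T. S \<in> V \<Longrightarrow> T \<in> V \<Longrightarrow> \<phi> (S + T) = \<phi> S + \<phi> T"
  shows "T \<in> V \<Longrightarrow> \<phi> (((\<lambda>T. W T + X T) ^^ a) T) =
    (\<Sum>s\<le>a. of_nat (a choose s) * \<phi> ((X ^^ (a - s)) ((W ^^ s) T)))"
proof (induction a arbitrary: T)
  case (Suc a)
  let ?S = "\<lambda>T. W T + X T"
  let ?u = "\<lambda>s. \<phi> ((X ^^ (Suc a - s)) ((W ^^ s) T))"
  note mem = additive_on_mem[OF X] additive_on_mem[OF W] V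
  have S: "additive_on V ?S"
    unfolding additive_on_def
    by (auto simp: mem additive_on_add[OF X] additive_on_add[OF W] algebra_simps)
  have "\<phi> ((?S ^^ Suc a) T) = \<phi> ((?S ^^ a) (W T)) + \<phi> ((?S ^^ a) (X T))"
    using Suc.prems
    by (simp only: funpow_Suc_right o_apply additive_on_add[OF additive_on_funpow[OF S]] \<phi> mem funpow_mem[OF S])
  also have "\<phi> ((?S ^^ a) (W T)) = (\<Sum>s\<le>a. of_nat (a choose s) * ?u (Suc s))"
    using Suc.prems by (simp add: Suc.IH mem funpow_swap1)
  also have "\<phi> ((?S ^^ a) (X T)) = (\<Sum>s\<le>a. of_nat (a choose s) * ?u s)"
    unfolding Suc.IH[OF mem(1)[OF Suc.prems]]
  proof (intro sum.cong refl)
    fix s assume "s \<in> {..a}"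
    then show "of_nat (a choose s) * \<phi> ((X ^^ (a - s)) ((W ^^ s) (X T))) = of_nat (a choose s) * ?u s"
      using Suc.prems by (simp add: funpow_commute_on[OF W X] XW Suc_diff_le funpow_swap1)
  qed
  also have "\<dots> = (\<Sum>s\<le>Suc a. of_nat (a choose s) * ?u s)"
    by (simp add: binomial_eq_0)
  also have "\<dots> = ?u 0 + (\<Sum>s\<le>a. of_nat (a choose Suc s) * ?u (Suc s))"
    by (subst sum.atMost_Suc_shift) simp
  also have "(\<Sum>s\<le>a. of_nat (a choose s) * ?u (Suc s)) + \<dots> =
      ?u 0 + (\<Sum>s\<le>a. of_nat (Suc a choose Suc s) * ?u (Suc s))"
    by (simp add: sum.distrib[symmetric] distrib_right add.left_commute)
  also have "\<dots> = (\<Sum>s\<le>Suc a. of_nat (Suc a choose s) * ?u s)"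
    by (subst sum.atMost_Suc_shift) simp
  finally show ?case .
qed simp

section \<open>The scalar coefficients\<close>

definition degree_coeff :: "complex \<Rightarrow> nat \<Rightarrow> complex fps" where
  "degree_coeff lambda k = (- fps_X) ^ k / (\<Prod>j<k. fps_const lambda - of_nat j * fps_X)"

lemma degree_coeff_0 [simp]: "degree_coeff lambda 0 = 1"
  by (simp add: degree_coeff_def)

lemma of_nat_eq_fps_const: "(of_nat n :: complex fps) = fps_const (of_nat n)"
  by (simp add: fps_of_nat)

context
  fixes lambda :: complex
  assumes lambda: "lambda \<noteq> 0"
begin

lemma denominator_unit: "fps_nth (\<Prod>j<k. fps_const lambda - of_nat j * fps_X) 0 \<noteq> 0"
  using lambda by (induction k) auto

text \<open>The denominator has constant term \<lambda>^k, hence is a unit and the quotient is a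
  genuine multiple of t^k.\<close>

lemma degree_coeff_eq:
  "degree_coeff lambda k = fps_X ^ k * ((- 1) ^ k * inverse (\<Prod>j<k. fps_const lambda - of_nat j * fps_X))"
  unfolding degree_coeff_def using denominator_unit
  by (simp add: fps_divide_unit power_minus[of fps_X] mult_ac)

lemma degree_coeff_Suc:
  "degree_coeff lambda (Suc k) * (fps_const lambda - of_nat k * fps_X) = - fps_X * degree_coeff lambda k"
proof -
  have "fps_nth (fps_const lambda - of_nat k * fps_X) 0 \<noteq> 0" using lambda by simp
  then have "inverse (fps_const lambda - of_nat k * fps_X) * (fps_const lambda - of_nat k * fps_X) = 1"
    by (rule inverse_mult_eq_1)
  then show ?thesis
    unfolding degree_coeff_eq
    by (simp add: fps_inverse_mult mult_ac)
qed

text \<open>Divisibility by t^(a+b). It makes the truncation of double sums at total degree K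
  harmless.\<close>

lemma degree_coeff_mult_mult_nth_eq_0:
  assumes "k < a + b"
  shows "fps_nth (degree_coeff lambda a * degree_coeff lambda b * F) k = 0"
proof -
  have "degree_coeff lambda a * degree_coeff lambda b * F = fps_X ^ (a + b) *
      ((- 1) ^ a * inverse (\<Prod>j<a. fps_const lambda - of_nat j * fps_X) *
       ((- 1) ^ b * inverse (\<Prod>j<b. fps_const lambda - of_nat j * fps_X)) * F)"
    unfolding degree_coeff_eq by (simp add: power_add mult_ac)
  then show ?thesis using assms by (simp only: fps_X_power_mult_nth if_True)
qed

text \<open>With \<open>\<nu> = \<lambda>/t\<close> this is the Vandermonde convolution of the falling factorials of
  \<open>e + m - 1 - \<nu>\<close> and \<open>j - m\<close>.\<close>

lemma degree_coeff_vandermonde: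
  "degree_coeff lambda (e + j) * (\<Sum>k\<le>e. of_nat (e choose k) * degree_coeff lambda (m + k) *
      falling (of_nat j - of_nat m) k) = degree_coeff lambda (e + m) * degree_coeff lambda j"
proof (induction e arbitrary: m)
  case 0
  then show ?case by (simp add: mult.commute)
next
  case (Suc e)
  let ?c = "degree_coeff lambda"
  let ?z = "\<lambda>m. of_nat j - of_nat m :: complex fps"
  let ?S = "\<lambda>e m. \<Sum>k\<le>e. of_nat (e choose k) * ?c (m + k) * falling (?z m) k"
  let ?L = "\<lambda>k. fps_const lambda - of_nat k * fps_X :: complex fps"
  have shift: "falling (?z m) (Suc k) = ?z m * falling (?z (Suc m)) k" for k
    using falling_shift[of "?z (Suc m)" k] by simp
  have "?S (Suc e) m = ?c m + (\<Sum>k\<le>e. of_nat (Suc e choose Suc k) * ?c (m + Suc k) * falling (?z m) (Suc k))"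
    by (subst sum.atMost_Suc_shift) simp
  also have "\<dots> = (?c m + (\<Sum>k\<le>e. of_nat (e choose Suc k) * ?c (m + Suc k) * falling (?z m) (Suc k))) +
      (\<Sum>k\<le>e. of_nat (e choose k) * ?c (m + Suc k) * falling (?z m) (Suc k))"
    by (simp add: sum.distrib distrib_right add.assoc add.left_commute)
  also have "?c m + (\<Sum>k\<le>e. of_nat (e choose Suc k) * ?c (m + Suc k) * falling (?z m) (Suc k)) =
      (\<Sum>k\<le>Suc e. of_nat (e choose k) * ?c (m + k) * falling (?z m) k)"
    by (subst sum.atMost_Suc_shift) simp
  also have "\<dots> = ?S e m" by (simp add: binomial_eq_0)
  also have "(\<Sum>k\<le>e. of_nat (e choose k) * ?c (m + Suc k) * falling (?z m) (Suc k)) = ?z m * ?S e (Suc m)"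
    by (simp add: shift sum_distrib_left mult_ac)
  \<comment> \<open>Pascal's rule gives two sums; from the falling factorials of the second the
    factor j - m is split off, leaving the sum for m + 1. This is why the induction keeps m
    arbitrary.\<close>
  finally have S: "?S (Suc e) m = ?S e m + ?z m * ?S e (Suc m)" .
  \<comment> \<open>Multiplication by \<lambda> - (e+j) t makes the recursion for the leading
    coefficient applicable; the factor is nonzero, having constant term \<lambda>, and is cancelled
    at the end.\<close>
  have "?L (e + j) * (?c (Suc e + j) * ?S (Suc e) m) = (?c (Suc (e + j)) * ?L (e + j)) * ?S (Suc e) m"
    by (simp only: add_Suc mult_ac)
  also have "\<dots> = - fps_X * ?c (e + j) * (?S e m + ?z m * ?S e (Suc m))"
    by (simp only: degree_coeff_Suc S)
  also have "\<dots> = - fps_X * (?c (e + j) * ?S e m + ?z m * (?c (e + j) * ?S e (Suc m)))"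
    by (simp only: distrib_left mult_ac)
  also have "\<dots> = - fps_X * (?c (e + m) * ?c j + ?z m * (?c (Suc e + m) * ?c j))"
    by (simp only: Suc.IH) (simp only: add_Suc_right add_Suc)
  also have "\<dots> = ?c j * ((- fps_X * ?c (e + m)) - ?z m * fps_X * ?c (Suc e + m))"
    by (simp add: algebra_simps)
  also have "- fps_X * ?c (e + m) = ?c (Suc e + m) * ?L (e + m)"
    using degree_coeff_Suc[of "e + m"] by simp
  \<comment> \<open>(\<lambda> - (e+m) t) - (j-m) t = \<lambda> - (e+j) t.\<close>
  also have "?c j * (?c (Suc e + m) * ?L (e + m) - ?z m * fps_X * ?c (Suc e + m)) =
      ?L (e + j) * (?c (Suc e + m) * ?c j)"
    by (simp add: algebra_simps)
  finally have "?L (e + j) * (?c (Suc e + j) * ?S (Suc e) m) = ?L (e + j) * (?c (Suc e + m) * ?c j)" .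
  moreover have "?L (e + j) \<noteq> 0"
  proof
    assume "?L (e + j) = 0"
    then have "fps_nth (?L (e + j)) 0 = 0" by simp
    with lambda show False by simp
  qed
  ultimately show ?case using mult_left_cancel by blast
qed

text \<open>The two sides are the sums in the two bracketings of a triple star product.\<close>

lemma associativity_sum:
  fixes u :: "nat \<Rightarrow> nat \<Rightarrow> nat \<Rightarrow> complex fps"
  assumes "q \<le> K"
  defines "c \<equiv> degree_coeff lambda" and "r \<equiv> \<lambda>a. fps_const (1 / fact a)"
  shows "fps_nth (\<Sum>a\<le>K. \<Sum>b\<le>K. c a * c b * (r a * r b * (\<Sum>s\<le>a. of_nat (a choose s) *
      (\<Sum>k\<le>b. ordering_coeff (a - s) b k * u (k + s) (a - s - k) (b - k))))) q =
    fps_nth (\<Sum>a\<le>K. \<Sum>b\<le>K. c a * c b * (r a * r b * (\<Sum>s\<le>a. of_nat (a choose s) * u s b (a - s)))) q"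
proof -
  \<comment> \<open>The numbers e, j, m are the exponents of the operators on the legs (1,3), (2,3),
    (1,2) in normal order; k counts the crossings.\<close>
  let ?f = "\<lambda>e j m k. of_nat (e choose k) * (r e * r j * r m) *
      (c (e + j) * c (m + k) * (falling (of_nat j - of_nat m) k * u e j m))"
  define S where "S = (SIGMA p:{(e, j, m). e + j + m \<le> K}. {..fst p})"
  have fin3: "finite {(e, j, m). e + j + m \<le> K}"
    by (rule finite_subset[of _ "{..K} \<times> {..K} \<times> {..K}"]) auto
  have rr: "r a = fps_const (1 / fact a)" for a by (simp add: r_def)
  have low: "fps_nth (x * (c a * c b * y)) q = 0" if "K < a + b" for a b x y
    using degree_coeff_mult_mult_nth_eq_0[of q a b "x * y"] that assms(1)
    by (simp add: c_def mult_ac)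
  have "fps_nth (\<Sum>a\<le>K. \<Sum>b\<le>K. c a * c b * (r a * r b * (\<Sum>s\<le>a. of_nat (a choose s) *
      (\<Sum>k\<le>b. ordering_coeff (a - s) b k * u (k + s) (a - s - k) (b - k))))) q =
    (\<Sum>(a, b, s, k)\<in>(SIGMA a:{..K}. SIGMA b:{..K}. {..a} \<times> {..b}).
      fps_nth (c a * c b * (r a * r b * (of_nat (a choose s) *
      (ordering_coeff (a - s) b k * u (k + s) (a - s - k) (b - k))))) q)"
    by (simp add: fps_sum_nth sum.Sigma sum_distrib_left split_def)
  \<comment> \<open>Summands with a + b > K are of too high order in t, and those with k > a - s
    have ordering coefficient 0. On the remaining set no subtraction truncates.\<close>
  also have "\<dots> = (\<Sum>(a, b, s, k)\<in>{(a, b, s, k). a + b \<le> K \<and> s + k \<le> a \<and> k \<le> b}.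
      fps_nth (c a * c b * (r a * r b * (of_nat (a choose s) *
      (ordering_coeff (a - s) b k * u (k + s) (a - s - k) (b - k))))) q)"
  proof (rule sum.mono_neutral_right)
    show "\<forall>p\<in>(SIGMA a:{..K}. SIGMA b:{..K}. {..a} \<times> {..b}) - {(a, b, s, k). a + b \<le> K \<and> s + k \<le> a \<and> k \<le> b}.
      (case p of (a, b, s, k) \<Rightarrow> fps_nth (c a * c b * (r a * r b * (of_nat (a choose s) *
      (ordering_coeff (a - s) b k * u (k + s) (a - s - k) (b - k))))) q) = 0"
    proof
      fix p assume "p \<in> (SIGMA a:{..K}. SIGMA b:{..K}. {..a} \<times> {..b}) -
        {(a, b, s, k). a + b \<le> K \<and> s + k \<le> a \<and> k \<le> b}"
      then obtain a b s k where p: "p = (a, b, s, k)" and "s \<le> a" "k \<le> b" "a + b \<le> K \<Longrightarrow> \<not> s + k \<le> a"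
        by auto
      then have "K < a + b \<or> a - s < k" by linarith
      then show "(case p of (a, b, s, k) \<Rightarrow> fps_nth (c a * c b * (r a * r b * (of_nat (a choose s) *
          (ordering_coeff (a - s) b k * u (k + s) (a - s - k) (b - k))))) q) = 0"
        using low[of a b 1] by (auto simp: p ordering_coeff_eq_0)
    qed
  qed auto
  also have "\<dots> = (\<Sum>((e, j, m), k)\<in>{((e, j, m), k). k \<le> e \<and> e + j + m + k \<le> K}. fps_nth (?f e j m k) q)"
  proof (rule sum.reindex_bij_witness[where
      i = "\<lambda>((e, j, m), k). (e - k + (j + k), m + k, e - k, k)" and
      j = "\<lambda>(a, b, s, k). ((k + s, a - s - k, b - k), k)"], goal_cases)
    case (5 p)
    obtain a b s k where p: "p = (a, b, s, k)" by (cases p) auto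
    with 5 have *: "a + b \<le> K" "s + k \<le> a" "k \<le> b" by auto
    define e j m where "e = k + s" and "j = a - s - k" and "m = b - k"
    have eqs: "a = e + j" "b = m + k" "s = e - k" "a - s = j + k" "k \<le> e"
      using * by (auto simp: e_def j_def m_def)
    \<comment> \<open>Both sides equal 1 / (s! k! j! m!), where s = e - k.\<close>
    have "1 / fact a * (1 / fact b) * of_nat (a choose s) * of_nat (fact k * (a - s choose k) * (b choose k)) =
        (of_nat (e choose k) * (1 / fact e * (1 / fact j) * (1 / fact m)) :: complex)"
      unfolding eqs(4) unfolding eqs(2) using eqs(5) by (simp add: eqs(1,3) binomial_fact)
    then have coeff: "r a * r b * of_nat (a choose s) * of_nat (fact k * (a - s choose k) * (b choose k)) =
        of_nat (e choose k) * (r e * r j * r m)"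
      unfolding rr of_nat_eq_fps_const fps_const_mult by (simp only:)
    have "ordering_coeff (a - s) b k =
        of_nat (fact k * (a - s choose k) * (b choose k)) * falling (of_nat j - of_nat m :: complex fps) k"
      unfolding ordering_coeff_def eqs(4) eqs(2) by simp
    then have "c a * c b * (r a * r b * (of_nat (a choose s) *
        (ordering_coeff (a - s) b k * u (k + s) (a - s - k) (b - k)))) =
      (r a * r b * of_nat (a choose s) * of_nat (fact k * (a - s choose k) * (b choose k))) *
        (c a * c b * (falling (of_nat j - of_nat m) k * u (k + s) (a - s - k) (b - k)))"
      by (simp only: mult_ac)
    also have "\<dots> = ?f e j m k"
      unfolding coeff
      by (simp only: e_def[symmetric] j_def[symmetric] m_def[symmetric] eqs(1)[symmetric] eqs(2)[symmetric])
    finally show ?case by (simp only: p prod.case e_def j_def m_def)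
  qed auto
  \<comment> \<open>The Vandermonde identity needs the full range k \<le> e. The summands added here
    have e + j + m + k > K and so are of too high order in t.\<close>
  also have "\<dots> = (\<Sum>((e, j, m), k)\<in>S. fps_nth (?f e j m k) q)"
  proof (rule sum.mono_neutral_left)
    show "finite S" unfolding S_def by (intro finite_SigmaI fin3) auto
    show "{((e, j, m), k). k \<le> e \<and> e + j + m + k \<le> K} \<subseteq> S" by (auto simp: S_def)
    show "\<forall>p\<in>S - {((e, j, m), k). k \<le> e \<and> e + j + m + k \<le> K}.
        (\<lambda>((e, j, m), k). fps_nth (?f e j m k) q) p = 0"
      by (auto simp: S_def intro!: low)
  qed
  also have "\<dots> = (\<Sum>(e, j, m)\<in>{(e, j, m). e + j + m \<le> K}. fps_nth (\<Sum>k\<le>e. ?f e j m k) q)"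
    unfolding S_def by (subst sum.Sigma[symmetric]) (use fin3 in \<open>auto simp: fps_sum_nth split_def\<close>)
  also have "\<dots> = (\<Sum>(e, j, m)\<in>{(e, j, m). e + j + m \<le> K}.
      fps_nth (r e * r j * r m * (c (e + m) * c j * u e j m)) q)"
  proof (intro sum.cong refl, clarify)
    fix e j m
    have "(\<Sum>k\<le>e. ?f e j m k) = r e * r j * r m * (c (e + j) *
        (\<Sum>k\<le>e. of_nat (e choose k) * c (m + k) * falling (of_nat j - of_nat m) k) * u e j m)"
      by (simp add: sum_distrib_left sum_distrib_right mult_ac)
    then show "fps_nth (\<Sum>k\<le>e. ?f e j m k) q = fps_nth (r e * r j * r m * (c (e + m) * c j * u e j m)) q"
      by (simp only: c_def degree_coeff_vandermonde)
  qed
  \<comment> \<open>The coefficient c_{e+m} c_j is that of the other bracketing, with a = e + m, b =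
    j and s = e.\<close>
  also have "\<dots> = (\<Sum>(a, b, s)\<in>{(a, b, s). a + b \<le> K \<and> s \<le> a}.
      fps_nth (c a * c b * (r a * r b * (of_nat (a choose s) * u s b (a - s)))) q)"
  proof (rule sum.reindex_bij_witness[where
      i = "\<lambda>(a, b, s). (s, b, a - s)" and j = "\<lambda>(e, j, m). (e + m, j, e)"], goal_cases)
    case (5 p)
    obtain e j m where p: "p = (e, j, m)" by (cases p) auto
    have coeff: "r (e + m) * of_nat (e + m choose e) = r e * r m"
      unfolding rr of_nat_eq_fps_const fps_const_mult by (simp add: binomial_fact)
    have "c (e + m) * c j * (r (e + m) * r j * (of_nat (e + m choose e) * u e j m)) =
        (r (e + m) * of_nat (e + m choose e)) * (r j * (c (e + m) * c j * u e j m))"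
      by (simp only: mult_ac)
    also have "\<dots> = r e * r j * r m * (c (e + m) * c j * u e j m)"
      unfolding coeff by (simp only: mult_ac)
    finally show ?case by (simp only: p prod.case add_diff_cancel_left')
  qed auto
  also have "\<dots> = (\<Sum>(a, b, s)\<in>(SIGMA a:{..K}. {..K} \<times> {..a}).
      fps_nth (c a * c b * (r a * r b * (of_nat (a choose s) * u s b (a - s)))) q)"
  proof (rule sum.mono_neutral_left)
    show "\<forall>p\<in>(SIGMA a:{..K}. {..K} \<times> {..a}) - {(a, b, s). a + b \<le> K \<and> s \<le> a}.
      (\<lambda>(a, b, s). fps_nth (c a * c b * (r a * r b * (of_nat (a choose s) * u s b (a - s)))) q) p = 0"
    proof
      fix p assume "p \<in> (SIGMA a:{..K}. {..K} \<times> {..a}) - {(a, b, s). a + b \<le> K \<and> s \<le> a}"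
      then obtain a b s where p: "p = (a, b, s)" and "\<not> a + b \<le> K" by auto
      then show "(\<lambda>(a, b, s). fps_nth (c a * c b * (r a * r b * (of_nat (a choose s) * u s b (a - s)))) q) p = 0"
        using low[of a b 1] by simp
    qed
  qed auto
  also have "\<dots> = fps_nth (\<Sum>a\<le>K. \<Sum>b\<le>K. c a * c b * (r a * r b * (\<Sum>s\<le>a. of_nat (a choose s) * u s b (a - s)))) q"
    by (simp add: fps_sum_nth sum.Sigma sum_distrib_left split_def)
  finally show ?thesis .
qed

end

section \<open>The pairing of two commuting families of derivations\<close>

text \<open>The product of the two tensor factors of \<Omega>^d (f \<otimes> g), by a recursion that
  avoids the tensor product.\<close>

primrec pairing :: "'i set \<Rightarrow> ('i \<Rightarrow> ('p \<Rightarrow> 'r::comm_ring_1) \<Rightarrow> 'p \<Rightarrow> 'r) \<Rightarrow>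
    ('i \<Rightarrow> ('p \<Rightarrow> 'r) \<Rightarrow> 'p \<Rightarrow> 'r) \<Rightarrow> nat \<Rightarrow> ('p \<Rightarrow> 'r) \<Rightarrow> ('p \<Rightarrow> 'r) \<Rightarrow> 'p \<Rightarrow> 'r" where
  "pairing I x y 0 f g = (\<lambda>p. f p * g p)"
| "pairing I x y (Suc d) f g = (\<lambda>p. \<Sum>i\<in>I. pairing I x y d (x i f) (y i g) p)"

locale derivation_families =
  fixes A :: "('p \<Rightarrow> 'r::comm_ring_1) set" and I :: "'i set"
    and x y :: "'i \<Rightarrow> ('p \<Rightarrow> 'r) \<Rightarrow> 'p \<Rightarrow> 'r"
  assumes finite_I: "finite I" and A: "function_algebra A"
    and x: "i \<in> I \<Longrightarrow> derivation_on A (x i)" and y: "i \<in> I \<Longrightarrow> derivation_on A (y i)"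
begin

abbreviation pair where "pair \<equiv> pairing I x y"

lemmas mem = derivation_mem[OF x] derivation_mem[OF y]
  function_algebra_add[OF A] function_algebra_mult[OF A] function_algebra_scale[OF A]

lemma pair_mem: "f \<in> A \<Longrightarrow> g \<in> A \<Longrightarrow> pair d f g \<in> A"
proof (induction d arbitrary: f g)
  case (Suc d)
  then show ?case
    unfolding pairing.simps by (intro function_algebra_sum[OF A]) (simp add: mem)
qed (simp add: mem)

lemma pair_add_left:
  "f \<in> A \<Longrightarrow> f' \<in> A \<Longrightarrow> g \<in> A \<Longrightarrow> pair d (\<lambda>p. f p + f' p) g = (\<lambda>p. pair d f g p + pair d f' g p)"
  by (induction d arbitrary: f f' g)
    (auto simp: distrib_right derivation_add[OF x] mem sum.distrib fun_eq_iff intro!: sum.cong)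

lemma pair_add_right:
  "f \<in> A \<Longrightarrow> g \<in> A \<Longrightarrow> g' \<in> A \<Longrightarrow> pair d f (\<lambda>p. g p + g' p) = (\<lambda>p. pair d f g p + pair d f g' p)"
  by (induction d arbitrary: f g g')
    (auto simp: distrib_left derivation_add[OF y] mem sum.distrib fun_eq_iff intro!: sum.cong)

lemma pair_scale_left:
  "f \<in> A \<Longrightarrow> g \<in> A \<Longrightarrow> pair d (\<lambda>p. c * f p) g = (\<lambda>p. c * pair d f g p)"
  by (induction d arbitrary: f g)
    (auto simp: mult.assoc derivation_scale[OF x] mem sum_distrib_left fun_eq_iff intro!: sum.cong)

lemma pair_scale_right:
  "f \<in> A \<Longrightarrow> g \<in> A \<Longrightarrow> pair d f (\<lambda>p. c * g p) = (\<lambda>p. c * pair d f g p)"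
  by (induction d arbitrary: f g)
    (auto simp: mult.left_commute derivation_scale[OF y] mem sum_distrib_left fun_eq_iff intro!: sum.cong)

lemma pair_zero:
  assumes "f \<in> A"
  shows "pair d (\<lambda>p. 0) f = (\<lambda>p. 0)" "pair d f (\<lambda>p. 0) = (\<lambda>p. 0)"
  using pair_scale_left[OF assms assms, of d 0] pair_scale_right[OF assms assms, of d 0] by simp_all

lemma pair_sum_left:
  assumes "\<And>i. i \<in> J \<Longrightarrow> F i \<in> A" "g \<in> A"
  shows "pair d (\<lambda>p. \<Sum>i\<in>J. F i p) g = (\<lambda>p. \<Sum>i\<in>J. pair d (F i) g p)"
  using assms(1)
proof (induction J rule: infinite_finite_induct)
  case (insert i J)
  then show ?case
    using pair_add_left[of "F i" "\<lambda>p. \<Sum>i\<in>J. F i p" g d] function_algebra_sum[OF A, of J F] assms(2)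
    by auto
qed (simp_all add: pair_zero assms(2))

lemma pair_sum_right:
  assumes "\<And>i. i \<in> J \<Longrightarrow> F i \<in> A" "f \<in> A"
  shows "pair d f (\<lambda>p. \<Sum>i\<in>J. F i p) = (\<lambda>p. \<Sum>i\<in>J. pair d f (F i) p)"
  using assms(1)
proof (induction J rule: infinite_finite_induct)
  case (insert i J)
  then show ?case
    using pair_add_right[of f "F i" "\<lambda>p. \<Sum>i\<in>J. F i p" d] function_algebra_sum[OF A, of J F] assms(2)
    by auto
qed (simp_all add: pair_zero assms(2))

text \<open>The hypotheses say that \<open>D\<close> annihilates \<open>\<Sum>\<^sub>i x\<^sub>i \<otimes> y\<^sub>i\<close> under the commutator action.\<close>

lemma derivation_pair:
  assumes D: "derivation_on A D"
    and Dx: "\<And>i f. i \<in> I \<Longrightarrow> f \<in> A \<Longrightarrow> D (x i f) = (\<lambda>p. x i (D f) p + (\<Sum>l\<in>I. a i l * x l f p))"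
    and Dy: "\<And>i f. i \<in> I \<Longrightarrow> f \<in> A \<Longrightarrow> D (y i f) = (\<lambda>p. y i (D f) p + (\<Sum>l\<in>I. - a l i * y l f p))"
  shows "f \<in> A \<Longrightarrow> g \<in> A \<Longrightarrow> D (pair d f g) = (\<lambda>p. pair d (D f) g p + pair d f (D g) p)"
proof (induction d arbitrary: f g)
  case 0
  then show ?case by (simp add: derivation_mult[OF D])
next
  case (Suc d)
  have Df: "D f \<in> A" "D g \<in> A" using Suc.prems derivation_mem[OF D] by auto
  have S: "(\<lambda>p. \<Sum>l\<in>I. c l * F l p) \<in> A" if "\<And>l. l \<in> I \<Longrightarrow> F l \<in> A" for c F
    using that by (intro function_algebra_sum[OF A] function_algebra_scale[OF A])
  have left: "pair d (D (x i f)) (y i g) =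
      (\<lambda>p. pair d (x i (D f)) (y i g) p + (\<Sum>l\<in>I. a i l * pair d (x l f) (y i g) p))" if "i \<in> I" for i
    using that Suc.prems Df unfolding Dx[OF that Suc.prems(1)]
    by (subst pair_add_left) (auto simp: mem S pair_sum_left pair_scale_left)
  have right: "pair d (x i f) (D (y i g)) =
      (\<lambda>p. pair d (x i f) (y i (D g)) p + (\<Sum>l\<in>I. - a l i * pair d (x i f) (y l g) p))" if "i \<in> I" for i
    using that Suc.prems Df S[of "\<lambda>l. y l g" "\<lambda>l. - a l i"] unfolding Dy[OF that Suc.prems(2)]
    by (subst pair_add_right)
      (auto simp: mem pair_sum_right[where F = "\<lambda>l p. - a l i * y l g p"]
        pair_scale_right[where c = "- a _ _"] simp del: mult_minus_left)
  \<comment> \<open>After the names i and l are exchanged in one double sum, the two are opposite: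
    the matrix acting on the y is minus the transpose of the one acting on the x.\<close>
  have cancel: "(\<Sum>i\<in>I. \<Sum>l\<in>I. a i l * pair d (x l f) (y i g) p) +
      (\<Sum>i\<in>I. \<Sum>l\<in>I. - a l i * pair d (x i f) (y l g) p) = 0" for p
    by (subst (2) sum.swap) (simp add: sum.distrib[symmetric])
  have "D (pair (Suc d) f g) = (\<lambda>p. \<Sum>i\<in>I. D (pair d (x i f) (y i g)) p)"
    unfolding pairing.simps using Suc.prems by (intro derivation_sum[OF A D] pair_mem mem)
  also have "\<dots> = (\<lambda>p. \<Sum>i\<in>I. pair d (D (x i f)) (y i g) p + pair d (x i f) (D (y i g)) p)"
    using Suc.prems by (intro ext sum.cong refl) (simp add: Suc.IH mem)
  also have "\<dots> = (\<lambda>p. (\<Sum>i\<in>I. pair d (x i (D f)) (y i g) p) + (\<Sum>i\<in>I. pair d (x i f) (y i (D g)) p) +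
      ((\<Sum>i\<in>I. \<Sum>l\<in>I. a i l * pair d (x l f) (y i g) p) +
      (\<Sum>i\<in>I. \<Sum>l\<in>I. - a l i * pair d (x i f) (y l g) p)))"
    by (simp add: left right sum.distrib algebra_simps)
  finally show ?case by (simp only: cancel) simp
qed

end

section \<open>Operators on three tensor legs and their relations\<close>

lemma sum_diagonal:
  assumes "finite I"
  shows "(\<Sum>i\<in>I. \<Sum>j\<in>I. if i = j then F i j else 0) = (\<Sum>i\<in>I. F i i)"
  using assms by (intro sum.cong refl) (simp add: sum.delta')

lemma sum_if_const: "(\<Sum>j\<in>I. if P then F j else 0) = (if P then sum F I else 0)"
  by simp

text \<open>Two opposite abelian families, with [[x_j, y_i], x_l] = \<delta>_ij x_l + \<delta>_il
  x_j and [y_l, [x_j, y_i]] = \<delta>_ij y_l + \<delta>_jl y_i. After contraction, each of the two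
  Kronecker terms contributes one copy of W, which gives the weight 2.\<close>

locale root_derivations = derivation_families +
  assumes x_commute: "\<lbrakk>i \<in> I; j \<in> I; f \<in> A\<rbrakk> \<Longrightarrow> x i (x j f) = x j (x i f)"
    and y_commute: "\<lbrakk>i \<in> I; j \<in> I; f \<in> A\<rbrakk> \<Longrightarrow> y i (y j f) = y j (y i f)"
    and xy_x: "\<lbrakk>i \<in> I; j \<in> I; l \<in> I; f \<in> A\<rbrakk> \<Longrightarrow>
      (\<lambda>p. x j (y i (x l f)) p - y i (x j (x l f)) p) =
      (\<lambda>p. x l (\<lambda>p. x j (y i f) p - y i (x j f) p) p +
        ((if i = j then x l f p else 0) + (if i = l then x j f p else 0)))"
    and xy_y: "\<lbrakk>i \<in> I; j \<in> I; l \<in> I; f \<in> A\<rbrakk> \<Longrightarrow>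
      y l (\<lambda>p. x j (y i f) p - y i (x j f) p) =
      (\<lambda>p. (x j (y i (y l f)) p - y i (x j (y l f)) p) +
        ((if i = j then y l f p else 0) + (if j = l then y i f p else 0)))"
begin

definition h :: "'c \<Rightarrow> 'c \<Rightarrow> ('a \<Rightarrow> 'b) \<Rightarrow> 'a \<Rightarrow> 'b" where
  "h j i f = (\<lambda>p. x j (y i f) p - y i (x j f) p)"

lemma h_mem:
  assumes "i \<in> I" "j \<in> I" "f \<in> A"
  shows "h j i f \<in> A"
proof -
  have "(\<lambda>p. x j (y i f) p + - 1 * y i (x j f) p) \<in> A"
    using assms by (intro mem)
  then show ?thesis by (simp add: h_def)
qed

text \<open>These functionals replace the tensor cube of \<open>A\<close>: an operator on tensors
  acts on them by precomposition, so the order of composition is reversed.\<close>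

definition tri :: "(('a \<Rightarrow> 'b) \<Rightarrow> ('a \<Rightarrow> 'b) \<Rightarrow> ('a \<Rightarrow> 'b) \<Rightarrow> 'b) set" where
  "tri = {T. (\<forall>f\<in>A. \<forall>f'\<in>A. \<forall>g\<in>A. \<forall>k\<in>A.
     T (\<lambda>p. f p + f' p) g k = T f g k + T f' g k \<and>
     T g (\<lambda>p. f p + f' p) k = T g f k + T g f' k \<and>
     T g k (\<lambda>p. f p + f' p) = T g k f + T g k f')}"

text \<open>Functionals are cut off outside \<open>A\<close>, so that their identities are equations between functions.\<close>

definition cut ::
  "(('a \<Rightarrow> 'b) \<Rightarrow> ('a \<Rightarrow> 'b) \<Rightarrow> ('a \<Rightarrow> 'b) \<Rightarrow> 'b) \<Rightarrow> ('a \<Rightarrow> 'b) \<Rightarrow> ('a \<Rightarrow> 'b) \<Rightarrow> ('a \<Rightarrow> 'b) \<Rightarrow> 'b" where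
  "cut T = (\<lambda>f g k. if f \<in> A \<and> g \<in> A \<and> k \<in> A then T f g k else 0)"

lemma cut_eq [simp]: "f \<in> A \<Longrightarrow> g \<in> A \<Longrightarrow> k \<in> A \<Longrightarrow> cut T f g k = T f g k"
  by (simp add: cut_def)

lemma cut_eqI:
  assumes "\<And>f g k. f \<in> A \<Longrightarrow> g \<in> A \<Longrightarrow> k \<in> A \<Longrightarrow> S f g k = T f g k"
  shows "cut S = cut T"
  using assms by (auto simp: cut_def fun_eq_iff)

lemma cut_plus: "cut S + cut T = cut (\<lambda>f g k. S f g k + T f g k)"
  by (auto simp: cut_def fun_eq_iff)

lemma triD:
  assumes "T \<in> tri" "f \<in> A" "f' \<in> A" "g \<in> A" "k \<in> A"
  shows "T (\<lambda>p. f p + f' p) g k = T f g k + T f' g k"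
    and "T g (\<lambda>p. f p + f' p) k = T g f k + T g f' k"
    and "T g k (\<lambda>p. f p + f' p) = T g k f + T g k f'"
  using assms unfolding tri_def by auto

lemma tri_zero: "T \<in> tri \<Longrightarrow> g \<in> A \<Longrightarrow> k \<in> A \<Longrightarrow> T g (\<lambda>p. 0) k = 0"
  using triD(2)[of T "\<lambda>p. 0" "\<lambda>p. 0" g k] function_algebra_zero[OF A] by simp

lemma tri_if:
  "T \<in> tri \<Longrightarrow> g \<in> A \<Longrightarrow> k \<in> A \<Longrightarrow> T g (\<lambda>p. if P then f p else 0) k = (if P then T g f k else 0)"
  by (cases P) (auto simp: tri_zero)

lemma if_mem: "f \<in> A \<Longrightarrow> (\<lambda>p. if P then f p else 0) \<in> A"
  by (cases P) (auto simp: function_algebra_zero[OF A])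

lemma tri_add_if:
  assumes T: "T \<in> tri" and "f \<in> A" "f' \<in> A" "f'' \<in> A" "g \<in> A" "k \<in> A"
  shows "T g (\<lambda>p. f p + ((if P then f' p else 0) + (if Q then f'' p else 0))) k =
    T g f k + ((if P then T g f' k else 0) + (if Q then T g f'' k else 0))"
  using triD(2)[OF T assms(2) function_algebra_add[OF A if_mem if_mem], of f' f'' g k P Q]
    triD(2)[OF T if_mem if_mem, of f' f'' g k P Q] assms
  by (simp add: tri_if)

text \<open>The actions of \<open>\<Sum>\<^sub>i x\<^sub>i \<otimes> y\<^sub>i\<close> in the tensor legs (2,3), (1,2) and (1,3), and of the
  commutator of the first two.\<close>

definition X where "X T = cut (\<lambda>f g k. \<Sum>i\<in>I. T f (x i g) (y i k))"
definition Y where "Y T = cut (\<lambda>f g k. \<Sum>i\<in>I. T (x i f) (y i g) k)"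
definition W where "W T = cut (\<lambda>f g k. \<Sum>i\<in>I. T (x i f) g (y i k))"
definition H where "H T = cut (\<lambda>f g k. \<Sum>i\<in>I. \<Sum>j\<in>I. T (x i f) (h j i g) (y j k))"

lemmas ops = X_def Y_def W_def H_def

lemma h_add:
  assumes "i \<in> I" "j \<in> I" "f \<in> A" "g \<in> A"
  shows "h j i (\<lambda>p. f p + g p) = (\<lambda>p. h j i f p + h j i g p)"
  using assms by (simp add: h_def derivation_add[OF x] derivation_add[OF y] mem fun_eq_iff)

lemma tri_add: "S \<in> tri \<Longrightarrow> T \<in> tri \<Longrightarrow> S + T \<in> tri"
  by (simp add: tri_def)

lemma additive_on_X: "additive_on tri X" and additive_on_Y: "additive_on tri Y"
  and additive_on_W: "additive_on tri W" and additive_on_H: "additive_on tri H"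
  unfolding additive_on_def
  by (auto simp: ops tri_def mem h_mem h_add derivation_add[OF x] derivation_add[OF y]
      cut_plus sum.distrib intro!: cut_eqI)

text \<open>The two operators share only the third leg, where the y commute. The companion below
  rests on the commuting x in the first leg.\<close>

lemma XW: "X (W T) = W (X T)"
  unfolding ops
  by (rule cut_eqI) (simp add: mem, subst sum.swap, simp add: y_commute cong: sum.cong)

lemma YW: "Y (W T) = W (Y T)"
  unfolding ops
  by (rule cut_eqI) (simp add: mem, subst sum.swap, simp add: x_commute cong: sum.cong)

lemma YX:
  assumes T: "T \<in> tri"
  shows "Y (X T) = X (Y T) + H T"
  unfolding ops cut_plus
proof (rule cut_eqI)
  fix f g k assume fgk: "f \<in> A" "g \<in> A" "k \<in> A"
  have *: "T (x i f) (x j (y i g)) (y j k) = T (x i f) (y i (x j g)) (y j k) + T (x i f) (h j i g) (y j k)"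
    if "i \<in> I" "j \<in> I" for i j
    using triD(2)[OF T, of "y i (x j g)" "h j i g" "x i f" "y j k"] that fgk
    by (simp add: mem h_mem) (simp add: h_def)
  have "(\<Sum>i\<in>I. \<Sum>j\<in>I. T (x i f) (x j (y i g)) (y j k)) =
      (\<Sum>j\<in>I. \<Sum>i\<in>I. T (x i f) (y i (x j g)) (y j k)) + (\<Sum>i\<in>I. \<Sum>j\<in>I. T (x i f) (h j i g) (y j k))"
    by (subst (2) sum.swap) (simp add: * sum.distrib)
  then show "(\<Sum>i\<in>I. cut (\<lambda>f g k. \<Sum>i\<in>I. T f (x i g) (y i k)) (x i f) (y i g) k) =
      (\<Sum>i\<in>I. cut (\<lambda>f g k. \<Sum>i\<in>I. T (x i f) (y i g) k) f (x i g) (y i k)) +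
      (\<Sum>i\<in>I. \<Sum>j\<in>I. T (x i f) (h j i g) (y j k))"
    using fgk by (simp add: mem)
qed

text \<open>In the middle leg, h is moved past x_l. The term with \<delta>_ij is a copy of W (X T)
  at once; the term with \<delta>_il becomes the same double sum because the y commute in the third
  leg.\<close>

lemma XH:
  assumes T: "T \<in> tri"
  shows "X (H T) = H (X T) + W (X T) + W (X T)"
  unfolding ops cut_plus
proof (rule cut_eqI)
  fix f g k assume fgk: "f \<in> A" "g \<in> A" "k \<in> A"
  have *: "T (x i f) (h j i (x l g)) (y j (y l k)) = T (x i f) (x l (h j i g)) (y l (y j k)) +
      ((if i = j then T (x i f) (x l g) (y l (y i k)) else 0) +
       (if i = l then T (x i f) (x j g) (y j (y i k)) else 0))"
    if "i \<in> I" "j \<in> I" "l \<in> I" for i j l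
    using that fgk unfolding h_def xy_x[OF that fgk(2)]
    by (subst tri_add_if[OF T]) (auto simp: mem h_mem[unfolded h_def] y_commute)
  have "(\<Sum>l\<in>I. \<Sum>i\<in>I. \<Sum>j\<in>I. T (x i f) (h j i (x l g)) (y j (y l k))) =
      (\<Sum>l\<in>I. \<Sum>i\<in>I. \<Sum>j\<in>I. T (x i f) (x l (h j i g)) (y l (y j k))) +
      ((\<Sum>l\<in>I. \<Sum>i\<in>I. T (x i f) (x l g) (y l (y i k))) + (\<Sum>i\<in>I. \<Sum>j\<in>I. T (x i f) (x j g) (y j (y i k))))"
  proof -
    have "(\<Sum>l\<in>I. \<Sum>i\<in>I. \<Sum>j\<in>I. if i = l then T (x i f) (x j g) (y j (y i k)) else 0) =
        (\<Sum>i\<in>I. \<Sum>j\<in>I. T (x i f) (x j g) (y j (y i k)))"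
      unfolding sum_if_const by (subst sum.swap) (rule sum_diagonal[OF finite_I])
    then show ?thesis by (simp only: * sum.distrib sum_diagonal[OF finite_I] cong: sum.cong)
  qed
  moreover have "(\<Sum>l\<in>I. \<Sum>i\<in>I. \<Sum>j\<in>I. T (x i f) (x l (h j i g)) (y l (y j k))) =
      (\<Sum>i\<in>I. \<Sum>j\<in>I. \<Sum>l\<in>I. T (x i f) (x l (h j i g)) (y l (y j k)))"
    by (subst sum.swap) (rule sum.cong[OF refl], rule sum.swap)
  moreover have "(\<Sum>l\<in>I. \<Sum>i\<in>I. T (x i f) (x l g) (y l (y i k))) =
      (\<Sum>i\<in>I. \<Sum>l\<in>I. T (x i f) (x l g) (y l (y i k)))"
    by (rule sum.swap)
  ultimately show "(\<Sum>i\<in>I. cut (\<lambda>f g k. \<Sum>i\<in>I. \<Sum>j\<in>I. T (x i f) (h j i g) (y j k)) f (x i g) (y i k)) =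
      (\<Sum>i\<in>I. \<Sum>j\<in>I. cut (\<lambda>f g k. \<Sum>i\<in>I. T f (x i g) (y i k)) (x i f) (h j i g) (y j k)) +
      (\<Sum>i\<in>I. cut (\<lambda>f g k. \<Sum>i\<in>I. T f (x i g) (y i k)) (x i f) g (y i k)) +
      (\<Sum>i\<in>I. cut (\<lambda>f g k. \<Sum>i\<in>I. T f (x i g) (y i k)) (x i f) g (y i k))"
    using fgk by (simp add: mem h_mem add.assoc)
qed

text \<open>The mirror image of \<open>XH\<close>: now h passes y_l in the middle leg, and the x
  commute in the first.\<close>

lemma HY:
  assumes T: "T \<in> tri"
  shows "H (Y T) = Y (H T) + W (Y T) + W (Y T)"
  unfolding ops cut_plus
proof (rule cut_eqI)
  fix f g k assume fgk: "f \<in> A" "g \<in> A" "k \<in> A"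
  have *: "T (x l (x i f)) (y l (h j i g)) (y j k) = T (x i (x l f)) (h j i (y l g)) (y j k) +
      ((if i = j then T (x l (x i f)) (y l g) (y i k) else 0) +
       (if j = l then T (x i (x j f)) (y i g) (y j k) else 0))"
    if "i \<in> I" "j \<in> I" "l \<in> I" for i j l
    using that fgk unfolding h_def xy_y[OF that fgk(2)]
    by (subst tri_add_if[OF T]) (auto simp: mem h_mem[unfolded h_def] x_commute)
  have "(\<Sum>i\<in>I. \<Sum>j\<in>I. \<Sum>l\<in>I. T (x l (x i f)) (y l (h j i g)) (y j k)) =
      (\<Sum>i\<in>I. \<Sum>j\<in>I. \<Sum>l\<in>I. T (x i (x l f)) (h j i (y l g)) (y j k)) +
      ((\<Sum>i\<in>I. \<Sum>l\<in>I. T (x l (x i f)) (y l g) (y i k)) + (\<Sum>i\<in>I. \<Sum>j\<in>I. T (x i (x j f)) (y i g) (y j k)))"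
  proof -
    have "(\<Sum>i\<in>I. \<Sum>j\<in>I. \<Sum>l\<in>I. if i = j then T (x l (x i f)) (y l g) (y i k) else 0) =
        (\<Sum>i\<in>I. \<Sum>l\<in>I. T (x l (x i f)) (y l g) (y i k))"
      unfolding sum_if_const by (rule sum_diagonal[OF finite_I])
    then show ?thesis by (simp only: * sum.distrib sum_diagonal[OF finite_I] cong: sum.cong)
  qed
  moreover have "(\<Sum>l\<in>I. \<Sum>i\<in>I. \<Sum>j\<in>I. T (x i (x l f)) (h j i (y l g)) (y j k)) =
      (\<Sum>i\<in>I. \<Sum>j\<in>I. \<Sum>l\<in>I. T (x i (x l f)) (h j i (y l g)) (y j k))"
    by (subst sum.swap) (rule sum.cong[OF refl], rule sum.swap)
  moreover have "(\<Sum>i\<in>I. \<Sum>j\<in>I. T (x i (x j f)) (y i g) (y j k)) =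
      (\<Sum>i\<in>I. \<Sum>l\<in>I. T (x l (x i f)) (y l g) (y i k))"
    by (rule sum.swap)
  ultimately show "(\<Sum>i\<in>I. \<Sum>j\<in>I. cut (\<lambda>f g k. \<Sum>i\<in>I. T (x i f) (y i g) k) (x i f) (h j i g) (y j k)) =
      (\<Sum>i\<in>I. cut (\<lambda>f g k. \<Sum>i\<in>I. \<Sum>j\<in>I. T (x i f) (h j i g) (y j k)) (x i f) (y i g) k) +
      (\<Sum>i\<in>I. cut (\<lambda>f g k. \<Sum>i\<in>I. T (x i f) (y i g) k) (x i f) g (y i k)) +
      (\<Sum>i\<in>I. cut (\<lambda>f g k. \<Sum>i\<in>I. T (x i f) (y i g) k) (x i f) g (y i k))"
    using fgk by (simp add: mem h_mem add.assoc)
qed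

text \<open>H acts on the middle argument through the brackets [x_j, y_i] alone, so evaluation has
  weight 0 once these kill g; f and k range over all of \<open>A\<close>.\<close>

lemma weight_zero_functional:
  assumes "f \<in> A" "g \<in> A" "k \<in> A" "\<And>i j. i \<in> I \<Longrightarrow> j \<in> I \<Longrightarrow> x j (y i g) = y i (x j g)"
  shows "weight_zero_functional tri X Y W H (\<lambda>T. T f g k)"
proof
  fix T assume "T \<in> tri"
  moreover have "h j i g = (\<lambda>p. 0)" if "i \<in> I" "j \<in> I" for i j
    using assms(4)[OF that] by (simp add: h_def)
  ultimately show "H T f g k = 0"
    using assms by (simp add: H_def mem tri_zero)
qed (simp_all add: tri_add additive_on_X additive_on_Y additive_on_W additive_on_H XW YW YX XH HY)

section \<open>The two bracketings of a triple product\<close>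

definition T0 where "T0 p = cut (\<lambda>f g k. f p * g p * k p)"

lemma T0_mem: "T0 p \<in> tri"
  by (simp add: T0_def tri_def mem algebra_simps)

text \<open>By the Leibniz rule, x_i acts on f g as on f plus as on g. So \<Omega> on (f g)
  \<otimes> k is the sum of the operators on the legs (1,3) and (2,3).\<close>

lemma pair_product_left:
  "cut (\<lambda>f g k. pair a (\<lambda>p. f p * g p) k p) = ((\<lambda>T. W T + X T) ^^ a) (T0 p)"
proof (induction a)
  case 0
  show ?case by (simp add: T0_def mult.assoc)
next
  case (Suc a)
  let ?T = "cut (\<lambda>f g k. pair a (\<lambda>p. f p * g p) k p)"
  have "cut (\<lambda>f g k. pair (Suc a) (\<lambda>p. f p * g p) k p) =
      cut (\<lambda>f g k. (\<Sum>i\<in>I. pair a (\<lambda>p. x i f p * g p) (y i k) p) + (\<Sum>i\<in>I. pair a (\<lambda>p. f p * x i g p) (y i k) p))"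
    by (rule cut_eqI) (simp add: derivation_mult[OF x] pair_add_left mem sum.distrib)
  moreover have "W ?T + X ?T = cut (\<lambda>f g k. (\<Sum>i\<in>I. pair a (\<lambda>p. x i f p * g p) (y i k) p) + (\<Sum>i\<in>I. pair a (\<lambda>p. f p * x i g p) (y i k) p))"
    unfolding W_def X_def cut_plus by (rule cut_eqI) (simp only: cut_eq mem cong: sum.cong)
  ultimately show ?case
    unfolding funpow.simps o_apply by (simp only: Suc.IH)
qed

lemma pair_product_right:
  "cut (\<lambda>f g k. pair a f (\<lambda>p. g p * k p) p) = ((\<lambda>T. W T + Y T) ^^ a) (T0 p)"
proof (induction a)
  case 0
  show ?case by (simp add: T0_def mult.assoc)
next
  case (Suc a)
  let ?T = "cut (\<lambda>f g k. pair a f (\<lambda>p. g p * k p) p)"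
  have "cut (\<lambda>f g k. pair (Suc a) f (\<lambda>p. g p * k p) p) =
      cut (\<lambda>f g k. (\<Sum>i\<in>I. pair a (x i f) (\<lambda>p. g p * y i k p) p) + (\<Sum>i\<in>I. pair a (x i f) (\<lambda>p. y i g p * k p) p))"
    by (rule cut_eqI) (simp add: derivation_mult[OF y] pair_add_right mem sum.distrib add.commute)
  moreover have "W ?T + Y ?T = cut (\<lambda>f g k. (\<Sum>i\<in>I. pair a (x i f) (\<lambda>p. g p * y i k p) p) + (\<Sum>i\<in>I. pair a (x i f) (\<lambda>p. y i g p * k p) p))"
    unfolding W_def Y_def cut_plus by (rule cut_eqI) (simp only: cut_eq mem cong: sum.cong)
  ultimately show ?case
    unfolding funpow.simps o_apply by (simp only: Suc.IH)
qed

text \<open>The inner pairing acts first on the arguments, hence its operator Y stands outermost on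
  functionals. It therefore has to be moved through X to reach normal order.\<close>

lemma pair_pair_left_eq:
  assumes "f \<in> A" "g \<in> A" "k \<in> A"
  shows "pair a (pair b f g) k p = (Y ^^ b) (((\<lambda>T. W T + X T) ^^ a) (T0 p)) f g k"
  using assms unfolding pair_product_left[symmetric]
proof (induction b arbitrary: f g)
  case (Suc b)
  then show ?case
    by (simp add: Y_def mem pair_sum_left pair_mem Suc.IH[symmetric])
qed simp

lemma pair_pair_right_eq:
  assumes "f \<in> A" "g \<in> A" "k \<in> A"
  shows "pair a f (pair b g k) p = (X ^^ b) (((\<lambda>T. W T + Y T) ^^ a) (T0 p)) f g k"
  using assms unfolding pair_product_right[symmetric]
proof (induction b arbitrary: g k)
  case (Suc b)
  then show ?case
    by (simp add: X_def mem pair_sum_right pair_mem Suc.IH[symmetric])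
qed simp

lemma pair_pair_left:
  assumes "f \<in> A" "g \<in> A" "k \<in> A" "\<And>i j. i \<in> I \<Longrightarrow> j \<in> I \<Longrightarrow> x j (y i g) = y i (x j g)"
  shows "pair a (pair b f g) k p = (\<Sum>s\<le>a. of_nat (a choose s) * (\<Sum>q\<le>b. ordering_coeff (a - s) b q *
    (X ^^ (a - s - q)) ((Y ^^ (b - q)) ((W ^^ (q + s)) (T0 p))) f g k))"
proof -
  interpret weight_zero_functional tri X Y W H "\<lambda>T. T f g k"
    by (rule weight_zero_functional[OF assms])
  have "(Y ^^ b) (((\<lambda>T. W T + X T) ^^ a) (T0 p)) f g k =
      (\<Sum>s\<le>a. of_nat (a choose s) * (Y ^^ b) ((X ^^ (a - s)) ((W ^^ s) (T0 p))) f g k)"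
    by (rule binomial_on[of tri X W "\<lambda>T. (Y ^^ b) T f g k"])
      (simp_all add: tri_add additive_on_X additive_on_W XW T0_mem
        additive_on_add[OF additive_on_funpow[OF additive_on_Y]])
  also have "\<dots> = (\<Sum>s\<le>a. of_nat (a choose s) * (\<Sum>q\<le>b. ordering_coeff (a - s) b q *
    (X ^^ (a - s - q)) ((Y ^^ (b - q)) ((W ^^ (q + s)) (T0 p))) f g k))"
    by (simp add: normal_ordering funpow_mem[OF additive_on_W] T0_mem funpow_add)
  finally show ?thesis
    by (simp only: pair_pair_left_eq[OF assms(1-3)])
qed

text \<open>Here X already stands outside Y, so the binomial theorem alone yields the normal form;
  it is the target for the other bracketing.\<close>

lemma pair_pair_right:
  assumes "f \<in> A" "g \<in> A" "k \<in> A"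
  shows "pair a f (pair b g k) p = (\<Sum>s\<le>a. of_nat (a choose s) *
    (X ^^ b) ((Y ^^ (a - s)) ((W ^^ s) (T0 p))) f g k)"
  unfolding pair_pair_right_eq[OF assms]
  by (rule binomial_on[of tri Y W "\<lambda>T. (X ^^ b) T f g k"])
    (simp_all add: tri_add additive_on_Y additive_on_W YW T0_mem
      additive_on_add[OF additive_on_funpow[OF additive_on_X]])

end

section \<open>Extension to power series\<close>

lemma coeff_fun_add: "coeff_fun k (\<lambda>p. F p + G p) = (\<lambda>p. coeff_fun k F p + coeff_fun k G p)"
  and coeff_fun_diff: "coeff_fun k (\<lambda>p. F p - G p) = (\<lambda>p. coeff_fun k F p - coeff_fun k G p)"
  and coeff_fun_zero: "coeff_fun k (\<lambda>p. 0) = (\<lambda>p. 0)"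
  and coeff_fun_mult: "coeff_fun k (\<lambda>p. F p * G p) = (\<lambda>p. \<Sum>i\<in>{0..k}. coeff_fun i F p * coeff_fun (k - i) G p)"
  and coeff_fun_scale: "coeff_fun k (\<lambda>p. c * F p) = (\<lambda>p. \<Sum>i\<in>{0..k}. fps_nth c i * coeff_fun (k - i) F p)"
  by (auto simp: coeff_fun_def fps_mult_nth)

lemma coeff_fun_if: "coeff_fun k (\<lambda>p. if P then F p else 0) = (\<lambda>p. if P then coeff_fun k F p else 0)"
  by (cases P) (simp_all add: coeff_fun_def)

lemma coeff_fun_sum: "coeff_fun k (\<lambda>p. \<Sum>i\<in>I. F i p) = (\<lambda>p. \<Sum>i\<in>I. coeff_fun k (F i) p)"
  and coeff_fun_const_scale: "coeff_fun k (\<lambda>p. fps_const c * G p) = (\<lambda>p. c * coeff_fun k G p)"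
  by (auto simp: coeff_fun_def fps_sum_nth)

lemma coeff_fun_coeffwise [simp]: "coeff_fun k (coeffwise D F) = D (coeff_fun k F)"
  by (auto simp: coeff_fun_def coeffwise_def)

lemma series_eqI: "(\<And>k. coeff_fun k F = coeff_fun k G) \<Longrightarrow> F = G"
  by (auto simp: coeff_fun_def fun_eq_iff fps_eq_iff)

lemma series_coeff: "F \<in> series_over A \<Longrightarrow> coeff_fun k F \<in> A"
  by (simp add: series_over_def)

lemma function_algebra_series_over:
  assumes A: "function_algebra A"
  shows "function_algebra (series_over A)"
  unfolding function_algebra_def series_over_def mem_Collect_eq coeff_fun_scale
  unfolding coeff_fun_add coeff_fun_zero coeff_fun_mult
  by (simp add: function_algebra_zero[OF A] function_algebra_add[OF A] function_algebra_sum[OF A]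
      function_algebra_mult[OF A] function_algebra_scale[OF A])

text \<open>Through this the calculus of pairings applies over the power series ring itself, with t
  as a scalar, and bilinearity in t comes for free.\<close>

lemma derivation_coeffwise:
  assumes A: "function_algebra A" and D: "derivation_on A D"
  shows "derivation_on (series_over A) (coeffwise D)"
proof -
  note mem = derivation_mem[OF D] series_coeff function_algebra_mult[OF A] function_algebra_scale[OF A]
  have "coeffwise D (\<lambda>p. F p + G p) = (\<lambda>p. coeffwise D F p + coeffwise D G p)"
    if "F \<in> series_over A" "G \<in> series_over A" for F G
    using that by (intro series_eqI) (simp add: coeff_fun_add derivation_add[OF D] mem)
  moreover have "coeffwise D (\<lambda>p. c * F p) = (\<lambda>p. c * coeffwise D F p)" if "F \<in> series_over A" for c F
    using that by (intro series_eqI)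
      (simp add: coeff_fun_scale derivation_sum[OF A D] derivation_scale[OF D] mem)
  moreover have "coeffwise D (\<lambda>p. F p * G p) = (\<lambda>p. coeffwise D F p * G p + F p * coeffwise D G p)"
    if "F \<in> series_over A" "G \<in> series_over A" for F G
    using that by (intro series_eqI)
      (simp add: coeff_fun_mult coeff_fun_add derivation_sum[OF A D] derivation_mult[OF D] mem sum.distrib)
  ultimately show ?thesis
    by (auto simp: derivation_on_def series_over_def derivation_mem[OF D])
qed


section \<open>The root vector fields\<close>

context
  notes One_nat_def [simp del]
begin

lemma mat_unit_carrier [simp]: "mat_unit n a b \<in> carrier_mat (n + 1) (n + 1)"
  by (simp add: mat_unit_def)

lemma mat_unit_entry: "i \<le> n \<Longrightarrow> j \<le> n \<Longrightarrow> mat_unit n a b $$ (i, j) = (if i = a \<and> j = b then 1 else 0)"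
  by (simp add: mat_unit_def)

lemma mult_mat_unit_entry:
  assumes "X \<in> gl (n + 1)" "a \<le> n" "p \<le> n" "q \<le> n"
  shows "(X * mat_unit n a b) $$ (p, q) = (if q = b then X $$ (p, a) else 0)"
proof -
  have "(X * mat_unit n a b) $$ (p, q) = (\<Sum>k<n + 1. X $$ (p, k) * (if k = a \<and> q = b then 1 else 0))"
    using assms by (subst mat_mult_entry[of _ "n + 1"]) (auto simp: mat_unit_entry)
  also have "\<dots> = (\<Sum>k<n + 1. if k = a then (if q = b then X $$ (p, a) else 0) else 0)"
    by (intro sum.cong) auto
  finally show ?thesis using assms by simp
qed

lemma mat_unit_mult_entry:
  assumes "X \<in> gl (n + 1)" "b \<le> n" "p \<le> n" "q \<le> n"
  shows "(mat_unit n a b * X) $$ (p, q) = (if p = a then X $$ (b, q) else 0)"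
proof -
  have "(mat_unit n a b * X) $$ (p, q) = (\<Sum>k<n + 1. (if p = a \<and> k = b then 1 else 0) * X $$ (k, q))"
    using assms by (subst mat_mult_entry[of _ "n + 1"]) (auto simp: mat_unit_entry)
  also have "\<dots> = (\<Sum>k<n + 1. if k = b then (if p = a then X $$ (b, q) else 0) else 0)"
    by (intro sum.cong) auto
  finally show ?thesis using assms by simp
qed

lemma bracket_entry:
  assumes "X \<in> gl N" "Y \<in> gl N" "p < N" "q < N"
  shows "lie_bracket X Y $$ (p, q) = (X * Y) $$ (p, q) - (Y * X) $$ (p, q)"
  using assms by (simp add: lie_bracket_def)

lemma bracket_carrier: "X \<in> gl N \<Longrightarrow> Y \<in> gl N \<Longrightarrow> lie_bracket X Y \<in> gl N"
  by (simp add: lie_bracket_def minus_carrier_mat mult_carrier_mat[of _ N N _ N])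

context
  fixes n :: nat
begin

abbreviation crd where "crd \<equiv> coord_ring (n + 1)"
abbreviation DX where "DX i \<equiv> left_vf (n + 1) (root_x n i)"
abbreviation DY where "DY i \<equiv> left_vf (n + 1) (root_y n i)"

lemma root_carrier:
  assumes "i \<in> {1..n}"
  shows "root_x n i \<in> gl (n + 1)" "root_y n i \<in> gl (n + 1)"
  using assms by (simp_all add: root_x_eq root_y_eq)

lemma derivation_DX: "i \<in> {1..n} \<Longrightarrow> derivation_on crd (DX i)"
  and derivation_DY: "i \<in> {1..n} \<Longrightarrow> derivation_on crd (DY i)"
  by (simp_all add: derivation_left_vf root_carrier del: atLeastAtMost_iff)

lemma left_vf_commute:
  assumes "X \<in> gl N" "Y \<in> gl N" "f \<in> coord_ring N" "X * Y = Y * X"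
  shows "left_vf N X (left_vf N Y f) = left_vf N Y (left_vf N X f)"
proof -
  have "lie_bracket X Y $$ (i, j) = 0" if "i < N" "j < N" for i j
    using assms that by (simp add: bracket_entry[of X N Y])
  then have "left_vf N (lie_bracket X Y) f = (\<lambda>g. 0)"
    \<comment> \<open>The bracket is the zero matrix, written as an empty linear
      combination.\<close>
    using left_vf_linear_combination[of "{}" undefined N "lie_bracket X Y" undefined f] assms
    by (simp add: bracket_carrier)
  then show ?thesis
    using left_vf_bracket[OF assms(1-3)] by (simp add: fun_eq_iff)
qed

text \<open>All products of two x vanish as matrices, and so do all products of two y.\<close>

lemma DX_commute: "i \<in> {1..n} \<Longrightarrow> j \<in> {1..n} \<Longrightarrow> f \<in> crd \<Longrightarrow> DX i (DX j f) = DX j (DX i f)"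
  and DY_commute: "i \<in> {1..n} \<Longrightarrow> j \<in> {1..n} \<Longrightarrow> f \<in> crd \<Longrightarrow> DY i (DY j f) = DY j (DY i f)"
  by (rule left_vf_commute; simp add: root_x_eq root_y_eq mat_unit_mult)+

text \<open>The action of the Levi subalgebra on the span of the \<open>x\<^sub>i\<close> is dual to its action on the
  span of the \<open>y\<^sub>i\<close>.\<close>

definition levi_action :: "complex mat \<Rightarrow> nat \<Rightarrow> nat \<Rightarrow> complex" where
  "levi_action Z i l = (if i = l then Z $$ (0, 0) else 0) - Z $$ (i, l)"

lemma levi_carrier: "Z \<in> levi n \<Longrightarrow> Z \<in> gl (n + 1)"
  by (simp add: levi_def)

lemma levi_DX:
  assumes Z: "Z \<in> levi n" and i: "i \<in> {1..n}" and f: "f \<in> crd"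
  shows "left_vf (n + 1) Z (DX i f) =
    (\<lambda>p. DX i (left_vf (n + 1) Z f) p + (\<Sum>l\<in>{1..n}. levi_action Z i l * DX l f p))"
proof -
  note c = levi_carrier[OF Z] root_carrier(1)[OF i]
  have "left_vf (n + 1) (lie_bracket Z (root_x n i)) f = (\<lambda>p. \<Sum>l\<in>{1..n}. levi_action Z i l * DX l f p)"
  proof (rule left_vf_linear_combination[OF _ bracket_carrier[OF c] _ f])
    fix p q assume pq: "p < n + 1" "q < n + 1"
    have "lie_bracket Z (root_x n i) $$ (p, q) =
        (if q = i then Z $$ (p, 0) else 0) - (if p = 0 then Z $$ (i, q) else 0)"
      using pq i c by (simp add: bracket_entry[of _ "n + 1"] root_x_eq mult_mat_unit_entry mat_unit_mult_entry
          del: index_mult_mat)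
    \<comment> \<open>Block diagonality removes the entries of column 0 below the corner, so that
      the bracket stays in the span of the x.\<close>
    also have "\<dots> = (if p = 0 \<and> q \<in> {1..n} then levi_action Z i q else 0)"
      using pq i Z by (cases "q = 0") (auto simp: levi_def levi_action_def)
    also have "\<dots> = (\<Sum>l\<in>{1..n}. if l = q then (if p = 0 then levi_action Z i q else 0) else 0)"
      by simp
    also have "\<dots> = (\<Sum>l\<in>{1..n}. levi_action Z i l * root_x n l $$ (p, q))"
      using pq by (intro sum.cong) (auto simp: root_x_eq mat_unit_entry)
    finally show "lie_bracket Z (root_x n i) $$ (p, q) = (\<Sum>l\<in>{1..n}. levi_action Z i l * root_x n l $$ (p, q))" .
  qed (rule root_carrier)
  then show ?thesis
    using left_vf_bracket[OF c f] by (auto simp: fun_eq_iff diff_eq_eq add.commute)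
qed

lemma levi_DY:
  assumes Z: "Z \<in> levi n" and i: "i \<in> {1..n}" and f: "f \<in> crd"
  shows "left_vf (n + 1) Z (DY i f) =
    (\<lambda>p. DY i (left_vf (n + 1) Z f) p + (\<Sum>l\<in>{1..n}. - levi_action Z l i * DY l f p))"
proof -
  note c = levi_carrier[OF Z] root_carrier(2)[OF i]
  have "left_vf (n + 1) (lie_bracket Z (root_y n i)) f = (\<lambda>p. \<Sum>l\<in>{1..n}. - levi_action Z l i * DY l f p)"
  proof (rule left_vf_linear_combination[OF _ bracket_carrier[OF c] _ f])
    fix p q assume pq: "p < n + 1" "q < n + 1"
    have "lie_bracket Z (root_y n i) $$ (p, q) =
        (if q = 0 then Z $$ (p, i) else 0) - (if p = i then Z $$ (0, q) else 0)"
      using pq i c by (simp add: bracket_entry[of _ "n + 1"] root_y_eq mult_mat_unit_entry mat_unit_mult_entry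
          del: index_mult_mat)
    also have "\<dots> = (if q = 0 \<and> p \<in> {1..n} then - levi_action Z p i else 0)"
      using pq i Z by (cases "p = 0") (auto simp: levi_def levi_action_def)
    also have "\<dots> = (\<Sum>l\<in>{1..n}. if l = p then (if q = 0 then - levi_action Z p i else 0) else 0)"
      by simp
    also have "\<dots> = (\<Sum>l\<in>{1..n}. - levi_action Z l i * root_y n l $$ (p, q))"
      using pq by (intro sum.cong) (auto simp: root_y_eq mat_unit_entry)
    finally show "lie_bracket Z (root_y n i) $$ (p, q) = (\<Sum>l\<in>{1..n}. - levi_action Z l i * root_y n l $$ (p, q))" .
  qed (rule root_carrier)
  then show ?thesis
    using left_vf_bracket[OF c f] by (auto simp: fun_eq_iff diff_eq_eq add.commute)
qed

context
  fixes i j assumes i: "i \<in> {1..n}" and j: "j \<in> {1..n}"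
begin

lemma root_bracket_entry:
  assumes "p \<le> n" "q \<le> n"
  shows "lie_bracket (root_x n j) (root_y n i) $$ (p, q) =
    (if p = 0 \<and> q = 0 \<and> i = j then 1 else 0) - (if p = i \<and> q = j then 1 else 0)"
  using i j assms
  by (simp add: lie_bracket_def root_x_eq root_y_eq mat_unit_mult) (auto simp: mat_unit_def)

lemma root_bracket_levi: "lie_bracket (root_x n j) (root_y n i) \<in> levi n"
  using i j by (auto simp: levi_def bracket_carrier root_carrier root_bracket_entry)

lemma root_bracket_action:
  assumes "l \<in> {1..n}" "m \<in> {1..n}"
  shows "levi_action (lie_bracket (root_x n j) (root_y n i)) l m =
    (if l = m then (if i = j then 1 else 0) else 0) + (if l = i then (if m = j then 1 else 0) else 0)"
  using assms i j by (auto simp: levi_action_def root_bracket_entry)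

lemma DX_DY_bracket:
  "f \<in> crd \<Longrightarrow> left_vf (n + 1) (lie_bracket (root_x n j) (root_y n i)) f = (\<lambda>p. DX j (DY i f) p - DY i (DX j f) p)"
  by (rule left_vf_bracket[OF root_carrier(1)[OF j] root_carrier(2)[OF i]])

text \<open>The bracket [x_j, y_i] is itself in the Levi subalgebra, so its action on the x is a
  case of \<open>levi_DX\<close>, with coefficients \<delta>_ij \<delta>_lm + \<delta>_il
  \<delta>_jm.\<close>

lemma DXY_DX:
  assumes l: "l \<in> {1..n}" and f: "f \<in> crd"
  shows "(\<lambda>p. DX j (DY i (DX l f)) p - DY i (DX j (DX l f)) p) =
    (\<lambda>p. DX l (\<lambda>p. DX j (DY i f) p - DY i (DX j f) p) p +
      ((if i = j then DX l f p else 0) + (if i = l then DX j f p else 0)))"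
proof -
  have "(\<Sum>m\<in>{1..n}. levi_action (lie_bracket (root_x n j) (root_y n i)) l m * DX m f p) =
      (if i = j then DX l f p else 0) + (if i = l then DX j f p else 0)" for p
  proof -
    have "(\<Sum>m\<in>{1..n}. levi_action (lie_bracket (root_x n j) (root_y n i)) l m * DX m f p) =
        (\<Sum>m\<in>{1..n}. (if l = m then (if i = j then DX l f p else 0) else 0) +
          (if j = m then (if i = l then DX j f p else 0) else 0))"
      using l by (intro sum.cong refl) (auto simp: root_bracket_action)
    then show ?thesis using l j by (simp add: sum.distrib)
  qed
  then show ?thesis
    using levi_DX[OF root_bracket_levi l f] DX_DY_bracket[OF f]
      DX_DY_bracket[OF derivation_mem[OF derivation_DX[OF l] f]] by simp
qed

lemma DY_DXY:
  assumes l: "l \<in> {1..n}" and f: "f \<in> crd"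
  shows "DY l (\<lambda>p. DX j (DY i f) p - DY i (DX j f) p) =
    (\<lambda>p. (DX j (DY i (DY l f)) p - DY i (DX j (DY l f)) p) +
      ((if i = j then DY l f p else 0) + (if j = l then DY i f p else 0)))"
proof -
  have "(\<Sum>m\<in>{1..n}. - levi_action (lie_bracket (root_x n j) (root_y n i)) m l * DY m f p) =
      - ((if i = j then DY l f p else 0) + (if j = l then DY i f p else 0))" for p
  proof -
    have "(\<Sum>m\<in>{1..n}. - levi_action (lie_bracket (root_x n j) (root_y n i)) m l * DY m f p) =
        - (\<Sum>m\<in>{1..n}. (if l = m then (if i = j then DY l f p else 0) else 0) +
          (if i = m then (if j = l then DY i f p else 0) else 0))"
      unfolding sum_negf[symmetric]
      using l by (intro sum.cong refl) (auto simp: root_bracket_action)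
    then show ?thesis using l i by (simp add: sum.distrib)
  qed
  then show ?thesis
    using levi_DY[OF root_bracket_levi l f] DX_DY_bracket[OF f]
      DX_DY_bracket[OF derivation_mem[OF derivation_DY[OF l] f]] by (simp add: fun_eq_iff)
qed

text \<open>The bracket lies in the Levi subalgebra and kills f. Associativity draws on invariance
  in this form.\<close>

lemma DX_DY_invariant:
  assumes "f \<in> levi_invariants n"
  shows "DX j (DY i f) = DY i (DX j f)"
  using assms DX_DY_bracket[of f] root_bracket_levi by (auto simp: levi_invariants_def fun_eq_iff)

end

end

end

lemma function_algebra_series_coord_ring: "function_algebra (series_over (coord_ring N))"
  by (intro function_algebra_series_over function_algebra_coord_ring)

global_interpretation fields: root_derivations "series_over (coord_ring (n + 1))" "{1..n}"
  "\<lambda>i. coeffwise (left_vf (n + 1) (root_x n i))" "\<lambda>i. coeffwise (left_vf (n + 1) (root_y n i))" for n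
proof
  fix i assume i: "i \<in> {1..n}"
  show "derivation_on (series_over (coord_ring (n + 1))) (coeffwise (left_vf (n + 1) (root_x n i)))"
    "derivation_on (series_over (coord_ring (n + 1))) (coeffwise (left_vf (n + 1) (root_y n i)))"
    by (intro derivation_coeffwise function_algebra_coord_ring derivation_DX derivation_DY i)+
next
  fix i j F assume "i \<in> {1..n}" "j \<in> {1..n}" "F \<in> series_over (coord_ring (n + 1))"
  then show "coeffwise (left_vf (n + 1) (root_x n i)) (coeffwise (left_vf (n + 1) (root_x n j)) F) =
      coeffwise (left_vf (n + 1) (root_x n j)) (coeffwise (left_vf (n + 1) (root_x n i)) F)"
    "coeffwise (left_vf (n + 1) (root_y n i)) (coeffwise (left_vf (n + 1) (root_y n j)) F) =
      coeffwise (left_vf (n + 1) (root_y n j)) (coeffwise (left_vf (n + 1) (root_y n i)) F)"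
    by (intro series_eqI; simp only: coeff_fun_coeffwise DX_commute DY_commute series_coeff)+
next
  fix i j l F assume *: "i \<in> {1..n}" "j \<in> {1..n}" "l \<in> {1..n}" "F \<in> series_over (coord_ring (n + 1))"
  let ?x = "\<lambda>i. coeffwise (left_vf (n + 1) (root_x n i))"
  let ?y = "\<lambda>i. coeffwise (left_vf (n + 1) (root_y n i))"
  show "(\<lambda>p. ?x j (?y i (?x l F)) p - ?y i (?x j (?x l F)) p) =
      (\<lambda>p. ?x l (\<lambda>p. ?x j (?y i F) p - ?y i (?x j F) p) p +
        ((if i = j then ?x l F p else 0) + (if i = l then ?x j F p else 0)))"
    by (intro series_eqI)
      (simp only: coeff_fun_add coeff_fun_diff coeff_fun_if coeff_fun_coeffwise
        DXY_DX[OF *(1-3) series_coeff[OF *(4)]])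
  show "?y l (\<lambda>p. ?x j (?y i F) p - ?y i (?x j F) p) =
      (\<lambda>p. (?x j (?y i (?y l F)) p - ?y i (?x j (?y l F)) p) +
        ((if i = j then ?y l F p else 0) + (if j = l then ?y i F p else 0)))"
    by (intro series_eqI)
      (simp only: coeff_fun_add coeff_fun_diff coeff_fun_if coeff_fun_coeffwise
        DY_DXY[OF *(1-3) series_coeff[OF *(4)]])
qed (simp_all add: function_algebra_series_coord_ring)

section \<open>The star product\<close>

text \<open>Coefficient form of \<Omega>^(d+1) = \<Omega>^d \<Omega>: for |m| = d + 1 the factor d +
  1 is the sum of the m_i, and m_i / m_i! = 1 / (m_i - 1)!.\<close>

lemma multinomial_Suc:
  fixes \<phi> :: "(nat \<Rightarrow> nat) \<Rightarrow> complex fps"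
  shows "of_nat (Suc d) * (\<Sum>m | m \<in> multi_indices n \<and> mdeg n m = Suc d.
      fps_const (1 / (\<Prod>i=1..n. fact (m i))) * \<phi> m) =
    (\<Sum>i\<in>{1..n}. \<Sum>m | m \<in> multi_indices n \<and> mdeg n m = d.
      fps_const (1 / (\<Prod>i=1..n. fact (m i))) * \<phi> (m(i := Suc (m i))))"
proof -
  let ?M = "\<lambda>d. {m. m \<in> multi_indices n \<and> mdeg n m = d}"
  let ?r = "\<lambda>m. fps_const (1 / (\<Prod>i=1..n. fact (m i))) :: complex fps"
  have fin: "finite (?M d)" for d
    by (rule finite_subset[OF _ finite_multi_indices[of n d]]) auto
  have mdeg_Suc: "mdeg n (m(i := Suc (m i))) = Suc (mdeg n m)" if "i \<in> {1..n}" for m i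
    using that unfolding mdeg_def by (subst (1 2) sum.remove[of _ i]) auto
  have fact_Suc: "of_nat (Suc (m i)) * ?r (m(i := Suc (m i))) = ?r m" if "i \<in> {1..n}" for m i
  proof -
    have "(\<Prod>j=1..n. fact ((m(i := Suc (m i))) j) :: complex) = of_nat (Suc (m i)) * (\<Prod>j=1..n. fact (m j))"
      using that by (subst (1 2) prod.remove[of _ i]) (auto simp del: of_nat_Suc)
    then show ?thesis
      unfolding of_nat_eq_fps_const fps_const_mult by (simp del: of_nat_Suc)
  qed
  have "of_nat (Suc d) * (\<Sum>m\<in>?M (Suc d). ?r m * \<phi> m) =
      (\<Sum>m\<in>?M (Suc d). \<Sum>i\<in>{1..n}. of_nat (m i) * (?r m * \<phi> m))"
    unfolding sum_distrib_left
  proof (intro sum.cong refl)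
    fix m assume "m \<in> ?M (Suc d)"
    then have "of_nat (Suc d) = (\<Sum>i\<in>{1..n}. of_nat (m i) :: complex fps)"
      by (simp add: mdeg_def flip: of_nat_sum)
    then show "of_nat (Suc d) * (?r m * \<phi> m) = (\<Sum>i\<in>{1..n}. of_nat (m i) * (?r m * \<phi> m))"
      by (simp only: sum_distrib_right)
  qed
  also have "\<dots> = (\<Sum>i\<in>{1..n}. \<Sum>m\<in>?M (Suc d). of_nat (m i) * (?r m * \<phi> m))"
    by (rule sum.swap)
  also have "\<dots> = (\<Sum>i\<in>{1..n}. \<Sum>m\<in>?M d. ?r m * \<phi> (m(i := Suc (m i))))"
  proof (rule sum.cong[OF refl])
    fix i assume i: "i \<in> {1..n}"
    have "(\<Sum>m\<in>?M (Suc d). of_nat (m i) * (?r m * \<phi> m)) =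
        (\<Sum>m\<in>{m \<in> ?M (Suc d). m i \<noteq> 0}. of_nat (m i) * (?r m * \<phi> m))"
      by (rule sum.mono_neutral_right) (auto simp: fin)
    also have "\<dots> = (\<Sum>m\<in>?M d. ?r m * \<phi> (m(i := Suc (m i))))"
    proof (rule sum.reindex_bij_witness[where i = "\<lambda>m. m(i := Suc (m i))" and j = "\<lambda>m. m(i := m i - 1)"])
      fix m assume m: "m \<in> {m \<in> ?M (Suc d). m i \<noteq> 0}"
      then show eq: "(m(i := m i - 1))(i := Suc ((m(i := m i - 1)) i)) = m" by auto
      show "m(i := m i - 1) \<in> ?M d"
        using mdeg_Suc[OF i, of "m(i := m i - 1)"] m i unfolding eq by (auto simp: multi_indices_def)
      show "?r (m(i := m i - 1)) * \<phi> ((m(i := m i - 1))(i := Suc ((m(i := m i - 1)) i))) =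
          of_nat (m i) * (?r m * \<phi> m)"
        using fact_Suc[OF i, of "m(i := m i - 1)"] m unfolding eq
        by (simp add: mult.assoc[symmetric] del: of_nat_Suc)
    next
      fix m assume m: "m \<in> ?M d"
      show "m(i := Suc (m i), i := (m(i := Suc (m i))) i - 1) = m" by simp
      show "m(i := Suc (m i)) \<in> {m \<in> ?M (Suc d). m i \<noteq> 0}"
        using m i mdeg_Suc[OF i, of m] by (auto simp: multi_indices_def)
    qed
    finally show "(\<Sum>m\<in>?M (Suc d). of_nat (m i) * (?r m * \<phi> m)) = (\<Sum>m\<in>?M d. ?r m * \<phi> (m(i := Suc (m i))))" .
  qed
  finally show ?thesis .
qed

text \<open>The head of the list acts first. The additional factor \<open>D i\<close> is commuted
  past the powers of the operators preceding it, until it acts before everything else.\<close>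

lemma fold_funpow_Suc:
  assumes D: "\<And>i f. i \<in> set js \<Longrightarrow> f \<in> A \<Longrightarrow> D i f \<in> A"
    and comm: "\<And>i j f. i \<in> set js \<Longrightarrow> j \<in> set js \<Longrightarrow> f \<in> A \<Longrightarrow> D i (D j f) = D j (D i f)"
    and "distinct js" "i \<in> set js" "f \<in> A"
  shows "fold (\<lambda>j. D j ^^ ((m(i := Suc (m i))) j)) js f = fold (\<lambda>j. D j ^^ m j) js (D i f)"
  using assms
proof (induction js arbitrary: f)
  case (Cons j js)
  have pow: "(D j ^^ k) f \<in> A" "(D j ^^ k) (D i f) = D i ((D j ^^ k) f)" for k
  proof (induction k)
    case (Suc k)
    { case 1 then show ?case using Suc Cons.prems(1) by simp }
    { case 2 then show ?case using Suc Cons.prems by simp }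
  qed (use Cons.prems in simp_all)
  show ?case
  proof (cases "i = j")
    case True
    then have "fold (\<lambda>j. D j ^^ ((m(i := Suc (m i))) j)) js f' = fold (\<lambda>j. D j ^^ m j) js f'" for f'
      using Cons.prems(3) by (intro fold_cong) auto
    then show ?thesis using True pow(2) by simp
  next
    case False
    then have "fold (\<lambda>j. D j ^^ ((m(i := Suc (m i))) j)) js ((D j ^^ m j) f) =
        fold (\<lambda>j. D j ^^ m j) js (D i ((D j ^^ m j) f))"
      using Cons.prems pow(1) by (intro Cons.IH) auto
    then show ?thesis using False pow(2) by simp
  qed
qed simp

lemma mono_act_Suc:
  assumes "i \<in> {1..n}" "f \<in> coord_ring (n + 1)"
  shows "mono_act n (root_x n) (m(i := Suc (m i))) f = mono_act n (root_x n) m (left_vf (n + 1) (root_x n i) f)"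
    and "mono_act n (root_y n) (m(i := Suc (m i))) f = mono_act n (root_y n) m (left_vf (n + 1) (root_y n i) f)"
  unfolding mono_act_def
  by (rule fold_funpow_Suc[where A = "coord_ring (n + 1)"];
      use assms in \<open>auto intro!: derivation_mem[OF derivation_DX] derivation_mem[OF derivation_DY]
        DX_commute DY_commute simp del: One_nat_def\<close>)+

lemma mono_act_0: "mono_act n Z (\<lambda>i. 0) f = f"
proof -
  have "fold (\<lambda>j f. f) js f = f" for js :: "nat list"
    by (induction js) auto
  then show ?thesis by (simp add: mono_act_def)
qed

lemma fps_mult_mult_nth:
  fixes a b c :: "'a::comm_ring_1 fps"
  shows "fps_nth (a * (b * c)) k =
    (\<Sum>(i, j)\<in>{(i, j). i + j \<le> k}. fps_nth a (k - (i + j)) * (fps_nth b i * fps_nth c j))"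
proof -
  have "fps_nth (a * (b * c)) k = (\<Sum>s\<in>{0..k}. \<Sum>i\<in>{0..s}. fps_nth a (k - s) * (fps_nth b i * fps_nth c (s - i)))"
    unfolding mult.commute[of a]
    by (simp only: fps_mult_nth sum_distrib_right, simp only: mult_ac)
  also have "\<dots> = (\<Sum>(s, i)\<in>(SIGMA s:{0..k}. {0..s}). fps_nth a (k - s) * (fps_nth b i * fps_nth c (s - i)))"
    by (simp add: sum.Sigma)
  also have "\<dots> = (\<Sum>(i, j)\<in>{(i, j). i + j \<le> k}. fps_nth a (k - (i + j)) * (fps_nth b i * fps_nth c j))"
    by (rule sum.reindex_bij_witness[where i = "\<lambda>(i, j). (i + j, i)" and j = "\<lambda>(s, i). (i, s - i)"]) auto
  finally show ?thesis .
qed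

lemma star_coeff_eq:
  assumes "lambda \<noteq> 0"
  shows "star_coeff n lambda m = degree_coeff lambda (mdeg n m) * fps_const (1 / (\<Prod>i=1..n. fact (m i)))"
proof -
  let ?P = "\<Prod>i=1..n. fact (m i) :: complex"
  let ?L = "\<Prod>j<mdeg n m. fps_const lambda - of_nat j * fps_X :: complex fps"
  have P: "(of_nat (\<Prod>i=1..n. fact (m i)) :: complex fps) = fps_const ?P"
    unfolding of_nat_eq_fps_const by (simp add: of_nat_prod)
  have "?P \<noteq> 0" by simp
  then have "fps_nth (fps_const ?P * ?L) 0 \<noteq> 0"
    using denominator_unit[OF assms, of "mdeg n m"] by simp
  then show ?thesis
    unfolding star_coeff_def degree_coeff_def P using denominator_unit[OF assms, of "mdeg n m"]
    by (simp add: fps_divide_unit fps_inverse_mult fps_const_inverse divide_inverse mult_ac)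
qed

text \<open>The definition truncates separately for each pair (i, j). Since multi-indices of higher
  degree contribute 0, one bound K serves all pairs, and the sum becomes a coefficient of a product
  of power series.\<close>

lemma star_nth:
  assumes lambda: "lambda \<noteq> 0" and k: "k \<le> K"
  shows "fps_nth (star n lambda F G p) k =
    fps_nth (\<Sum>m\<in>{m \<in> multi_indices n. mdeg n m \<le> K}. star_coeff n lambda m *
      (coeffwise (mono_act n (root_x n) m) F p * coeffwise (mono_act n (root_y n) m) G p)) k"
proof -
  let ?M = "\<lambda>k. {m \<in> multi_indices n. mdeg n m \<le> k}"
  let ?x = "\<lambda>m i. mono_act n (root_x n) m (coeff_fun i F) p"
  let ?y = "\<lambda>m j. mono_act n (root_y n) m (coeff_fun j G) p"
  have trunc: "fps_nth (star_fun n lambda (coeff_fun i F) (coeff_fun j G) p) q =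
      (\<Sum>m\<in>?M K. fps_nth (star_coeff n lambda m) q * (?x m i * ?y m j))" if "q \<le> K" for q i j
    unfolding star_fun_def fps_nth_Abs_fps
    by (rule sum.mono_neutral_left[OF finite_multi_indices])
      (use that star_coeff_eq_0[OF lambda] in \<open>auto simp: not_le\<close>)
  have "fps_nth (star n lambda F G p) k = (\<Sum>(i, j)\<in>{(i, j). i + j \<le> k}.
      \<Sum>m\<in>?M K. fps_nth (star_coeff n lambda m) (k - (i + j)) * (?x m i * ?y m j))"
    unfolding star_def fps_nth_Abs_fps using k by (intro sum.cong refl) (auto simp: trunc)
  also have "\<dots> = (\<Sum>m\<in>?M K. \<Sum>(i, j)\<in>{(i, j). i + j \<le> k}.
      fps_nth (star_coeff n lambda m) (k - (i + j)) * (?x m i * ?y m j))"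
    unfolding split_def by (rule sum.swap)
  also have "\<dots> = (\<Sum>m\<in>?M K. fps_nth (star_coeff n lambda m *
      (coeffwise (mono_act n (root_x n) m) F p * coeffwise (mono_act n (root_y n) m) G p)) k)"
    unfolding fps_mult_mult_nth by (simp add: coeffwise_def)
  finally show ?thesis by (simp add: fps_sum_nth)
qed

abbreviation "series n \<equiv> series_over (coord_ring (n + 1))"

abbreviation "x_field n \<equiv> \<lambda>i. coeffwise (left_vf (n + 1) (root_x n i))"
abbreviation "y_field n \<equiv> \<lambda>i. coeffwise (left_vf (n + 1) (root_y n i))"
abbreviation "root_pairing n \<equiv> pairing {1..n} (x_field n) (y_field n)"

lemma coeffwise_mono_act_Suc:
  assumes "i \<in> {1..n}" "F \<in> series n"
  shows "coeffwise (mono_act n (root_x n) (m(i := Suc (m i)))) F = coeffwise (mono_act n (root_x n) m) (x_field n i F)"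
    and "coeffwise (mono_act n (root_y n) (m(i := Suc (m i)))) F = coeffwise (mono_act n (root_y n) m) (y_field n i F)"
  using assms by (auto intro!: series_eqI mono_act_Suc simp: series_coeff simp del: One_nat_def)

text \<open>The multinomial theorem for \<Omega>^d / d!, with the factor d + 1 of
  \<open>multinomial_Suc\<close> divided out in each step.\<close>

lemma sum_multi_indices_pairing:
  assumes "F \<in> series n" "G \<in> series n"
  shows "(\<Sum>m | m \<in> multi_indices n \<and> mdeg n m = d. fps_const (1 / (\<Prod>i=1..n. fact (m i))) *
      (coeffwise (mono_act n (root_x n) m) F p * coeffwise (mono_act n (root_y n) m) G p)) =
    fps_const (1 / fact d) * root_pairing n d F G p"
  using assms
proof (induction d arbitrary: F G)
  case 0
  have "{m. m \<in> multi_indices n \<and> mdeg n m = 0} = {\<lambda>i. 0}"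
    by (auto simp: multi_indices_def mdeg_def fun_eq_iff) (metis atLeastAtMost_iff)
  moreover have "coeffwise (mono_act n Z (\<lambda>i. 0)) F = F" for Z F
    by (rule series_eqI) (simp add: mono_act_0)
  ultimately show ?case by simp
next
  case (Suc d)
  let ?S = "\<Sum>m | m \<in> multi_indices n \<and> mdeg n m = Suc d. fps_const (1 / (\<Prod>i=1..n. fact (m i))) *
      (coeffwise (mono_act n (root_x n) m) F p * coeffwise (mono_act n (root_y n) m) G p)"
  have "of_nat (Suc d) * ?S = (\<Sum>i\<in>{1..n}. fps_const (1 / fact d) * root_pairing n d (x_field n i F) (y_field n i G) p)"
    unfolding multinomial_Suc
  proof (rule sum.cong[OF refl])
    fix i assume i: "i \<in> {1..n}"
    show "(\<Sum>m | m \<in> multi_indices n \<and> mdeg n m = d. fps_const (1 / (\<Prod>i=1..n. fact (m i))) *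
        (coeffwise (mono_act n (root_x n) (m(i := Suc (m i)))) F p *
         coeffwise (mono_act n (root_y n) (m(i := Suc (m i)))) G p)) =
      fps_const (1 / fact d) * root_pairing n d (x_field n i F) (y_field n i G) p"
      unfolding coeffwise_mono_act_Suc[OF i Suc.prems(1)] coeffwise_mono_act_Suc[OF i Suc.prems(2)]
      using Suc.prems i by (intro Suc.IH fields.mem)
  qed
  then have "of_nat (Suc d) * ?S = fps_const (1 / fact d) * root_pairing n (Suc d) F G p"
    by (simp add: sum_distrib_left)
  then have "fps_const (1 / of_nat (Suc d)) * (fps_const (of_nat (Suc d)) * ?S) =
      fps_const (1 / of_nat (Suc d)) * (fps_const (1 / fact d) * root_pairing n (Suc d) F G p)"
    unfolding of_nat_eq_fps_const by (rule arg_cong)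
  then show ?case
    unfolding mult.assoc[symmetric] fps_const_mult by (simp del: of_nat_Suc pairing.simps add: mult.commute)
qed

text \<open>A finite combination of pairings, to which the algebra of pairings applies literally; it
  agrees with \<open>star\<close> through order K in t.\<close>

definition star_trunc ::
  "nat \<Rightarrow> complex \<Rightarrow> nat \<Rightarrow> (complex mat \<Rightarrow> complex fps) \<Rightarrow> (complex mat \<Rightarrow> complex fps) \<Rightarrow> complex mat \<Rightarrow> complex fps" where
  "star_trunc n lambda K F G = (\<lambda>p. \<Sum>d\<in>{..K}. degree_coeff lambda d * fps_const (1 / fact d) * root_pairing n d F G p)"

context
  fixes n :: nat and lambda :: complex
  assumes lambda: "lambda \<noteq> 0"
  notes One_nat_def [simp del]
begin

lemma star_nth_trunc:
  assumes "k \<le> K" and FG: "F \<in> series n" "G \<in> series n"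
  shows "fps_nth (star n lambda F G p) k = fps_nth (star_trunc n lambda K F G p) k"
proof -
  let ?M = "{m \<in> multi_indices n. mdeg n m \<le> K}"
  let ?w = "\<lambda>m. fps_const (1 / (\<Prod>i=1..n. fact (m i))) *
      (coeffwise (mono_act n (root_x n) m) F p * coeffwise (mono_act n (root_y n) m) G p)"
  have "(\<Sum>m\<in>?M. star_coeff n lambda m *
      (coeffwise (mono_act n (root_x n) m) F p * coeffwise (mono_act n (root_y n) m) G p)) =
    (\<Sum>m\<in>?M. degree_coeff lambda (mdeg n m) * ?w m)"
    by (simp add: star_coeff_eq[OF lambda] mult.assoc)
  also have "\<dots> = (\<Sum>d\<in>{..K}. \<Sum>m\<in>{m \<in> ?M. mdeg n m = d}. degree_coeff lambda (mdeg n m) * ?w m)"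
    by (rule sum.group[symmetric]) (auto simp: finite_multi_indices)
  also have "\<dots> = (\<Sum>d\<in>{..K}. degree_coeff lambda d * fps_const (1 / fact d) * root_pairing n d F G p)"
  proof (rule sum.cong[OF refl])
    fix d assume "d \<in> {..K}"
    then have "{m \<in> ?M. mdeg n m = d} = {m. m \<in> multi_indices n \<and> mdeg n m = d}" by auto
    then have "(\<Sum>m\<in>{m \<in> ?M. mdeg n m = d}. degree_coeff lambda (mdeg n m) * ?w m) =
        degree_coeff lambda d * (\<Sum>m | m \<in> multi_indices n \<and> mdeg n m = d. ?w m)"
      unfolding sum_distrib_left by (intro sum.cong) auto
    then show "(\<Sum>m\<in>{m \<in> ?M. mdeg n m = d}. degree_coeff lambda (mdeg n m) * ?w m) =
        degree_coeff lambda d * fps_const (1 / fact d) * root_pairing n d F G p"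
      by (simp only: sum_multi_indices_pairing[OF FG] mult.assoc)
  qed
  finally show ?thesis
    unfolding star_nth[OF lambda assms(1)] star_trunc_def by simp
qed

lemma coeff_star:
  assumes "k \<le> K" "F \<in> series n" "G \<in> series n"
  shows "coeff_fun k (star n lambda F G) = coeff_fun k (star_trunc n lambda K F G)"
  using star_nth_trunc[OF assms] by (simp add: coeff_fun_def)

lemma star_trunc_mem: "F \<in> series n \<Longrightarrow> G \<in> series n \<Longrightarrow> star_trunc n lambda K F G \<in> series n"
  unfolding star_trunc_def
  by (intro function_algebra_sum[OF function_algebra_series_coord_ring] fields.mem fields.pair_mem)

lemma star_mem: "F \<in> series n \<Longrightarrow> G \<in> series n \<Longrightarrow> star n lambda F G \<in> series n"
  using star_trunc_mem[THEN series_coeff] by (auto simp: series_over_def coeff_star[OF order_refl])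

lemma star_eqI:
  assumes "F \<in> series n" "G \<in> series n"
    and "\<And>K. coeff_fun K (star_trunc n lambda K F G) = coeff_fun K H"
  shows "star n lambda F G = H"
  using assms by (intro series_eqI) (simp add: coeff_star[OF order_refl])

lemma star_add_left:
  assumes "F \<in> series n" "F' \<in> series n" "G \<in> series n"
  shows "star n lambda (\<lambda>p. F p + F' p) G = (\<lambda>p. star n lambda F G p + star n lambda F' G p)"
proof (rule star_eqI)
  show "coeff_fun K (star_trunc n lambda K (\<lambda>p. F p + F' p) G) =
      coeff_fun K (\<lambda>p. star n lambda F G p + star n lambda F' G p)" for K
    unfolding coeff_fun_add coeff_star[OF order_refl assms(1,3)] coeff_star[OF order_refl assms(2,3)]
    unfolding coeff_fun_add[symmetric] star_trunc_def fields.pair_add_left[OF assms]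
    by (simp add: distrib_left sum.distrib)
qed (use assms fields.mem in auto)

lemma star_add_right:
  assumes "F \<in> series n" "G \<in> series n" "G' \<in> series n"
  shows "star n lambda F (\<lambda>p. G p + G' p) = (\<lambda>p. star n lambda F G p + star n lambda F G' p)"
proof (rule star_eqI)
  show "coeff_fun K (star_trunc n lambda K F (\<lambda>p. G p + G' p)) =
      coeff_fun K (\<lambda>p. star n lambda F G p + star n lambda F G' p)" for K
    unfolding coeff_fun_add coeff_star[OF order_refl assms(1,2)] coeff_star[OF order_refl assms(1,3)]
    unfolding coeff_fun_add[symmetric] star_trunc_def fields.pair_add_right[OF assms]
    by (simp add: distrib_left sum.distrib)
qed (use assms fields.mem in auto)

text \<open>Multiplication by a power series mixes the orders up to K, so agreement with the partial
  sum is used at all of them.\<close>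

lemma coeff_scale_star:
  assumes "F \<in> series n" "G \<in> series n"
  shows "coeff_fun K (\<lambda>p. a * star n lambda F G p) = coeff_fun K (\<lambda>p. a * star_trunc n lambda K F G p)"
  unfolding coeff_fun_scale using coeff_star[OF diff_le_self assms] by (simp only:)

lemma star_scale_left:
  assumes "F \<in> series n" "G \<in> series n"
  shows "star n lambda (\<lambda>p. a * F p) G = (\<lambda>p. a * star n lambda F G p)"
proof (rule star_eqI)
  show "coeff_fun K (star_trunc n lambda K (\<lambda>p. a * F p) G) = coeff_fun K (\<lambda>p. a * star n lambda F G p)" for K
    unfolding coeff_scale_star[OF assms] star_trunc_def fields.pair_scale_left[OF assms]
    by (simp add: sum_distrib_left mult_ac)
qed (use assms fields.mem in auto)

lemma star_scale_right:
  assumes "F \<in> series n" "G \<in> series n"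
  shows "star n lambda F (\<lambda>p. a * G p) = (\<lambda>p. a * star n lambda F G p)"
proof (rule star_eqI)
  show "coeff_fun K (star_trunc n lambda K F (\<lambda>p. a * G p)) = coeff_fun K (\<lambda>p. a * star n lambda F G p)" for K
    unfolding coeff_scale_star[OF assms] star_trunc_def fields.pair_scale_right[OF assms]
    by (simp add: sum_distrib_left mult_ac)
qed (use assms fields.mem in auto)

lemma star_0:
  assumes "F \<in> series n" "G \<in> series n"
  shows "coeff_fun 0 (star n lambda F G) = (\<lambda>p. coeff_fun 0 F p * coeff_fun 0 G p)"
  unfolding coeff_star[OF order_refl assms] star_trunc_def by (simp add: coeff_fun_mult)

text \<open>Continuity in the t-adic sense. It allows the inner factor of a double product to be
  replaced by its partial sum.\<close>

lemma star_nth_cong: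
  assumes "\<And>i. i \<le> k \<Longrightarrow> coeff_fun i F = coeff_fun i F'" "\<And>i. i \<le> k \<Longrightarrow> coeff_fun i G = coeff_fun i G'"
  shows "coeff_fun k (star n lambda F G) = coeff_fun k (star n lambda F' G')"
proof -
  have "(\<Sum>(i, j)\<in>{(i, j). i + j \<le> k}.
       fps_nth (star_fun n lambda (coeff_fun i F) (coeff_fun j G) p) (k - (i + j))) =
    (\<Sum>(i, j)\<in>{(i, j). i + j \<le> k}.
       fps_nth (star_fun n lambda (coeff_fun i F') (coeff_fun j G') p) (k - (i + j)))" for p
    using assms by (intro sum.cong) auto
  then show ?thesis
    unfolding coeff_fun_def[of k "star n lambda F G"] coeff_fun_def[of k "star n lambda F' G'"]
    unfolding star_def fps_nth_Abs_fps by (rule ext)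
qed

lemma star_assoc:
  assumes F: "F \<in> series n" and G: "G \<in> series n" and H: "H \<in> series n"
    and inv: "\<And>i j. i \<in> {1..n} \<Longrightarrow> j \<in> {1..n} \<Longrightarrow> x_field n j (y_field n i G) = y_field n i (x_field n j G)"
  shows "star n lambda (star n lambda F G) H = star n lambda F (star n lambda G H)"
proof (rule series_eqI)
  fix K
  let ?c = "degree_coeff lambda" and ?r = "\<lambda>a. fps_const (1 / fact a) :: complex fps"
  have mem: "(\<lambda>p. ?c b * ?r b * root_pairing n b F' G' p) \<in> series n"
    if "F' \<in> series n" "G' \<in> series n" for b F' G'
    using that by (intro fields.mem fields.pair_mem)
  have left: "star_trunc n lambda K (star_trunc n lambda K F G) H p =
      (\<Sum>a\<le>K. \<Sum>b\<le>K. ?c a * ?c b * (?r a * ?r b * root_pairing n a (root_pairing n b F G) H p))" for p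
    unfolding star_trunc_def
    by (subst fields.pair_sum_left[OF mem[OF F G] H])
      (simp only: fields.pair_scale_left[OF fields.pair_mem[OF F G] H], simp only: sum_distrib_left mult_ac)
  have right: "star_trunc n lambda K F (star_trunc n lambda K G H) p =
      (\<Sum>a\<le>K. \<Sum>b\<le>K. ?c a * ?c b * (?r a * ?r b * root_pairing n a F (root_pairing n b G H) p))" for p
    unfolding star_trunc_def
    by (subst fields.pair_sum_right[OF mem[OF G H] F])
      (simp only: fields.pair_scale_right[OF F fields.pair_mem[OF G H]], simp only: sum_distrib_left mult_ac)
  have "coeff_fun K (star n lambda (star n lambda F G) H) = coeff_fun K (star n lambda (star_trunc n lambda K F G) H)"
    by (rule star_nth_cong) (rule coeff_star[OF _ F G], assumption, rule refl)
  also have "\<dots> = coeff_fun K (star_trunc n lambda K (star_trunc n lambda K F G) H)"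
    by (rule coeff_star[OF order_refl star_trunc_mem[OF F G] H])
  also have "\<dots> = coeff_fun K (star_trunc n lambda K F (star_trunc n lambda K G H))"
    unfolding coeff_fun_def
  proof
    fix p
    \<comment> \<open>Both sides are expanded in the values at (F, G, H) of the threefold product
      acted on by X^j Y^m W^e. The hypothesis \<open>inv\<close> on the middle factor enters through
      the normal ordering of the left side.\<close>
    show "fps_nth (star_trunc n lambda K (star_trunc n lambda K F G) H p) K =
        fps_nth (star_trunc n lambda K F (star_trunc n lambda K G H) p) K"
      by (simp only: left right fields.pair_pair_left[OF F G H] inv fields.pair_pair_right[OF F G H],
        rule associativity_sum[OF lambda order_refl, where u = "\<lambda>e j m.
        (fields.X n ^^ j) ((fields.Y n ^^ m) ((fields.W n ^^ e) (fields.T0 n p))) F G H"])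
  qed
  also have "\<dots> = coeff_fun K (star n lambda F (star_trunc n lambda K G H))"
    by (rule coeff_star[OF order_refl F star_trunc_mem[OF G H], symmetric])
  also have "\<dots> = coeff_fun K (star n lambda F (star n lambda G H))"
    by (rule star_nth_cong) (rule refl, rule coeff_star[OF _ G H, symmetric])
  finally show "coeff_fun K (star n lambda (star n lambda F G) H) = coeff_fun K (star n lambda F (star n lambda G H))" .
qed

text \<open>The matrix \<open>a\<close> describes the action of D on the x, and minus its transpose
  the action on the y. This covers the Levi subalgebra, where it is \<open>levi_action\<close>, and
  the right fields, where it is 0.\<close>

lemma star_derivation:
  assumes D: "derivation_on (coord_ring (n + 1)) D"
    and Dx: "\<And>i f. i \<in> {1..n} \<Longrightarrow> f \<in> coord_ring (n + 1) \<Longrightarrow> D (left_vf (n + 1) (root_x n i) f) =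
      (\<lambda>p. left_vf (n + 1) (root_x n i) (D f) p + (\<Sum>l\<in>{1..n}. a i l * left_vf (n + 1) (root_x n l) f p))"
    and Dy: "\<And>i f. i \<in> {1..n} \<Longrightarrow> f \<in> coord_ring (n + 1) \<Longrightarrow> D (left_vf (n + 1) (root_y n i) f) =
      (\<lambda>p. left_vf (n + 1) (root_y n i) (D f) p + (\<Sum>l\<in>{1..n}. - a l i * left_vf (n + 1) (root_y n l) f p))"
    and F: "F \<in> series n" and G: "G \<in> series n"
  shows "coeffwise D (star n lambda F G) =
    (\<lambda>p. star n lambda (coeffwise D F) G p + star n lambda F (coeffwise D G) p)"
proof (rule series_eqI)
  fix K
  let ?D = "coeffwise D"
  note S = function_algebra_series_coord_ring
  have D': "derivation_on (series n) ?D"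
    by (rule derivation_coeffwise[OF function_algebra_coord_ring D])
  have DQ: "?D (root_pairing n d F G) = (\<lambda>p. root_pairing n d (?D F) G p + root_pairing n d F (?D G) p)" for d
  proof (rule fields.derivation_pair[OF D' _ _ F G, where a = "\<lambda>i l. fps_const (a i l)"])
    fix i H assume i: "i \<in> {1..n}" and H: "H \<in> series n"
    show "?D (x_field n i H) = (\<lambda>p. x_field n i (?D H) p + (\<Sum>l\<in>{1..n}. fps_const (a i l) * x_field n l H p))"
      by (rule series_eqI)
        (simp only: coeff_fun_add coeff_fun_sum coeff_fun_const_scale coeff_fun_coeffwise Dx[OF i series_coeff[OF H]])
    show "?D (y_field n i H) = (\<lambda>p. y_field n i (?D H) p + (\<Sum>l\<in>{1..n}. - fps_const (a l i) * y_field n l H p))"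
      by (rule series_eqI)
        (simp only: coeff_fun_add coeff_fun_sum coeff_fun_const_scale fps_const_neg coeff_fun_coeffwise Dy[OF i series_coeff[OF H]])
  qed
  have mem: "?D F \<in> series n" "?D G \<in> series n"
    using derivation_mem[OF D'] F G by auto
  have "?D (star_trunc n lambda K F G) = (\<lambda>p. \<Sum>d\<in>{..K}. ?D (\<lambda>p. degree_coeff lambda d * fps_const (1 / fact d) * root_pairing n d F G p) p)"
    unfolding star_trunc_def by (rule derivation_sum[OF S D']) (intro fields.mem fields.pair_mem F G)
  also have "\<dots> = (\<lambda>p. star_trunc n lambda K (?D F) G p + star_trunc n lambda K F (?D G) p)"
    unfolding derivation_scale[OF D' fields.pair_mem[OF F G]] DQ star_trunc_def
    by (simp add: distrib_left sum.distrib)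
  finally have "?D (star_trunc n lambda K F G) = (\<lambda>p. star_trunc n lambda K (?D F) G p + star_trunc n lambda K F (?D G) p)" .
  then have "coeff_fun K (?D (star_trunc n lambda K F G)) =
      coeff_fun K (\<lambda>p. star_trunc n lambda K (?D F) G p + star_trunc n lambda K F (?D G) p)"
    by (rule arg_cong)
  then show "coeff_fun K (?D (star n lambda F G)) =
      coeff_fun K (\<lambda>p. star n lambda (?D F) G p + star n lambda F (?D G) p)"
    by (simp only: coeff_fun_add coeff_fun_coeffwise coeff_star[OF order_refl] F G mem)
qed

section \<open>Levi invariants under the star product\<close>

lemma invariants_coord_ring: "f \<in> levi_invariants n \<Longrightarrow> f \<in> coord_ring (n + 1)"
  by (simp add: levi_invariants_def)

lemma series_invariants: "F \<in> series_over (levi_invariants n) \<Longrightarrow> F \<in> series n"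
  by (simp add: series_over_def invariants_coord_ring)

text \<open>Levi elements are derivations of the product and kill both factors.\<close>

lemma star_invariants:
  assumes F: "F \<in> series_over (levi_invariants n)" and G: "G \<in> series_over (levi_invariants n)"
  shows "star n lambda F G \<in> series_over (levi_invariants n)"
  unfolding series_over_def mem_Collect_eq levi_invariants_def
proof (intro allI CollectI conjI ballI)
  fix k
  note FG = series_invariants[OF F] series_invariants[OF G]
  show "coeff_fun k (star n lambda F G) \<in> coord_ring (n + 1)"
    using star_mem[OF FG] by (rule series_coeff)
  fix Z assume Z: "Z \<in> levi n"
  have 0: "coeffwise (left_vf (n + 1) Z) H = (\<lambda>p. 0)" if "H \<in> series_over (levi_invariants n)" for H
    using series_coeff[OF that] Z by (intro series_eqI) (auto simp: coeff_fun_zero levi_invariants_def)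
  have "coeffwise (left_vf (n + 1) Z) (star n lambda F G) =
      (\<lambda>p. star n lambda (\<lambda>p. 0) G p + star n lambda F (\<lambda>p. 0) p)"
    using star_derivation[OF derivation_left_vf[OF levi_carrier[OF Z]] levi_DX[OF Z] levi_DY[OF Z] FG]
    by (simp only: 0[OF F] 0[OF G])
  also have "\<dots> = (\<lambda>p. 0)"
    using star_scale_left[OF FG, of 0] star_scale_right[OF FG, of 0] by (simp add: fun_eq_iff)
  finally have "coeff_fun k (coeffwise (left_vf (n + 1) Z) (star n lambda F G)) = coeff_fun k (\<lambda>p. 0)"
    by simp
  then show "left_vf (n + 1) Z (coeff_fun k (star n lambda F G)) = (\<lambda>g. 0)"
    by (simp add: coeff_fun_zero)
qed

lemma star_product_star: "star_product (levi_invariants n) (star n lambda)"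
  unfolding star_product_def
proof (intro conjI ballI allI)
  fix F G H
  assume F: "F \<in> series_over (levi_invariants n)" and G: "G \<in> series_over (levi_invariants n)"
    and H: "H \<in> series_over (levi_invariants n)"
  show "star n lambda (star n lambda F G) H = star n lambda F (star n lambda G H)"
  proof (rule star_assoc)
    fix i j assume "i \<in> {1..n}" "j \<in> {1..n}"
    then show "x_field n j (y_field n i G) = y_field n i (x_field n j G)"
      by (intro series_eqI) (simp only: coeff_fun_coeffwise DX_DY_invariant series_coeff[OF G])
  qed (use F G H in \<open>auto intro: series_invariants\<close>)
qed (auto simp: star_invariants star_add_left star_add_right star_scale_left star_scale_right star_0 series_invariants)

section \<open>Invariance under the right co-regular action\<close>

lemma right_vf_invariants:
  assumes X: "X \<in> gl (n + 1)" and f: "f \<in> levi_invariants n"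
  shows "right_vf (n + 1) X f \<in> levi_invariants n"
  unfolding levi_invariants_def
proof (intro CollectI conjI ballI)
  note D = derivation_right_vf[OF X] and c = invariants_coord_ring[OF f]
  show "right_vf (n + 1) X f \<in> coord_ring (n + 1)" by (rule derivation_mem[OF D c])
  fix Z assume Z: "Z \<in> levi n"
  have "left_vf (n + 1) Z (right_vf (n + 1) X f) = right_vf (n + 1) X (\<lambda>g. 0)"
    using left_vf_right_vf_commute[OF levi_carrier[OF Z] X c] f Z by (simp add: levi_invariants_def)
  then show "left_vf (n + 1) Z (right_vf (n + 1) X f) = (\<lambda>g. 0)"
    by (simp add: derivation_zero[OF function_algebra_coord_ring D])
qed

lemma right_word_invariants:
  "w \<in> lists (gl (n + 1)) \<Longrightarrow> f \<in> levi_invariants n \<Longrightarrow> right_word (n + 1) w f \<in> levi_invariants n"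
  unfolding right_word_def by (induction w arbitrary: f) (auto simp: right_vf_invariants simp del: add_Suc_right)

lemma star_right_vf:
  assumes X: "X \<in> gl (n + 1)" and F: "F \<in> series n" and G: "G \<in> series n"
  shows "coeffwise (right_vf (n + 1) X) (star n lambda F G) =
    (\<lambda>p. star n lambda (coeffwise (right_vf (n + 1) X) F) G p + star n lambda F (coeffwise (right_vf (n + 1) X) G) p)"
proof (rule star_derivation[where a = "\<lambda>i l. 0", OF derivation_right_vf[OF X] _ _ F G])
  fix i f assume "i \<in> {1..n}" "f \<in> coord_ring (n + 1)"
  then show "right_vf (n + 1) X (left_vf (n + 1) (root_x n i) f) =
      (\<lambda>p. left_vf (n + 1) (root_x n i) (right_vf (n + 1) X f) p + (\<Sum>l\<in>{1..n}. 0 * left_vf (n + 1) (root_x n l) f p))"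
    "right_vf (n + 1) X (left_vf (n + 1) (root_y n i) f) =
      (\<lambda>p. left_vf (n + 1) (root_y n i) (right_vf (n + 1) X f) p + (\<Sum>l\<in>{1..n}. - 0 * left_vf (n + 1) (root_y n l) f p))"
    using left_vf_right_vf_commute[OF root_carrier(1) X] left_vf_right_vf_commute[OF root_carrier(2) X]
    by (simp_all del: One_nat_def)
qed

text \<open>The iterated Leibniz rule. The induction runs from the end of the word, since the last
  letter is the last operator applied. A set J of old positions gives rise to two new ones: J
  itself, with the new letter on G, and J with the last position inserted, with the new letter on
  F.\<close>

lemma star_right_word:
  assumes "w \<in> lists (gl (n + 1))"
    and F: "F \<in> series_over (levi_invariants n)" and G: "G \<in> series_over (levi_invariants n)"
  shows "coeffwise (right_word (n + 1) w) (star n lambda F G) = (\<lambda>p. \<Sum>J\<in>Pow {..<length w}.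
    star n lambda (coeffwise (right_word (n + 1) (nths w J)) F) (coeffwise (right_word (n + 1) (nths w (- J))) G) p)"
  using assms(1)
proof (induction w rule: rev_induct)
  case Nil
  have "coeffwise (right_word (n + 1) []) H = H" for H
    by (rule series_eqI) (simp add: right_word_def)
  then show ?case by simp
next
  case (snoc X w)
  let ?W = "\<lambda>w. coeffwise (right_word (n + 1) w)" and ?R = "coeffwise (right_vf (n + 1) X)"
  let ?l = "length w"
  have w: "w \<in> lists (gl (n + 1))" and X: "X \<in> gl (n + 1)" using snoc.prems by auto
  have D: "derivation_on (series n) ?R"
    by (intro derivation_coeffwise function_algebra_coord_ring derivation_right_vf X)
  have app: "?W (v @ [X]) H = ?R (?W v H)" for v H
    by (rule series_eqI) (simp add: right_word_def)
  have mem: "?W (nths w J) H \<in> series n" if "H \<in> series_over (levi_invariants n)" for J H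
  proof -
    have "nths w J \<in> lists (gl (n + 1))" using w by (auto dest: in_set_nthsD)
    then show ?thesis
      using series_coeff[OF that]
      by (auto simp: series_over_def intro!: invariants_coord_ring right_word_invariants simp del: add_Suc_right)
  qed
  have subwords: "nths (w @ [X]) J = nths w J" "nths (w @ [X]) (- J) = nths w (- J) @ [X]"
    "nths (w @ [X]) (insert ?l J) = nths w J @ [X]" "nths (w @ [X]) (- insert ?l J) = nths w (- J)"
    if "J \<in> Pow {..<?l}" for J
  proof -
    \<comment> \<open>Position \<open>?l\<close> lies beyond the end of w, so its membership does
      not affect subwords of w.\<close>
    have "nths w (insert ?l J) = nths w J" "nths w (- insert ?l J) = nths w (- J)"
      unfolding nths_def by (auto intro!: arg_cong[of _ _ "map fst"] filter_cong dest: set_zip_rightD)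
    moreover have "?l \<notin> J" using that by auto
    ultimately show "nths (w @ [X]) J = nths w J" "nths (w @ [X]) (- J) = nths w (- J) @ [X]"
      "nths (w @ [X]) (insert ?l J) = nths w J @ [X]" "nths (w @ [X]) (- insert ?l J) = nths w (- J)"
      by (simp_all add: nths_append)
  qed
  let ?g = "\<lambda>J p. star n lambda (?W (nths (w @ [X]) J) F) (?W (nths (w @ [X]) (- J)) G) p"
  have "?W (w @ [X]) (star n lambda F G) =
      ?R (\<lambda>p. \<Sum>J\<in>Pow {..<?l}. star n lambda (?W (nths w J) F) (?W (nths w (- J)) G) p)"
    by (simp only: app snoc.IH[OF w])
  also have "\<dots> = (\<lambda>p. \<Sum>J\<in>Pow {..<?l}. ?R (star n lambda (?W (nths w J) F) (?W (nths w (- J)) G)) p)"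
    by (rule derivation_sum[OF function_algebra_series_coord_ring D]) (intro star_mem mem F G)
  also have "\<dots> = (\<lambda>p. \<Sum>J\<in>Pow {..<?l}. ?g (insert ?l J) p + ?g J p)"
    by (intro ext sum.cong refl) (simp only: star_right_vf[OF X mem[OF F] mem[OF G]] subwords app)
  also have "\<dots> = (\<lambda>p. \<Sum>J\<in>Pow {..<length (w @ [X])}. ?g J p)"
  proof
    fix p
    have inj: "inj_on (insert ?l) (Pow {..<?l})"
      by (rule inj_onI) (metis Diff_insert_absorb PowD lessThan_iff less_irrefl subsetD)
    have "Pow {..<length (w @ [X])} = Pow {..<?l} \<union> insert ?l ` Pow {..<?l}"
      by (simp add: lessThan_Suc Pow_insert)
    moreover have "Pow {..<?l} \<inter> insert ?l ` Pow {..<?l} = {}" by auto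
    ultimately show "(\<Sum>J\<in>Pow {..<?l}. ?g (insert ?l J) p + ?g J p) = (\<Sum>J\<in>Pow {..<length (w @ [X])}. ?g J p)"
      by (simp add: sum.union_disjoint sum.reindex[OF inj] sum.distrib add.commute)
  qed
  finally show ?case .
qed

lemma right_U_invariant_star: "right_U_invariant (n + 1) (levi_invariants n) (star n lambda)"
  unfolding right_U_invariant_def
proof (intro conjI ballI)
  fix u f assume u: "u \<in> U_reps (n + 1)" and f: "f \<in> levi_invariants n"
  then have w: "right_word (n + 1) w f \<in> levi_invariants n" if "w \<in> Poly_Mapping.keys u" for w
    using that by (intro right_word_invariants) (auto simp: U_reps_def)
  show "right_U (n + 1) u f \<in> levi_invariants n"
    unfolding levi_invariants_def right_U_def
  proof (intro CollectI conjI ballI)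
    show "(\<lambda>g. \<Sum>w\<in>Poly_Mapping.keys u. Poly_Mapping.lookup u w * right_word (n + 1) w f g) \<in> coord_ring (n + 1)"
      by (intro function_algebra_sum function_algebra_scale function_algebra_coord_ring invariants_coord_ring w)
    fix Z assume Z: "Z \<in> levi n"
    note D = derivation_left_vf[OF levi_carrier[OF Z]]
    have "left_vf (n + 1) Z (\<lambda>g. \<Sum>w\<in>Poly_Mapping.keys u. Poly_Mapping.lookup u w * right_word (n + 1) w f g) =
      (\<lambda>g. \<Sum>w\<in>Poly_Mapping.keys u. left_vf (n + 1) Z (\<lambda>g. Poly_Mapping.lookup u w * right_word (n + 1) w f g) g)"
      by (intro derivation_sum[OF function_algebra_coord_ring D] function_algebra_scale
          function_algebra_coord_ring invariants_coord_ring w)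
    also have "\<dots> = (\<lambda>g. \<Sum>w\<in>Poly_Mapping.keys u. 0)"
    proof (intro ext sum.cong refl)
      fix g v assume v: "v \<in> Poly_Mapping.keys u"
      show "left_vf (n + 1) Z (\<lambda>g. Poly_Mapping.lookup u v * right_word (n + 1) v f g) g = 0"
        using derivation_scale[OF D invariants_coord_ring[OF w[OF v]]] w[OF v] Z
        by (simp add: levi_invariants_def)
    qed
    finally show "left_vf (n + 1) Z (\<lambda>g. \<Sum>w\<in>Poly_Mapping.keys u. Poly_Mapping.lookup u w * right_word (n + 1) w f g) = (\<lambda>g. 0)"
      by simp
  qed
next
  fix u F G assume u: "u \<in> U_reps (n + 1)"
    and FG: "F \<in> series_over (levi_invariants n)" "G \<in> series_over (levi_invariants n)"
  show "coeffwise (right_U (n + 1) u) (star n lambda F G) = right_U_coprod (n + 1) u (star n lambda) F G"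
  proof (rule series_eqI)
    fix k
    have word: "right_word (n + 1) w (coeff_fun k (star n lambda F G)) = (\<lambda>p. \<Sum>J\<in>Pow {..<length w}.
        coeff_fun k (star n lambda (coeffwise (right_word (n + 1) (nths w J)) F)
          (coeffwise (right_word (n + 1) (nths w (- J))) G)) p)"
      if "w \<in> Poly_Mapping.keys u" for w
    proof -
      have "w \<in> lists (gl (n + 1))" using that u by (auto simp: U_reps_def)
      from arg_cong[OF star_right_word[OF this FG], of "coeff_fun k"] show ?thesis
        by (simp only: coeff_fun_coeffwise coeff_fun_sum)
    qed
    show "coeff_fun k (coeffwise (right_U (n + 1) u) (star n lambda F G)) =
        coeff_fun k (right_U_coprod (n + 1) u (star n lambda) F G)"
      unfolding coeff_fun_coeffwise right_U_def right_U_coprod_def coeff_fun_sum coeff_fun_const_scale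
      by (intro ext sum.cong refl) (simp only: word)
  qed
qed

end

theorem corollary6p4:
  fixes n :: nat and lambda :: complex
  assumes "lambda \<noteq> 0"
  shows "star_product (levi_invariants n) (star n lambda) \<and>
         right_U_invariant (n + 1) (levi_invariants n) (star n lambda)"
  using star_product_star[OF assms] right_U_invariant_star[OF assms] by blast

end
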